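(* In the battery-sharing model described in the context, suppose all users are net generative, i.e. $\Delta_i>0$ for all $i\in[n]$. Then $$\limsup_{b_{\max}\to\infty}\frac{\log(\mathrm{LLR}_o)}{b_{\max}}=-c,$$ where $\mathrm{LLR}_o=\mathrm{LLR}_o(b_{\max})$ is the optimal system loss of load rate under the fairness constraints for battery size $b_{\max}$, and $c$ is a positive constant.
   Context: Notation: $[n]=\{1,\dots,n\}$; $\mathbb{I}\{\cdot\}$ denotes an indicator. Net generation. There are $n$ users. The net generation of user $i$ at discrete time $t$ is $X_i(t)\in S_i\subset\mathbb{Z}$ (positive: surplus; negative: deficit), where $S_i$ has $\max S_i>0$ and $\min S_i<0$. The vector $X(t)=(X_1(t),\dots,X_n(t))$ is an irreducible discrete-time Markov chain on a finite state space $S\subseteq\prod_{i\in[n]}S_i$ (the users' processes need not be independent), with $\mathbb{P}[X(t+1)=s\mid X(t)=s]>0$ for all $s\in S$. Its stationary distribution is $\pi$. The drift of user $i$ is $\Delta_i=\sum_{s\in S}s_i\pi(s)$, where $s=(s_1,\dots,s_n)$. Battery. A shared battery of capacity $b_{\max}\in\mathbb{N}$ has level $B(t)\in\{0,\dots,b_{\max}\}$ and evolves as $B(t+1)=B(t)+\sum_{i\in[n]}A_i(t)$, where $A_i(t)$ is the energy accepted from user $i$ (if $\ge0$) or supplied to user $i$ (if negative). In state $(x,b)\in S\times\{0,\dots,b_{\max}\}$ the set $A(x,b)$ of allowable actions consists of all integer vectors $(a_1,\dots,a_n)$ with $a_i\in\{0,\dots,x_i\}$ if $x_i\ge0$, $a_i\in\{x_i,\dots,0\}$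 if $x_i<0$, and $0\le b+\sum_{i}a_i\le b_{\max}$. A policy is a (possibly randomized, history-dependent) rule choosing at each time $t$ an action in $A(X(t),B(t))$ as a function of the history up to time $t$; the process $X$ evolves autonomously, unaffected by actions. The initial distribution of $(X(0),B(0))$ is fixed for each $b_{\max}$ (arbitrary). Loss of load rate: $\mathrm{LLR}_i=\lim_{T\to\infty}\frac1T\sum_{t=0}^T\mathbb{E}\big[\mathbb{I}\{X_i(t)<0\}(A_i(t)-X_i(t))\big]$ and $\mathrm{LLR}_{\rm sys}=\sum_{i\in[n]}\mathrm{LLR}_i$. $\mathrm{LLR}_o$ is the minimum of $\mathrm{LLR}_{\rm sys}$ over all policies satisfying, for every $i\in[n]$, the fairness constraint $\lim_{T\to\infty}\frac1T\sum_{t=0}^T\mathbb{E}[A_i(t)]\ge0$.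
   Formalization: The positive constant c may be +∞ (with log 0 = −∞), exactly when LLR_o = 0 for all large b_max; this can occur, e.g. n = 2, S = {(-1,2),(2,-1)} with uniform transitions, where no real c works. In all other cases c is a positive real. *)

theory Defs
  imports "HOL-Probability.Probability"
begin

text \<open>Users are the elements of a finite type \<open>'n\<close>. A net generation vector and an action are
  functions \<open>'n \<Rightarrow> int\<close>. The net generation chain is given by its transition kernel
  \<open>K\<close>; only its values on the state space \<open>S\<close> matter.\<close>

definition irreducible_chain :: "'s set \<Rightarrow> ('s \<Rightarrow> 's pmf) \<Rightarrow> bool" where
  "irreducible_chain S K \<longleftrightarrow>
     S \<noteq> {} \<and> (\<forall>x\<in>S. set_pmf (K x) \<subseteq> S) \<and>
     (\<forall>x\<in>S. \<forall>y\<in>S. (x, y) \<in> {(u, v). u \<in> S \<and> pmf (K u) v > 0}\<^sup>*)"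

definition stationary_distribution :: "'s set \<Rightarrow> ('s \<Rightarrow> 's pmf) \<Rightarrow> 's pmf \<Rightarrow> bool" where
  "stationary_distribution S K \<pi> \<longleftrightarrow> set_pmf \<pi> \<subseteq> S \<and> bind_pmf \<pi> K = \<pi>"

definition drift :: "('n \<Rightarrow> int) set \<Rightarrow> ('n \<Rightarrow> int) pmf \<Rightarrow> 'n \<Rightarrow> real" where
  "drift S \<pi> i = (\<Sum>s\<in>S. real_of_int (s i) * pmf \<pi> s)"

definition allowable :: "nat \<Rightarrow> ('n::finite \<Rightarrow> int) \<Rightarrow> int \<Rightarrow> ('n \<Rightarrow> int) set" where
  "allowable bmax x b =
     {a. (\<forall>i. if x i \<ge> 0 then a i \<in> {0..x i} else a i \<in> {x i..0}) \<and>
         0 \<le> b + (\<Sum>i\<in>UNIV. a i) \<and> b + (\<Sum>i\<in>UNIV. a i) \<le> int bmax}"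

text \<open>A history lists the past triples (net generation, battery level, action), most recent
  first; a policy maps the history and the current state to a distribution over actions.\<close>

type_synonym 'n history = "(('n \<Rightarrow> int) \<times> int \<times> ('n \<Rightarrow> int)) list"
type_synonym 'n policy = "'n history \<Rightarrow> ('n \<Rightarrow> int) \<Rightarrow> int \<Rightarrow> ('n \<Rightarrow> int) pmf"

definition is_policy :: "('n::finite \<Rightarrow> int) set \<Rightarrow> nat \<Rightarrow> 'n policy \<Rightarrow> bool" where
  "is_policy S bmax p \<longleftrightarrow>
     (\<forall>h. \<forall>x\<in>S. \<forall>b\<in>{0..int bmax}. set_pmf (p h x b) \<subseteq> allowable bmax x b)"

text \<open>Joint law of the history before time \<open>t\<close>, \<open>X(t)\<close> and \<open>B(t)\<close>. The next net
  generation is drawn from \<open>K x\<close> independently of the action.\<close>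

primrec process ::
  "(('n::finite \<Rightarrow> int) \<Rightarrow> ('n \<Rightarrow> int) pmf) \<Rightarrow> (('n \<Rightarrow> int) \<times> int) pmf \<Rightarrow> 'n policy \<Rightarrow>
   nat \<Rightarrow> ('n history \<times> ('n \<Rightarrow> int) \<times> int) pmf" where
  "process K \<mu> p 0 = map_pmf (\<lambda>(x, b). ([], x, b)) \<mu>"
| "process K \<mu> p (Suc t) =
     bind_pmf (process K \<mu> p t) (\<lambda>(h, x, b).
     bind_pmf (p h x b) (\<lambda>a.
     map_pmf (\<lambda>x'. ((x, b, a) # h, x', b + (\<Sum>i\<in>UNIV. a i))) (K x)))"

text \<open>Joint law of \<open>X(t)\<close> and the action \<open>A(t)\<close>.\<close>

definition state_action_law ::
  "(('n::finite \<Rightarrow> int) \<Rightarrow> ('n \<Rightarrow> int) pmf) \<Rightarrow> (('n \<Rightarrow> int) \<times> int) pmf \<Rightarrow> 'n policy \<Rightarrow>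
   nat \<Rightarrow> (('n \<Rightarrow> int) \<times> ('n \<Rightarrow> int)) pmf" where
  "state_action_law K \<mu> p t =
     bind_pmf (process K \<mu> p t) (\<lambda>(h, x, b). map_pmf (Pair x) (p h x b))"

definition expected_loss where
  "expected_loss K \<mu> p i t =
     measure_pmf.expectation (state_action_law K \<mu> p t)
       (\<lambda>(x, a). of_bool (x i < 0) * real_of_int (a i - x i))"

definition expected_accepted where
  "expected_accepted K \<mu> p i t =
     measure_pmf.expectation (state_action_law K \<mu> p t) (\<lambda>(x, a). real_of_int (a i))"

definition time_average :: "(nat \<Rightarrow> real) \<Rightarrow> nat \<Rightarrow> real" where
  "time_average f T = (1 / real T) * (\<Sum>t=0..T. f t)"

definition LLR where
  "LLR K \<mu> p i = lim (time_average (expected_loss K \<mu> p i))"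

definition LLR_sys where
  "LLR_sys K \<mu> p = (\<Sum>i\<in>UNIV. LLR K \<mu> p i)"

text \<open>Policies over which \<open>LLR_opt\<close> optimizes: all the limits involved exist, and the
  fairness constraint holds for every user.\<close>

definition feasible_policies ::
  "('n::finite \<Rightarrow> int) set \<Rightarrow> (('n \<Rightarrow> int) \<Rightarrow> ('n \<Rightarrow> int) pmf) \<Rightarrow> (('n \<Rightarrow> int) \<times> int) pmf \<Rightarrow>
   nat \<Rightarrow> 'n policy set" where
  "feasible_policies S K \<mu> bmax =
     {p. is_policy S bmax p \<and>
         (\<forall>i. convergent (time_average (expected_loss K \<mu> p i))) \<and>
         (\<forall>i. convergent (time_average (expected_accepted K \<mu> p i)) \<and>
              lim (time_average (expected_accepted K \<mu> p i)) \<ge> 0)}"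

text \<open>The set below is nonempty (never using the battery is feasible) and bounded below by 0, so
  this infimum is the minimum whenever the latter is attained.\<close>

definition LLR_opt where
  "LLR_opt S K \<mu> bmax = (INF p\<in>feasible_policies S K \<mu> bmax. LLR_sys K \<mu> p)"

text \<open>Logarithm with \<open>log 0 = -\<infinity>\<close>; the library sets \<open>ln 0 = 0\<close>.\<close>

definition log_ext :: "real \<Rightarrow> ereal" where
  "log_ext x = (if x = 0 then -\<infinity> else ereal (ln x))"

end

(* The policy that partitions the battery into private shares, one per user, satisfies every fairness
   constraint, and since all drifts are positive an exponential Lyapunov function shows that its loss
   is exponentially small in bmax; so limsup < 0. It remains to decide when limsup = -infinity. Call a
   user needy if it is in deficit in some state. As the battery is bounded, fairness forces all
   long-run contributions to vanish, so users that are never in deficit cannot help at a positive rate.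

   If the needy users have a joint deficit in some state, the chain stays in that state for bmax + 1
   steps with probability exponential in bmax; so the optimal loss is at least exponentially small.

   Otherwise the needy users never run a joint deficit, and for large bmax they can avoid loss
   completely. Each of them has a capped account in the battery, which may be overdrawn as long as the
   battery is not empty. If it runs empty, current surpluses are accepted beyond the caps and the
   accounts are reset. Debts arise only at such resets, which are exponentially rare. They
   are repaid by transfers from the account of a debtor to that of a creditor when the latter is in
   deficit, which is possible at a rate bounded away from zero. Always letting the most indebted user repay the largest creditor keeps all balances of order sqrt t.

   All time averages are controlled by one-step drift inequalities, which rest on approximate solutions
   of the Poisson equation of the net generation chain. *)

theory Submission
  imports Defs "HOL-Real_Asymp.Real_Asymp"
begin

section \<open>Finite kernels\<close>

text \<open>The fairness constraint is exact, and this shapes the zero-loss case: even an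
  exponentially small violation makes a policy infeasible. Private shares do not reach zero loss,
  since a needy user may stay in deficit long enough to empty its share while the other shares are
  full. Pooling removes the loss but shifts energy between users, and every shift has to be
  recovered in the long run. Positive drift leaves room for this: an account near its cap turns
  income away, and lowering it by a repayment lets its owner accept that income. Fairness constrains
  expectations only, so the expected balances, which are deterministic, can be steered instead of
  the realized ones. Feasibility also demands that all time averages converge. For finite memory
  this is the mean ergodic theorem, which covers reducible and periodic joint chains. The pooling
  policy uses a clock as well; there the loss vanishes identically and the accepted energy
  telescopes.\<close>

lemma expectation_mono_finite:
  fixes f g :: "'a \<Rightarrow> real"
  assumes "finite (set_pmf p)" "\<And>x. x \<in> set_pmf p \<Longrightarrow> f x \<le> g x"
  shows "measure_pmf.expectation p f \<le> measure_pmf.expectation p g"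
  using assms
  by (intro integral_mono_AE) (auto simp: AE_measure_pmf_iff intro: integrable_measure_pmf_finite)

lemma expectation_cong_support:
  fixes f g :: "'a \<Rightarrow> real"
  assumes "\<And>x. x \<in> set_pmf p \<Longrightarrow> f x = g x"
  shows "measure_pmf.expectation p f = measure_pmf.expectation p g"
  using assms by (intro integral_cong_AE) (auto simp: AE_measure_pmf_iff)

lemma expectation_add_finite:
  fixes f g :: "'a \<Rightarrow> real"
  assumes "finite (set_pmf p)"
  shows "measure_pmf.expectation p (\<lambda>x. f x + g x) =
         measure_pmf.expectation p f + measure_pmf.expectation p g"
  using assms by (intro Bochner_Integration.integral_add integrable_measure_pmf_finite)

lemma expectation_diff_finite:
  fixes f g :: "'a \<Rightarrow> real"
  assumes "finite (set_pmf p)"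
  shows "measure_pmf.expectation p (\<lambda>x. f x - g x) =
         measure_pmf.expectation p f - measure_pmf.expectation p g"
  using assms by (intro Bochner_Integration.integral_diff integrable_measure_pmf_finite)

lemma expectation_sum_finite:
  fixes f :: "'i \<Rightarrow> 'a \<Rightarrow> real"
  assumes "finite (set_pmf p)"
  shows "measure_pmf.expectation p (\<lambda>x. \<Sum>i\<in>I. f i x) =
         (\<Sum>i\<in>I. measure_pmf.expectation p (f i))"
  using assms by (intro Bochner_Integration.integral_sum integrable_measure_pmf_finite)

lemma expectation_const [simp]: "measure_pmf.expectation p (\<lambda>x. c::real) = c"
  by simp

lemma expectation_bounds_finite:
  fixes f :: "'a \<Rightarrow> real"
  assumes "finite (set_pmf p)" "\<And>x. x \<in> set_pmf p \<Longrightarrow> \<bar>f x\<bar> \<le> M"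
  shows "\<bar>measure_pmf.expectation p f\<bar> \<le> M"
proof -
  have "measure_pmf.expectation p f \<le> measure_pmf.expectation p (\<lambda>_. M)"
    using assms by (intro expectation_mono_finite) (auto simp: abs_le_iff)
  moreover have "measure_pmf.expectation p (\<lambda>_. -M) \<le> measure_pmf.expectation p f"
    using assms by (intro expectation_mono_finite) (auto simp: abs_le_iff minus_le_iff)
  ultimately show ?thesis by simp
qed

lemma expectation_bind_finite:
  fixes h :: "'b \<Rightarrow> real"
  assumes "finite (set_pmf p)" "\<And>x. x \<in> set_pmf p \<Longrightarrow> finite (set_pmf (f x))"
  shows "measure_pmf.expectation (bind_pmf p f) h =
         measure_pmf.expectation p (\<lambda>x. measure_pmf.expectation (f x) h)"
  using assms
  by (subst pmf_expectation_bind[of "set_pmf p"])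
     (auto simp: integral_measure_pmf_real[of "set_pmf p"] mult.commute)

section \<open>Cesaro averages and the mean ergodic theorem for a kernel on a finite set\<close>

lemma finite_convergent_subsequence:
  fixes a :: "nat \<Rightarrow> 's \<Rightarrow> real"
  assumes "finite F" "\<And>n x. x \<in> F \<Longrightarrow> \<bar>a n x\<bar> \<le> M x"
  shows "\<exists>r. strict_mono r \<and> (\<forall>x\<in>F. convergent (\<lambda>n. a (r n) x))"
  using assms
proof (induction F rule: finite_induct)
  case empty
  show ?case by (auto intro: exI[of _ id] simp: strict_mono_def)
next
  case (insert y F)
  then obtain r where r: "strict_mono r" "\<forall>x\<in>F. convergent (\<lambda>n. a (r n) x)" by auto
  have "bounded (range (\<lambda>n. a (r n) y))"
    using insert.prems[of y] by (auto simp: bounded_iff)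
  then obtain l q where q: "strict_mono q" "((\<lambda>n. a (r n) y) \<circ> q) \<longlonglongrightarrow> l"
    using bounded_imp_convergent_subsequence by metis
  have "convergent (\<lambda>n. a ((r \<circ> q) n) x)" if "x \<in> insert y F" for x
  proof (cases "x = y")
    case True
    then show ?thesis using q(2) by (auto simp: convergent_def o_def)
  next
    case False
    then have "convergent (\<lambda>n. a (r n) x)" using r(2) that by auto
    then obtain m where "(\<lambda>n. a (r n) x) \<longlonglongrightarrow> m" unfolding convergent_def by (rule exE)
    from LIMSEQ_subseq_LIMSEQ[OF this q(1)] show ?thesis by (auto simp: convergent_def o_def)
  qed
  moreover have "strict_mono (r \<circ> q)" using r(1) q(1) by (simp add: strict_mono_o)
  ultimately show ?case by blast
qed

locale finite_kernel =
  fixes F :: "'s set" and P :: "'s \<Rightarrow> 's pmf"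
  assumes finite_F: "finite F"
    and closed_F: "x \<in> F \<Longrightarrow> set_pmf (P x) \<subseteq> F"
begin

definition T :: "('s \<Rightarrow> real) \<Rightarrow> 's \<Rightarrow> real" where
  "T f x = measure_pmf.expectation (P x) f"

definition cesaro :: "('s \<Rightarrow> real) \<Rightarrow> nat \<Rightarrow> 's \<Rightarrow> real" where
  "cesaro f N x = (\<Sum>k<N. (T ^^ k) f x) / real N"

text \<open>The partial sum of \<open>- (T ^^ k) f\<close> over \<open>k < m\<close> solves the
  Poisson equation up to the error \<open>(T ^^ m) f\<close>, which need not converge. Averaging
  over \<open>m < N\<close> replaces this error by the Cesaro average.\<close>

definition corrector :: "('s \<Rightarrow> real) \<Rightarrow> nat \<Rightarrow> 's \<Rightarrow> real" where
  "corrector f N x = - (\<Sum>m<N. \<Sum>k<m. (T ^^ k) f x) / real N"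

lemma finite_support: "x \<in> F \<Longrightarrow> finite (set_pmf (P x))"
  using closed_F finite_F finite_subset by blast

lemma T_sum: "x \<in> F \<Longrightarrow> T f x = (\<Sum>y\<in>F. f y * pmf (P x) y)"
  unfolding T_def using finite_F closed_F by (intro integral_measure_pmf_real) auto

lemma T_cong: "(\<And>y. y \<in> F \<Longrightarrow> f y = g y) \<Longrightarrow> x \<in> F \<Longrightarrow> T f x = T g x"
  unfolding T_def using closed_F by (intro expectation_cong_support) auto

lemma T_abs_le:
  assumes "\<And>y. y \<in> F \<Longrightarrow> \<bar>f y\<bar> \<le> M" "x \<in> F"
  shows "\<bar>T f x\<bar> \<le> M"
  unfolding T_def using assms closed_F finite_support by (intro expectation_bounds_finite) auto

lemma T_pow_abs_le:
  assumes "\<And>y. y \<in> F \<Longrightarrow> \<bar>f y\<bar> \<le> M"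
  shows "x \<in> F \<Longrightarrow> \<bar>(T ^^ k) f x\<bar> \<le> M"
  by (induction k arbitrary: x) (auto intro: assms T_abs_le)

lemma T_pow_cong: "(\<And>y. y \<in> F \<Longrightarrow> f y = g y) \<Longrightarrow> x \<in> F \<Longrightarrow> (T ^^ k) f x = (T ^^ k) g x"
  by (induction k arbitrary: x) (auto intro: T_cong)

lemma T_diff: "x \<in> F \<Longrightarrow> T (\<lambda>y. f y - g y) x = T f x - T g x"
  unfolding T_def using finite_support by (intro expectation_diff_finite)

lemma T_lsum: "x \<in> F \<Longrightarrow> T (\<lambda>y. \<Sum>i\<in>I. f i y) x = (\<Sum>i\<in>I. T (f i) x)"
  unfolding T_def using finite_support by (intro expectation_sum_finite)

lemma T_div: "T (\<lambda>y. f y / c) x = T f x / c"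
  unfolding T_def by simp

lemma T_minus: "T (\<lambda>y. - f y) x = - T f x"
  unfolding T_def by simp

lemma T_pow_diff: "x \<in> F \<Longrightarrow> (T ^^ k) (\<lambda>y. f y - g y) x = (T ^^ k) f x - (T ^^ k) g x"
proof (induction k arbitrary: x)
  case (Suc k)
  have "T ((T ^^ k) (\<lambda>y. f y - g y)) x = T (\<lambda>y. (T ^^ k) f y - (T ^^ k) g y) x"
    using Suc by (intro T_cong) auto
  then show ?case using Suc.prems by (simp add: T_diff)
qed auto

lemma corrector_eq:
  assumes "x \<in> F" "N > 0"
  shows "T (corrector f N) x - corrector f N x = f x - cesaro f N x"
proof -
  have tele: "(\<Sum>k<m. (T ^^ Suc k) f x - (T ^^ k) f x) = (T ^^ m) f x - f x" for m
    by (induction m) auto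
  have "T (corrector f N) x = - (\<Sum>m<N. \<Sum>k<m. (T ^^ Suc k) f x) / real N"
    unfolding corrector_def T_div T_minus using assms by (simp add: T_lsum)
  then have "T (corrector f N) x - corrector f N x =
      - ((\<Sum>m<N. \<Sum>k<m. (T ^^ Suc k) f x) - (\<Sum>m<N. \<Sum>k<m. (T ^^ k) f x)) / real N"
    unfolding corrector_def by (simp add: field_simps diff_divide_distrib)
  also have "(\<Sum>m<N. \<Sum>k<m. (T ^^ Suc k) f x) - (\<Sum>m<N. \<Sum>k<m. (T ^^ k) f x) =
      (\<Sum>m<N. \<Sum>k<m. (T ^^ Suc k) f x - (T ^^ k) f x)"
    by (simp add: sum_subtractf)
  also have "\<dots> = (\<Sum>m<N. (T ^^ m) f x - f x)"
    unfolding tele ..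
  also have "- \<dots> / real N = f x - cesaro f N x"
    unfolding cesaro_def using assms(2) by (simp add: sum_subtractf field_simps)
  finally show ?thesis .
qed

lemma cesaro_diff: "x \<in> F \<Longrightarrow> cesaro (\<lambda>y. f y - g y) N x = cesaro f N x - cesaro g N x"
  unfolding cesaro_def by (simp add: T_pow_diff sum_subtractf diff_divide_distrib)

lemma cesaro_cong: "(\<And>y. y \<in> F \<Longrightarrow> f y = g y) \<Longrightarrow> x \<in> F \<Longrightarrow> cesaro f N x = cesaro g N x"
  unfolding cesaro_def by (intro arg_cong2[where f="(/)"] sum.cong T_pow_cong refl) auto

lemma cesaro_abs_le:
  assumes "\<And>y. y \<in> F \<Longrightarrow> \<bar>f y\<bar> \<le> M" "x \<in> F" "0 \<le> M"
  shows "\<bar>cesaro f N x\<bar> \<le> M"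
proof (cases "N = 0")
  case False
  have "\<bar>\<Sum>k<N. (T ^^ k) f x\<bar> \<le> (\<Sum>k<N. M)"
    by (intro order.trans[OF sum_abs] sum_mono T_pow_abs_le assms)
  then show ?thesis using False unfolding cesaro_def by (simp add: field_simps)
qed (use assms in \<open>simp add: cesaro_def\<close>)

lemma bounded_on_F: "\<exists>M\<ge>0. \<forall>y\<in>F. \<bar>f y :: real\<bar> \<le> M"
proof -
  have "\<bar>f y\<bar> \<le> (\<Sum>z\<in>F. \<bar>f z\<bar>)" if "y \<in> F" for y
    using finite_F that by (intro member_le_sum) auto
  moreover have "(\<Sum>z\<in>F. \<bar>f z\<bar>) \<ge> 0" by (intro sum_nonneg) auto
  ultimately show ?thesis by blast
qed

lemma cesaro_coboundary:
  assumes "x \<in> F"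
  shows "(\<lambda>N. cesaro (\<lambda>y. T g y - g y) N x) \<longlonglongrightarrow> 0"
proof -
  obtain M where M: "0 \<le> M" "\<forall>y\<in>F. \<bar>g y\<bar> \<le> M" using bounded_on_F[of g] by blast
  have tele: "(\<Sum>k<N. (T ^^ k) (\<lambda>y. T g y - g y) x) = (T ^^ N) g x - g x" for N
  proof (induction N)
    case (Suc N)
    have "(T ^^ N) (T g) x = (T ^^ Suc N) g x" by (simp only: funpow_Suc_right o_apply)
    moreover have "(T ^^ N) (\<lambda>y. T g y - g y) x = (T ^^ N) (T g) x - (T ^^ N) g x"
      by (rule T_pow_diff[OF assms])
    ultimately show ?case using Suc unfolding sum.lessThan_Suc by linarith
  qed auto
  have "norm (cesaro (\<lambda>y. T g y - g y) N x) \<le> (2 * M) * inverse (real N)" for N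
  proof -
    have "\<bar>(T ^^ N) g x - g x\<bar> \<le> 2 * M"
      using T_pow_abs_le[of g M x N] M assms by fastforce
    then have "\<bar>(T ^^ N) g x - g x\<bar> * inverse (real N) \<le> 2 * M * inverse (real N)"
      by (intro mult_right_mono) auto
    then show ?thesis unfolding cesaro_def tele by (simp only: divide_inverse abs_mult real_norm_def) simp
  qed
  then have "\<forall>\<^sub>F N in sequentially. norm (cesaro (\<lambda>y. T g y - g y) N x) \<le> (2 * M) * inverse (real N)"
    by (intro always_eventually allI)
  moreover have "(\<lambda>N. (2 * M) * inverse (real N)) \<longlonglongrightarrow> 0"
    by (rule tendsto_mult_right_zero[OF lim_inverse_n[where 'a=real]])
  ultimately show ?thesis by (rule Lim_null_comparison)
qed

text \<open>Mean ergodic theorem: a subsequential limit of the Cesaro averages is invariant, and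
  \<open>f\<close> differs from a Cesaro average of itself by a coboundary only.\<close>

lemma cesaro_converges:
  obtains l where "\<And>x. x \<in> F \<Longrightarrow> (\<lambda>N. cesaro f N x) \<longlonglongrightarrow> l x" "\<And>x. x \<in> F \<Longrightarrow> T l x = l x"
proof -
  obtain M where M: "0 \<le> M" "\<forall>y\<in>F. \<bar>f y\<bar> \<le> M" using bounded_on_F[of f] by blast
  have "\<exists>r. strict_mono r \<and> (\<forall>x\<in>F. convergent (\<lambda>n. cesaro f (r n) x))"
    using M by (intro finite_convergent_subsequence[where M = "\<lambda>_. M"] finite_F cesaro_abs_le) auto
  then obtain r where r: "strict_mono r" "\<And>x. x \<in> F \<Longrightarrow> convergent (\<lambda>n. cesaro f (r n) x)" by blast
  define l where "l x = lim (\<lambda>n. cesaro f (r n) x)" for x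
  have l: "(\<lambda>n. cesaro f (r n) x) \<longlonglongrightarrow> l x" if "x \<in> F" for x
    using r(2)[OF that] by (simp add: l_def convergent_LIMSEQ_iff)
  have inv: "T l x = l x" if x: "x \<in> F" for x
  proof -
    have "(\<lambda>n. T (cesaro f (r n)) x) \<longlonglongrightarrow> T l x"
      unfolding T_sum[OF x] by (intro tendsto_intros l)
    \<comment> \<open>\<open>T\<close> commutes with Cesaro averaging, so the defect of invariance
      is the Cesaro average of a coboundary, which vanishes in the limit.\<close>
    moreover have "T (cesaro f N) x - cesaro f N x = cesaro (\<lambda>y. T f y - f y) N x" for N
    proof -
      have "T (cesaro f N) x = (\<Sum>k<N. (T ^^ k) (T f) x) / real N"
        unfolding cesaro_def T_div T_lsum[OF x] by (simp add: funpow_swap1)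
      then show ?thesis unfolding cesaro_diff[OF x] by (simp add: cesaro_def)
    qed
    then have "(\<lambda>n. T (cesaro f (r n)) x - cesaro f (r n) x) \<longlonglongrightarrow> 0"
      using LIMSEQ_subseq_LIMSEQ[OF cesaro_coboundary[OF x, of f] r(1)] by (simp add: o_def)
    ultimately have "(\<lambda>n. cesaro f (r n) x) \<longlonglongrightarrow> T l x"
      using tendsto_diff by fastforce
    then show ?thesis using LIMSEQ_unique l[OF x] by blast
  qed
  have pow_inv: "(T ^^ k) l x = l x" if "x \<in> F" for k x
    using that
  proof (induction k arbitrary: x)
    case (Suc k)
    then have "T ((T ^^ k) l) x = T l x" by (intro T_cong) auto
    with Suc inv show ?case by simp
  qed auto
  have "(\<lambda>N. cesaro f N x) \<longlonglongrightarrow> l x" if x: "x \<in> F" for x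
  proof (rule LIMSEQ_I)
    fix e :: real assume e: "e > 0"
    have "\<forall>\<^sub>F n in sequentially. \<forall>y\<in>F. \<bar>cesaro f (r n) y - l y\<bar> < e / 2"
    proof (intro eventually_ball_finite ballI finite_F)
      fix y assume "y \<in> F"
      from tendstoD[OF l[OF this], of "e / 2"] e
      show "\<forall>\<^sub>F n in sequentially. \<bar>cesaro f (r n) y - l y\<bar> < e / 2" by (simp add: dist_real_def)
    qed
    moreover have "\<forall>\<^sub>F n in sequentially. r n > 0"
      using seq_suble[OF r(1)] by (intro eventually_sequentiallyI[of 1]) (meson less_le_trans zero_less_one)
    ultimately have "\<forall>\<^sub>F n in sequentially. (\<forall>y\<in>F. \<bar>cesaro f (r n) y - l y\<bar> < e / 2) \<and> r n > 0"
      by (rule eventually_conj)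
    then obtain n where n: "\<And>y. y \<in> F \<Longrightarrow> \<bar>cesaro f (r n) y - l y\<bar> < e / 2" "r n > 0"
      unfolding eventually_sequentially by (metis order_refl)
    define g where "g = corrector f (r n)"
    have g: "f y - l y = (T g y - g y) - (l y - cesaro f (r n) y)" if "y \<in> F" for y
      using corrector_eq[OF that n(2), of f] by (simp add: g_def)
    \<comment> \<open>A single index \<open>n\<close> of the subsequence controls the whole
      sequence: the coboundary part vanishes as \<open>N\<close> grows, while the remainder is below
      \<open>e / 2\<close> uniformly on \<open>F\<close>, and averaging preserves this
      bound.\<close>
    have eq: "cesaro f N x - l x =
        cesaro (\<lambda>y. T g y - g y) N x - cesaro (\<lambda>y. l y - cesaro f (r n) y) N x" if "N > 0" for N
    proof -
      have "cesaro f N x - l x = cesaro (\<lambda>y. f y - l y) N x"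
        using that x pow_inv by (simp add: cesaro_diff) (simp add: cesaro_def)
      also have "\<dots> = cesaro (\<lambda>y. (T g y - g y) - (l y - cesaro f (r n) y)) N x"
        using g x by (intro cesaro_cong)
      finally show ?thesis by (simp only: cesaro_diff[OF x])
    qed
    obtain N0 where N0: "\<And>N. N \<ge> N0 \<Longrightarrow> \<bar>cesaro (\<lambda>y. T g y - g y) N x\<bar> < e / 2"
      using LIMSEQ_D[OF cesaro_coboundary[OF x, of g], of "e/2"] e by auto
    have "norm (cesaro f N x - l x) < e" if "N \<ge> Suc N0" for N
    proof -
      have "\<bar>cesaro (\<lambda>y. l y - cesaro f (r n) y) N x\<bar> \<le> e / 2"
        using n(1) e x by (intro cesaro_abs_le) (auto simp: abs_minus_commute intro: less_imp_le)
      moreover have "\<bar>cesaro (\<lambda>y. T g y - g y) N x\<bar> < e / 2" using N0 that by simp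
      ultimately show ?thesis using eq[of N] that unfolding real_norm_def by linarith
    qed
    then show "\<exists>N0. \<forall>N\<ge>N0. norm (cesaro f N x - l x) < e" by blast
  qed
  then show ?thesis using that inv by blast
qed

end

section \<open>Drift inequalities for the net generation chain\<close>

text \<open>The support of \<pi> is nonempty and closed under transitions, so irreducibility extends
  it to all of \<open>S\<close>.\<close>

lemma stationary_pmf_pos:
  assumes irr: "irreducible_chain S K" and st: "stationary_distribution S K \<pi>" and s: "s \<in> S"
  shows "pmf \<pi> s > 0"
proof -
  obtain x where x: "x \<in> set_pmf \<pi>" using set_pmf_not_empty[of \<pi>] by blast
  then have "x \<in> S" using st by (auto simp: stationary_distribution_def)
  then have "(x, s) \<in> {(u, v). u \<in> S \<and> pmf (K u) v > 0}\<^sup>*"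
    using irr s by (auto simp: irreducible_chain_def)
  then have "s \<in> set_pmf \<pi>"
  proof (induction rule: rtrancl_induct)
    case (step y z)
    then have "z \<in> set_pmf (K y)" by (auto simp: set_pmf_iff)
    then have "z \<in> set_pmf (bind_pmf \<pi> K)" using step.IH by auto
    moreover have "bind_pmf \<pi> K = \<pi>" using st by (simp add: stationary_distribution_def)
    ultimately show ?case by (simp only:)
  qed (rule x)
  then show ?thesis by (simp add: pmf_positive)
qed

text \<open>Maximum principle: at a maximum, the mean over the successors can equal the maximum only
  if every successor is a maximum too; irreducibility spreads this over \<open>S\<close>.\<close>

lemma invariant_function_constant:
  assumes fin: "finite S" and irr: "irreducible_chain S K"
    and inv: "\<And>x. x \<in> S \<Longrightarrow> measure_pmf.expectation (K x) l = l x"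
  shows "\<exists>c::real. \<forall>x\<in>S. l x = c"
proof -
  have ne: "S \<noteq> {}" and cl: "\<And>x. x \<in> S \<Longrightarrow> set_pmf (K x) \<subseteq> S"
    using irr by (auto simp: irreducible_chain_def)
  define m where "m = Max (l ` S)"
  have le: "l y \<le> m" if "y \<in> S" for y using fin that by (simp add: m_def)
  have "m \<in> l ` S" unfolding m_def using fin ne by (intro Max_in) auto
  then obtain x0 where x0: "x0 \<in> S" "l x0 = m" by auto
  have "l y = m" if y: "y \<in> S" for y
  proof -
    have "(x0, y) \<in> {(u, v). u \<in> S \<and> pmf (K u) v > 0}\<^sup>*"
      using irr x0 y by (auto simp: irreducible_chain_def)
    then show ?thesis
    proof (induction rule: rtrancl_induct)
      case (step u v)
      then have u: "u \<in> S" and p: "pmf (K u) v > 0" by auto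
      then have v: "v \<in> S" using cl[OF u] by (auto simp: set_pmf_iff)
      have "(\<Sum>y\<in>S. (m - l y) * pmf (K u) y) = m * (\<Sum>y\<in>S. pmf (K u) y) - (\<Sum>y\<in>S. l y * pmf (K u) y)"
        by (simp add: algebra_simps sum_subtractf sum_distrib_left)
      also have "(\<Sum>y\<in>S. pmf (K u) y) = 1" using fin cl[OF u] by (rule sum_pmf_eq_1)
      also have "(\<Sum>y\<in>S. l y * pmf (K u) y) = l u"
        unfolding inv[OF u, symmetric] using fin cl[OF u]
        by (intro integral_measure_pmf_real[symmetric]) auto
      finally have "(\<Sum>y\<in>S. (m - l y) * pmf (K u) y) = 0" using step.IH by simp
      then have "(m - l v) * pmf (K u) v = 0"
        using fin le v by (subst (asm) sum_nonneg_eq_0_iff) auto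
      then show ?case using p by simp
    qed (rule x0)
  qed
  then show ?thesis by blast
qed

text \<open>An approximate solution of the Poisson equation with right-hand side \<open>f\<close>; it turns
  one-step inequalities into bounds on time averages without any reference to path measures.\<close>

lemma poisson_inequality:
  assumes fin: "finite S" and irr: "irreducible_chain S K" and st: "stationary_distribution S K \<pi>"
    and pos: "(\<Sum>s\<in>S. f s * pmf \<pi> s) > 0"
  shows "\<exists>g. \<exists>\<delta>>0. \<forall>x\<in>S. measure_pmf.expectation (K x) g \<le> g x + f x - \<delta>"
proof -
  have cl: "\<And>x. x \<in> S \<Longrightarrow> set_pmf (K x) \<subseteq> S"
    using irr by (auto simp: irreducible_chain_def)
  interpret finite_kernel S K by unfold_locales (use fin cl in auto)
  obtain l where l: "\<And>x. x \<in> S \<Longrightarrow> (\<lambda>N. cesaro f N x) \<longlonglongrightarrow> l x" "\<And>x. x \<in> S \<Longrightarrow> T l x = l x"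
    using cesaro_converges[of f] by blast
  obtain c where c: "\<And>x. x \<in> S \<Longrightarrow> l x = c"
    using invariant_function_constant[OF fin irr, of l] l(2) unfolding T_def by blast
  have \<pi>S: "set_pmf \<pi> \<subseteq> S" and \<pi>K: "bind_pmf \<pi> K = \<pi>"
    using st by (auto simp: stationary_distribution_def)
  have fin\<pi>: "finite (set_pmf \<pi>)" using \<pi>S fin finite_subset by blast
  have E\<pi>: "measure_pmf.expectation \<pi> h = (\<Sum>s\<in>S. h s * pmf \<pi> s)" for h :: "_ \<Rightarrow> real"
    using fin \<pi>S by (intro integral_measure_pmf_real) auto
  have "measure_pmf.expectation \<pi> (T h) = measure_pmf.expectation \<pi> h" for h
  proof -
    have "measure_pmf.expectation (bind_pmf \<pi> K) h = measure_pmf.expectation \<pi> (T h)"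
      unfolding T_def using fin\<pi> \<pi>S finite_support by (intro expectation_bind_finite) auto
    then show ?thesis by (simp add: \<pi>K)
  qed
  then have "measure_pmf.expectation \<pi> ((T ^^ k) f) = measure_pmf.expectation \<pi> f" for k
    by (induction k) auto
  then have E\<pi>ces: "measure_pmf.expectation \<pi> (cesaro f N) = measure_pmf.expectation \<pi> f" if "N > 0" for N
    unfolding cesaro_def using that by (simp add: expectation_sum_finite[OF fin\<pi>])
  \<comment> \<open>Expectations under \<pi> are unchanged by \<open>T\<close>; this identifies the
    constant \<open>c\<close> with the stationary mean of \<open>f\<close>.\<close>
  have "(\<lambda>N. measure_pmf.expectation \<pi> (cesaro f N)) \<longlonglongrightarrow> measure_pmf.expectation \<pi> l"
    unfolding E\<pi> by (intro tendsto_intros l)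
  moreover have "(\<lambda>N. measure_pmf.expectation \<pi> (cesaro f N)) \<longlonglongrightarrow> measure_pmf.expectation \<pi> f"
    by (rule tendsto_eventually) (use E\<pi>ces in \<open>auto intro: eventually_sequentiallyI[of 1]\<close>)
  ultimately have "measure_pmf.expectation \<pi> l = measure_pmf.expectation \<pi> f"
    using LIMSEQ_unique by blast
  moreover have "measure_pmf.expectation \<pi> l = measure_pmf.expectation \<pi> (\<lambda>_. c)"
    using c \<pi>S by (intro expectation_cong_support) auto
  ultimately have "c > 0" using pos by (simp add: E\<pi>[of f])
  have "\<forall>\<^sub>F N in sequentially. \<forall>x\<in>S. cesaro f N x > c / 2"
  proof (intro eventually_ball_finite ballI fin)
    fix x assume "x \<in> S"
    then show "\<forall>\<^sub>F N in sequentially. cesaro f N x > c / 2"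
      using l(1) c \<open>c > 0\<close> by (intro order_tendstoD(1)[of _ c]) auto
  qed
  \<comment> \<open>Finiteness of \<open>S\<close> makes the convergence uniform, so one corrector
    serves all states. Half of the mean remains as the margin \<delta>.\<close>
  then obtain N0 where N0: "\<And>N. N \<ge> N0 \<Longrightarrow> \<forall>x\<in>S. cesaro f N x > c / 2"
    unfolding eventually_sequentially by blast
  define g where "g = corrector f (Suc N0)"
  have "measure_pmf.expectation (K x) g \<le> g x + f x - c / 2" if "x \<in> S" for x
    using corrector_eq[OF that, of "Suc N0" f] N0[of "Suc N0"] that unfolding T_def g_def by fastforce
  then show ?thesis using \<open>c > 0\<close> half_gt_zero by blast
qed

section \<open>Exponential Lyapunov functions for accounts with positive drift\<close>

lemma exp_le_quadratic:
  fixes x :: real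
  assumes "\<bar>x\<bar> \<le> 1"
  shows "exp x \<le> 1 + x + x\<^sup>2"
proof (cases "x \<ge> 0")
  case True
  then show ?thesis using assms exp_bound[of x] by simp
next
  case False
  have "exp (- x) \<ge> 1 - x" using exp_ge_add_one_self[of "-x"] by simp
  moreover have "(1 + x + x\<^sup>2) * (1 - x) = 1 - x ^ 3"
    by (simp add: algebra_simps power2_eq_square power3_eq_cube)
  moreover have "x ^ 3 \<le> 0" using False by (simp add: power3_eq_cube mult_le_0_iff zero_le_mult_iff)
  moreover have "1 + x + x\<^sup>2 \<ge> 0" using assms by (smt (verit) zero_le_power2)
  ultimately have "(1 + x + x\<^sup>2) * exp (- x) \<ge> 1"
    by (smt (verit) mult_left_mono)
  then show ?thesis by (simp add: exp_minus field_simps)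
qed

text \<open>The increments \<open>g y - g x - v x\<close> have mean at most
  \<open>- \<delta>\<close>. For small \<theta> the linear gain \<open>\<theta> * \<delta>\<close>
  in the exponential moment beats the quadratic error \<open>(\<theta> * M)\<^sup>2\<close>.\<close>

lemma exponential_contraction:
  fixes g v :: "'i \<Rightarrow> 's \<Rightarrow> real"
  assumes fin: "finite I" "finite S" and cl: "\<And>x. x \<in> S \<Longrightarrow> set_pmf (K x) \<subseteq> S" and "\<delta> > 0"
    and dr: "\<And>i x. i \<in> I \<Longrightarrow> x \<in> S \<Longrightarrow> measure_pmf.expectation (K x) (g i) \<le> g i x + v i x - \<delta>"
  shows "\<exists>\<theta> \<rho>. \<theta> > 0 \<and> 0 \<le> \<rho> \<and> \<rho> < 1 \<and>
    (\<forall>i\<in>I. \<forall>x\<in>S. measure_pmf.expectation (K x) (\<lambda>y. exp (\<theta> * (g i y - g i x - v i x))) \<le> \<rho>)"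
proof -
  let ?A = "(\<lambda>(i, x, y). \<bar>g i y - g i x - v i x\<bar>) ` (I \<times> S \<times> S)"
  define M where "M = Max (insert (max 1 \<delta>) ?A)"
  have fA: "finite (insert (max 1 \<delta>) ?A)" using fin by auto
  have M: "\<bar>g i y - g i x - v i x\<bar> \<le> M" if "i \<in> I" "x \<in> S" "y \<in> S" for i x y
    unfolding M_def using fA that by (intro Max_ge) force+
  have "max 1 \<delta> \<le> M" unfolding M_def using fA by (intro Max_ge) auto
  then have M1: "M \<ge> 1" "M \<ge> \<delta>" by auto
  \<comment> \<open>This choice makes the quadratic error exactly half of the linear gain, which
    gives \<rho>. That \<open>M\<close> is at least 1 and at least \<delta> keeps the exponents in
    the range of \<open>exp_le_quadratic\<close> and \<rho> nonnegative.\<close>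
  define \<theta> where "\<theta> = \<delta> / (2 * M\<^sup>2)"
  have \<theta>: "\<theta> > 0" using \<open>\<delta> > 0\<close> M1 by (simp add: \<theta>_def)
  have "\<delta> \<le> M * (2 * M)" using M1 \<open>\<delta> > 0\<close> by (smt (verit) mult_le_cancel_left1)
  then have \<theta>M: "\<theta> * M \<le> 1" using M1 by (simp add: \<theta>_def power2_eq_square field_simps)
  define \<rho> where "\<rho> = 1 - \<theta> * \<delta> / 2"
  have "\<theta> * \<delta> \<le> \<theta> * M" using M1 \<theta> by simp
  then have "\<theta> * \<delta> \<le> 2" using \<theta>M by linarith
  then have \<rho>: "0 \<le> \<rho>" "\<rho> < 1" using \<theta> \<open>\<delta> > 0\<close> by (simp_all add: \<rho>_def)
  have "measure_pmf.expectation (K x) (\<lambda>y. exp (\<theta> * (g i y - g i x - v i x))) \<le> \<rho>"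
    if i: "i \<in> I" and x: "x \<in> S" for i x
  proof -
    have fs: "finite (set_pmf (K x))" using cl[OF x] fin finite_subset by blast
    have "measure_pmf.expectation (K x) (\<lambda>y. exp (\<theta> * (g i y - g i x - v i x)))
        \<le> measure_pmf.expectation (K x) (\<lambda>y. 1 + \<theta> * (g i y - (g i x + v i x)) + (\<theta> * M)\<^sup>2)"
    proof (intro expectation_mono_finite fs)
      fix y assume "y \<in> set_pmf (K x)"
      then have m: "\<bar>g i y - g i x - v i x\<bar> \<le> M" using cl[OF x] M i x by blast
      let ?r = "\<theta> * (g i y - g i x - v i x)"
      have "\<bar>?r\<bar> \<le> \<theta> * M" using m \<theta> by (simp add: abs_mult)
      moreover from this have "?r\<^sup>2 \<le> (\<theta> * M)\<^sup>2" by (metis abs_ge_zero power2_abs power_mono)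
      moreover have "?r = \<theta> * (g i y - (g i x + v i x))" by (simp add: algebra_simps)
      ultimately show "exp ?r \<le> 1 + \<theta> * (g i y - (g i x + v i x)) + (\<theta> * M)\<^sup>2"
        using exp_le_quadratic[of ?r] \<theta>M by linarith
    qed
    also have "\<dots> = 1 + \<theta> * (measure_pmf.expectation (K x) (g i) - (g i x + v i x)) + (\<theta> * M)\<^sup>2"
      by (simp add: expectation_add_finite[OF fs] expectation_diff_finite[OF fs])
    also have "\<dots> \<le> 1 + \<theta> * (- \<delta>) + (\<theta> * M)\<^sup>2"
      using dr[OF i x] \<theta> by (intro add_mono mult_left_mono) auto
    also have "(\<theta> * M)\<^sup>2 = \<theta> * \<delta> / 2" using M1 by (simp add: \<theta>_def power2_eq_square field_simps)
    finally show ?thesis unfolding \<rho>_def by linarith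
  qed
  with \<theta> \<rho> show ?thesis by blast
qed

text \<open>The hypothesis on \<open>e'\<close> is met by an account with income \<open>v\<close> that is capped at
  or above \<open>\<beta>\<close> and is never charged while below \<open>\<beta>\<close>.\<close>

lemma exponential_drift:
  fixes g v :: "'s \<Rightarrow> real"
  assumes fs: "finite (set_pmf p)" and "\<theta> > 0"
    and c: "measure_pmf.expectation p (\<lambda>y. exp (\<theta> * (g y - g x - v x))) \<le> \<rho>"
    and B: "\<And>y. y \<in> set_pmf p \<Longrightarrow> g y \<le> M"
    and e': "e' \<ge> min (e + v x) \<beta>"
  shows "measure_pmf.expectation p (\<lambda>y. exp (\<theta> * (g y - e')))
    \<le> \<rho> * exp (\<theta> * (g x - e)) + exp (\<theta> * M) * exp (- \<theta> * \<beta>)"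
proof -
  have "measure_pmf.expectation p (\<lambda>y. exp (\<theta> * (g y - e')))
      \<le> measure_pmf.expectation p (\<lambda>y. exp (\<theta> * (g y - g x - v x)) * exp (\<theta> * (g x - e))
          + exp (\<theta> * M) * exp (- \<theta> * \<beta>))"
  proof (intro expectation_mono_finite fs)
    fix y assume y: "y \<in> set_pmf p"
    have "g y - e' \<le> max (g y - (e + v x)) (M - \<beta>)" using e' B[OF y] by linarith
    then have "\<theta> * (g y - e') \<le> \<theta> * (g y - (e + v x)) \<or> \<theta> * (g y - e') \<le> \<theta> * (M - \<beta>)"
      using \<open>\<theta> > 0\<close> by (auto simp: max_def split: if_splits)
    then have "exp (\<theta> * (g y - e')) \<le> exp (\<theta> * (g y - (e + v x))) \<or>
        exp (\<theta> * (g y - e')) \<le> exp (\<theta> * (M - \<beta>))" by (simp only: exp_le_cancel_iff)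
    then have "exp (\<theta> * (g y - e')) \<le> exp (\<theta> * (g y - (e + v x))) + exp (\<theta> * (M - \<beta>))"
      by (metis add.commute add_increasing2 exp_ge_zero)
    also have "exp (\<theta> * (g y - (e + v x))) = exp (\<theta> * (g y - g x - v x)) * exp (\<theta> * (g x - e))"
      by (simp add: exp_add[symmetric] algebra_simps)
    also have "exp (\<theta> * (M - \<beta>)) = exp (\<theta> * M) * exp (- \<theta> * \<beta>)"
      by (simp add: exp_add[symmetric] algebra_simps)
    finally show "exp (\<theta> * (g y - e')) \<le> exp (\<theta> * (g y - g x - v x)) * exp (\<theta> * (g x - e))
        + exp (\<theta> * M) * exp (- \<theta> * \<beta>)" .
  qed
  also have "\<dots> = measure_pmf.expectation p (\<lambda>y. exp (\<theta> * (g y - g x - v x))) * exp (\<theta> * (g x - e))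
      + exp (\<theta> * M) * exp (- \<theta> * \<beta>)"
    by (simp add: expectation_add_finite[OF fs])
  also have "\<dots> \<le> \<rho> * exp (\<theta> * (g x - e)) + exp (\<theta> * M) * exp (- \<theta> * \<beta>)"
    using c by (intro add_mono mult_right_mono) auto
  finally show ?thesis .
qed

section \<open>Long-run averages under arbitrary policies\<close>

lemma finite_pointwise:
  fixes A :: "'n::finite \<Rightarrow> 'b set"
  assumes "\<And>i. finite (A i)"
  shows "finite {f. \<forall>i. f i \<in> A i}"
proof -
  have "{f. \<forall>i. f i \<in> A i} = PiE UNIV A" by auto
  then show ?thesis using assms by (simp add: finite_PiE)
qed

lemma finite_allowable: "finite (allowable bmax x b)"
proof (rule finite_subset)
  show "allowable bmax x b \<subseteq> {a. \<forall>i. a i \<in> {-\<bar>x i\<bar>..\<bar>x i\<bar>}}"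
  proof
    fix a assume "a \<in> allowable bmax x b"
    then have "\<forall>i. if x i \<ge> 0 then a i \<in> {0..x i} else a i \<in> {x i..0}"
      unfolding allowable_def by blast
    then have "a i \<in> {-\<bar>x i\<bar>..\<bar>x i\<bar>}" for i by (cases "x i \<ge> 0") (force dest: spec[of _ i])+
    then show "a \<in> {a. \<forall>i. a i \<in> {-\<bar>x i\<bar>..\<bar>x i\<bar>}}" by blast
  qed
qed (intro finite_pointwise, simp)

lemma allowableD:
  assumes "a \<in> allowable bmax x b"
  shows "x i \<ge> 0 \<Longrightarrow> 0 \<le> a i" "x i \<ge> 0 \<Longrightarrow> a i \<le> x i"
    "x i < 0 \<Longrightarrow> x i \<le> a i" "x i < 0 \<Longrightarrow> a i \<le> 0"
    "b + (\<Sum>i\<in>UNIV. a i) \<in> {0..int bmax}"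
proof -
  have *: "\<forall>i. if x i \<ge> 0 then a i \<in> {0..x i} else a i \<in> {x i..0}"
    using assms unfolding allowable_def by blast
  show "x i \<ge> 0 \<Longrightarrow> 0 \<le> a i" "x i \<ge> 0 \<Longrightarrow> a i \<le> x i"
    "x i < 0 \<Longrightarrow> x i \<le> a i" "x i < 0 \<Longrightarrow> a i \<le> 0"
    using spec[OF *, of i] by auto
  show "b + (\<Sum>i\<in>UNIV. a i) \<in> {0..int bmax}" using assms by (simp add: allowable_def)
qed

lemma time_average_linear:
  "time_average (\<lambda>t. f t + g t) T = time_average f T + time_average g T"
  "time_average (\<lambda>t. - f t) T = - time_average f T"
  "time_average (\<lambda>t. \<Sum>i\<in>I. h i t) T = (\<Sum>i\<in>I. time_average (h i) T)"
proof -
  show "time_average (\<lambda>t. f t + g t) T = time_average f T + time_average g T"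
    by (simp add: time_average_def sum.distrib distrib_left)
  show "time_average (\<lambda>t. - f t) T = - time_average f T"
    by (simp add: time_average_def sum_negf)
  have "(\<Sum>t=0..T. \<Sum>i\<in>I. h i t) = (\<Sum>i\<in>I. \<Sum>t=0..T. h i t)" by (rule sum.swap)
  then show "time_average (\<lambda>t. \<Sum>i\<in>I. h i t) T = (\<Sum>i\<in>I. time_average (h i) T)"
    by (simp add: time_average_def sum_distrib_left)
qed

text \<open>Summing the one-step inequality telescopes the potential, and a bounded potential
  contributes only O(1/T) to the average.\<close>

lemma time_average_lower_bound:
  assumes lim: "time_average f \<longlonglongrightarrow> L" and B: "\<And>t. \<bar>\<phi> t\<bar> \<le> M"
    and step: "\<And>t. f t + \<phi> (Suc t) \<ge> \<phi> t + c"
  shows "L \<ge> c"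
proof -
  have sum: "(\<Sum>t=0..T. f t) \<ge> (real T + 1) * c - 2 * M" for T
  proof -
    have "(\<Sum>t=0..T. f t) + \<phi> (Suc T) \<ge> \<phi> 0 + (real T + 1) * c"
    proof (induction T)
      case 0
      then show ?case using step[of 0] by simp
    next
      case (Suc T)
      then show ?case using step[of "Suc T"] by (simp add: algebra_simps)
    qed
    then show ?thesis using B[of 0] B[of "Suc T"] by linarith
  qed
  \<comment> \<open>\<open>time_average\<close> divides \<open>T + 1\<close> summands by
    \<open>T\<close>; the additional summand is the extra \<open>c\<close> in the vanishing
    term.\<close>
  have "(\<lambda>T. c + (c - 2 * M) * inverse (real T)) \<longlonglongrightarrow> c + 0"
    by (intro tendsto_add tendsto_const tendsto_mult_right_zero lim_inverse_n)
  then have "(\<lambda>T. c + (c - 2 * M) * inverse (real T)) \<longlonglongrightarrow> c" by simp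
  moreover have "\<forall>\<^sub>F T in sequentially. c + (c - 2 * M) * inverse (real T) \<le> time_average f T"
  proof (rule eventually_sequentiallyI[of 1])
    fix T :: nat assume "1 \<le> T"
    then have "c + (c - 2 * M) * inverse (real T) = ((real T + 1) * c - 2 * M) / real T"
      by (simp add: field_simps)
    also have "\<dots> \<le> (\<Sum>t=0..T. f t) / real T" using sum by (intro divide_right_mono) auto
    finally show "c + (c - 2 * M) * inverse (real T) \<le> time_average f T"
      by (simp add: time_average_def)
  qed
  ultimately show ?thesis using lim tendsto_le[OF sequentially_bot] by blast
qed

locale battery =
  fixes S :: "('n::finite \<Rightarrow> int) set" and K :: "('n \<Rightarrow> int) \<Rightarrow> ('n \<Rightarrow> int) pmf"
    and \<pi> :: "('n \<Rightarrow> int) pmf"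
  assumes finite_S: "finite S" and irreducible: "irreducible_chain S K"
    and stationary: "stationary_distribution S K \<pi>"
    and lazy: "\<And>s. s \<in> S \<Longrightarrow> pmf (K s) s > 0"
    and net_generative: "\<And>i. drift S \<pi> i > 0"
begin

lemma closed_S: "x \<in> S \<Longrightarrow> set_pmf (K x) \<subseteq> S"
  using irreducible by (auto simp: irreducible_chain_def)

lemma finite_K: "x \<in> S \<Longrightarrow> finite (set_pmf (K x))"
  using closed_S finite_S finite_subset by blast

definition needy :: "'n set" where
  "needy = {i. \<exists>s\<in>S. s i < 0}"

lemma not_needy: "s \<in> S \<Longrightarrow> i \<notin> needy \<Longrightarrow> 0 \<le> s i"
  by (force simp: needy_def)

lemma process_support:
  assumes p: "is_policy S bmax p" and \<mu>: "set_pmf \<mu> \<subseteq> S \<times> {0..int bmax}"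
  shows "finite (set_pmf (process K \<mu> p t)) \<and>
    (\<forall>(h, x, b) \<in> set_pmf (process K \<mu> p t). x \<in> S \<and> b \<in> {0..int bmax})"
proof (induction t)
  case 0
  have "finite (set_pmf \<mu>)" using \<mu> finite_S by (meson finite_SigmaI finite_atLeastAtMost_int finite_subset)
  then show ?case using \<mu> by auto
next
  case (Suc t)
  have pol: "set_pmf (p h x b) \<subseteq> allowable bmax x b" if "(h, x, b) \<in> set_pmf (process K \<mu> p t)" for h x b
    using Suc p that unfolding is_policy_def by fast
  show ?case
  proof (intro conjI)
    have "finite (set_pmf (p h x b))" "finite (set_pmf (K x))"
      if "(h, x, b) \<in> set_pmf (process K \<mu> p t)" for h x b
      using finite_subset[OF pol[OF that] finite_allowable] Suc finite_K that by fast+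
    with Suc show "finite (set_pmf (process K \<mu> p (Suc t)))" by auto
    show "\<forall>(h, x, b) \<in> set_pmf (process K \<mu> p (Suc t)). x \<in> S \<and> b \<in> {0..int bmax}"
    proof clarify
      fix h' x' b' assume "(h', x', b') \<in> set_pmf (process K \<mu> p (Suc t))"
      then obtain h x b a where 1: "(h, x, b) \<in> set_pmf (process K \<mu> p t)"
        and a: "a \<in> set_pmf (p h x b)" and 2: "x' \<in> set_pmf (K x)" "b' = b + (\<Sum>i\<in>UNIV. a i)"
        by auto
      have "x \<in> S" using Suc 1 by fast
      then have "x' \<in> S" using 2 closed_S by blast
      moreover have "b' \<in> {0..int bmax}" using allowableD(5) pol[OF 1] a 2 by blast
      ultimately show "x' \<in> S \<and> b' \<in> {0..int bmax}" ..
    qed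
  qed
qed

lemma
  assumes p: "is_policy S bmax p" and \<mu>: "set_pmf \<mu> \<subseteq> S \<times> {0..int bmax}"
  shows expectation_state_action:
      "measure_pmf.expectation (state_action_law K \<mu> p t) (F :: _ \<Rightarrow> real) =
       measure_pmf.expectation (process K \<mu> p t)
         (\<lambda>(h, x, b). measure_pmf.expectation (p h x b) (\<lambda>a. F (x, a)))"
    and expectation_process_Suc:
      "measure_pmf.expectation (process K \<mu> p (Suc t)) (\<lambda>(h, x, b). W x b :: real) =
       measure_pmf.expectation (process K \<mu> p t) (\<lambda>(h, x, b). measure_pmf.expectation (p h x b)
         (\<lambda>a. measure_pmf.expectation (K x) (\<lambda>x'. W x' (b + (\<Sum>i\<in>UNIV. a i)))))"
    and finite_state_action: "finite (set_pmf (state_action_law K \<mu> p t))"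
proof -
  note sup = process_support[OF p \<mu>, of t]
  have fin: "finite (set_pmf (p h x b))" "finite (set_pmf (K x))"
      if "(h, x, b) \<in> set_pmf (process K \<mu> p t)" for h x b
  proof -
    have "x \<in> S" "b \<in> {0..int bmax}" using sup that by auto
    then have "set_pmf (p h x b) \<subseteq> allowable bmax x b" "finite (set_pmf (K x))"
      using p finite_K by (auto simp: is_policy_def)
    then show "finite (set_pmf (p h x b))" "finite (set_pmf (K x))"
      using finite_subset[OF _ finite_allowable] by auto
  qed
  show "measure_pmf.expectation (state_action_law K \<mu> p t) (F :: _ \<Rightarrow> real) =
       measure_pmf.expectation (process K \<mu> p t)
         (\<lambda>(h, x, b). measure_pmf.expectation (p h x b) (\<lambda>a. F (x, a)))"
  proof -
    have "measure_pmf.expectation (state_action_law K \<mu> p t) F = measure_pmf.expectation (process K \<mu> p t)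
        (\<lambda>z. measure_pmf.expectation ((\<lambda>(h, x, b). map_pmf (Pair x) (p h x b)) z) F)"
      unfolding state_action_law_def using sup fin by (intro expectation_bind_finite) auto
    also have "\<dots> = measure_pmf.expectation (process K \<mu> p t)
        (\<lambda>(h, x, b). measure_pmf.expectation (p h x b) (\<lambda>a. F (x, a)))"
      by (intro expectation_cong_support, clarify) simp
    finally show ?thesis .
  qed
  show "finite (set_pmf (state_action_law K \<mu> p t))"
    unfolding state_action_law_def using sup fin by auto
  show "measure_pmf.expectation (process K \<mu> p (Suc t)) (\<lambda>(h, x, b). W x b :: real) =
       measure_pmf.expectation (process K \<mu> p t) (\<lambda>(h, x, b). measure_pmf.expectation (p h x b)
         (\<lambda>a. measure_pmf.expectation (K x) (\<lambda>x'. W x' (b + (\<Sum>i\<in>UNIV. a i)))))"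
  proof -
    let ?step = "\<lambda>h x b. bind_pmf (p h x b) (\<lambda>a.
      map_pmf (\<lambda>x'. ((x, b, a) # h, x', b + (\<Sum>i\<in>UNIV. a i))) (K x))"
    have "measure_pmf.expectation (process K \<mu> p (Suc t)) (\<lambda>(h, x, b). W x b) =
      measure_pmf.expectation (process K \<mu> p t)
        (\<lambda>z. measure_pmf.expectation ((\<lambda>(h, x, b). ?step h x b) z) (\<lambda>(h, x, b). W x b))"
      unfolding process.simps using sup fin by (intro expectation_bind_finite) auto
    also have "\<dots> = measure_pmf.expectation (process K \<mu> p t) (\<lambda>(h, x, b).
        measure_pmf.expectation (p h x b)
         (\<lambda>a. measure_pmf.expectation (K x) (\<lambda>x'. W x' (b + (\<Sum>i\<in>UNIV. a i)))))"
    proof (intro expectation_cong_support, clarify)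
      fix h x b assume "(h, x, b) \<in> set_pmf (process K \<mu> p t)"
      note f = fin[OF this]
      have "measure_pmf.expectation (?step h x b) (\<lambda>(h, x, b). W x b) = measure_pmf.expectation (p h x b)
          (\<lambda>a. measure_pmf.expectation (map_pmf (\<lambda>x'. ((x, b, a) # h, x', b + (\<Sum>i\<in>UNIV. a i))) (K x))
            (\<lambda>(h, x, b). W x b))"
        using f by (intro expectation_bind_finite) auto
      then show "measure_pmf.expectation (?step h x b) (\<lambda>(h, x, b). W x b) = measure_pmf.expectation (p h x b)
         (\<lambda>a. measure_pmf.expectation (K x) (\<lambda>x'. W x' (b + (\<Sum>i\<in>UNIV. a i))))" by simp
    qed
    finally show ?thesis .
  qed
qed

text \<open>The one-step inequality is required for every allowable action, so it survives averaging
  over any randomized, history-dependent choice. The potential is automatically bounded because it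
  is evaluated at finitely many states and levels.\<close>

lemma long_run_lower_bound:
  fixes Y :: "('n \<Rightarrow> int) \<times> ('n \<Rightarrow> int) \<Rightarrow> real"
  assumes p: "is_policy S bmax p" and \<mu>: "set_pmf \<mu> \<subseteq> S \<times> {0..int bmax}"
    and step: "\<And>x b a. x \<in> S \<Longrightarrow> b \<in> {0..int bmax} \<Longrightarrow> a \<in> allowable bmax x b \<Longrightarrow>
      Y (x, a) + measure_pmf.expectation (K x) (\<lambda>x'. W x' (b + (\<Sum>i\<in>UNIV. a i))) \<ge> W x b + c"
    and lim: "time_average (\<lambda>t. measure_pmf.expectation (state_action_law K \<mu> p t) Y) \<longlonglongrightarrow> L"
  shows "L \<ge> c"
proof -
  define M where "M = (\<Sum>x\<in>S. \<Sum>b=0..int bmax. \<bar>W x b\<bar>)"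
  have M: "\<bar>W x b\<bar> \<le> M" if "x \<in> S" "b \<in> {0..int bmax}" for x b
  proof -
    have "\<bar>W x b\<bar> \<le> (\<Sum>b=0..int bmax. \<bar>W x b\<bar>)" using that by (intro member_le_sum[where f = "\<lambda>b. \<bar>W x b\<bar>"]) auto
    also have "\<dots> \<le> M" unfolding M_def using that finite_S
      by (intro member_le_sum[where f = "\<lambda>x. \<Sum>b=0..int bmax. \<bar>W x b\<bar>"] sum_nonneg) auto
    finally show ?thesis .
  qed
  let ?\<phi> = "\<lambda>t. measure_pmf.expectation (process K \<mu> p t) (\<lambda>(h, x, b). W x b)"
  let ?W = "\<lambda>(h, x, b). W x b"
  let ?EY = "\<lambda>(h, x, b). measure_pmf.expectation (p h x b) (\<lambda>a. Y (x, a))"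
  let ?EW = "\<lambda>(h, x, b). measure_pmf.expectation (p h x b)
    (\<lambda>a. measure_pmf.expectation (K x) (\<lambda>x'. W x' (b + (\<Sum>i\<in>UNIV. a i))))"
  note sup = process_support[OF p \<mu>]
  show ?thesis
  proof (rule time_average_lower_bound[OF lim, where \<phi> = ?\<phi> and M = M])
    show "\<bar>?\<phi> t\<bar> \<le> M" for t
      using sup[of t] M by (intro expectation_bounds_finite) auto
  next
    fix t
    have fin: "finite (set_pmf (process K \<mu> p t))" using sup by blast
    have "?\<phi> t + c = measure_pmf.expectation (process K \<mu> p t) (\<lambda>z. ?W z + c)"
      by (simp only: expectation_add_finite[OF fin] expectation_const)
    also have "\<dots> \<le> measure_pmf.expectation (process K \<mu> p t) (\<lambda>z. ?EY z + ?EW z)"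
    proof (intro expectation_mono_finite fin)
      fix z assume z: "z \<in> set_pmf (process K \<mu> p t)"
      obtain h x b where hxb: "z = (h, x, b)" by (cases z)
      have x: "x \<in> S" "b \<in> {0..int bmax}" using sup[of t] z hxb by auto
      then have a: "set_pmf (p h x b) \<subseteq> allowable bmax x b" using p by (auto simp: is_policy_def)
      have f: "finite (set_pmf (p h x b))" by (rule finite_subset[OF a finite_allowable])
      have "measure_pmf.expectation (p h x b) (\<lambda>a. W x b + c) \<le>
        measure_pmf.expectation (p h x b) (\<lambda>a. Y (x, a) +
          measure_pmf.expectation (K x) (\<lambda>x'. W x' (b + (\<Sum>i\<in>UNIV. a i))))"
        using step[OF x] a by (intro expectation_mono_finite f) (simp add: subset_eq)
      then show "?W z + c \<le> ?EY z + ?EW z"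
        unfolding hxb prod.case expectation_const expectation_add_finite[OF f] .
    qed
    also have "\<dots> = measure_pmf.expectation (process K \<mu> p t) ?EY + measure_pmf.expectation (process K \<mu> p t) ?EW"
      by (rule expectation_add_finite[OF fin])
    also have "\<dots> = measure_pmf.expectation (state_action_law K \<mu> p t) Y + ?\<phi> (Suc t)"
      by (simp only: expectation_state_action[OF p \<mu>] expectation_process_Suc[OF p \<mu>])
    finally show "?\<phi> t + c \<le> measure_pmf.expectation (state_action_law K \<mu> p t) Y + ?\<phi> (Suc t)" .
  qed
qed

lemma LLR_sys_nonneg:
  assumes p: "p \<in> feasible_policies S K \<mu> bmax" and \<mu>: "set_pmf \<mu> \<subseteq> S \<times> {0..int bmax}"
  shows "LLR_sys K \<mu> p \<ge> 0"
  unfolding LLR_sys_def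
proof (rule sum_nonneg)
  fix i
  have pol: "is_policy S bmax p" and conv: "convergent (time_average (expected_loss K \<mu> p i))"
    using p by (auto simp: feasible_policies_def)
  have eq: "expected_loss K \<mu> p i = (\<lambda>t. measure_pmf.expectation (state_action_law K \<mu> p t)
      (\<lambda>(x, a). of_bool (x i < 0) * real_of_int (a i - x i)))"
    by (rule ext) (simp add: expected_loss_def)
  have lim: "time_average (expected_loss K \<mu> p i) \<longlonglongrightarrow> LLR K \<mu> p i"
    using conv by (simp add: LLR_def convergent_LIMSEQ_iff)
  show "LLR K \<mu> p i \<ge> 0"
  proof (rule long_run_lower_bound[OF pol \<mu> _ lim[unfolded eq], where W = "\<lambda>_ _. 0"])
    fix x :: "'n \<Rightarrow> int" and b :: int and a :: "'n \<Rightarrow> int"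
    assume "a \<in> allowable bmax x b"
    from allowableD(3)[OF this, of i]
    show "0 + 0 \<le> (case (x, a) of (x, a) \<Rightarrow> of_bool (x i < 0) * real_of_int (a i - x i)) +
        measure_pmf.expectation (K x) (\<lambda>x'. 0)" by auto
  qed
qed

text \<open>If the needy users have a joint deficit in state \<open>s\<close>, then while the chain stays in
  \<open>s\<close> the battery level falls by at least one per step unless load is lost or a user that is
  never in deficit contributes. The latter cannot happen at a positive rate: the battery is bounded
  and every user satisfies the fairness constraint.\<close>

lemma LLR_sys_exponential_lower_bound:
  assumes s: "s \<in> S" and deficit: "(\<Sum>i\<in>needy. s i) < 0"
  shows "\<exists>\<kappa>>0. \<exists>r>0. r < 1 \<and> (\<forall>bmax \<mu> p. set_pmf \<mu> \<subseteq> S \<times> {0..int bmax} \<longrightarrow>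
    p \<in> feasible_policies S K \<mu> bmax \<longrightarrow> LLR_sys K \<mu> p \<ge> \<kappa> * r ^ bmax)"
proof -
  define q where "q = pmf (K s) s"
  have q: "0 < q" "q \<le> 1" using lazy[OF s] by (auto simp: q_def pmf_le_1)
  \<comment> \<open>Halving \<open>q\<close> creates slack: if the level drops by one while the
    chain is in \<open>s\<close>, the expected next value of \<open>V\<close> is at least twice the
    present one. The surplus pays for the time spent in \<open>s\<close>.\<close>
  define r where "r = q / 2"
  have r: "0 < r" "r \<le> 1 / 2" using q by (auto simp: r_def)
  have q2: "q = 2 * r" by (simp add: r_def)
  have "(\<Sum>x\<in>S. of_bool (x = s) * pmf \<pi> x) = pmf \<pi> s"
    using finite_S s by (simp add: sum.remove of_bool_def)
  then have "(\<Sum>x\<in>S. of_bool (x = s) * pmf \<pi> x) > 0"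
    using stationary_pmf_pos[OF irreducible stationary s] by simp
  \<comment> \<open>Applied to the indicator of \<open>s\<close>, the Poisson inequality certifies
    that \<open>s\<close> is visited with frequency at least \<delta>.\<close>
  from poisson_inequality[OF finite_S irreducible stationary this]
  obtain g and \<delta> :: real where \<delta>: "\<delta> > 0" and
    g: "\<And>x. x \<in> S \<Longrightarrow> measure_pmf.expectation (K x) g \<le> g x + of_bool (x = s) - \<delta>"
    by auto
  have "LLR_sys K \<mu> p \<ge> (\<delta> * r) * r ^ bmax"
    if \<mu>: "set_pmf \<mu> \<subseteq> S \<times> {0..int bmax}" and p: "p \<in> feasible_policies S K \<mu> bmax" for bmax \<mu> p
  proof -
    have pol: "is_policy S bmax p"
      and conv: "\<And>i. convergent (time_average (expected_loss K \<mu> p i))"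
        "\<And>i. convergent (time_average (expected_accepted K \<mu> p i))"
      and fair: "\<And>i. lim (time_average (expected_accepted K \<mu> p i)) \<ge> 0"
      using p by (auto simp: feasible_policies_def)
    define acc where "acc i = lim (time_average (expected_accepted K \<mu> p i))" for i
    have lims: "time_average (expected_loss K \<mu> p i) \<longlonglongrightarrow> LLR K \<mu> p i"
      "time_average (expected_accepted K \<mu> p i) \<longlonglongrightarrow> acc i" for i
      using conv by (auto simp: LLR_def acc_def convergent_LIMSEQ_iff)
    have loss_eq: "expected_loss K \<mu> p i t = measure_pmf.expectation (state_action_law K \<mu> p t)
      (\<lambda>z. of_bool (fst z i < 0) * real_of_int (snd z i - fst z i))" for i t
      by (simp add: expected_loss_def case_prod_unfold)
    have acc_eq: "expected_accepted K \<mu> p i t = measure_pmf.expectation (state_action_law K \<mu> p t)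
      (\<lambda>z. real_of_int (snd z i))" for i t
      by (simp add: expected_accepted_def case_prod_unfold)
    note fin = finite_state_action[OF pol \<mu>]
    \<comment> \<open>With the battery level as potential, the total contribution cannot be positive
      in the long run. Fairness for the needy users then leaves nothing positive for the
      others.\<close>
    have "- (\<Sum>i\<in>UNIV. acc i) \<ge> 0"
    proof (rule long_run_lower_bound[OF pol \<mu>, where W = "\<lambda>x b. real_of_int b"
          and Y = "\<lambda>z. - (\<Sum>i\<in>UNIV. real_of_int (snd z i))"])
      have "(\<lambda>t. measure_pmf.expectation (state_action_law K \<mu> p t) (\<lambda>z. - (\<Sum>i\<in>UNIV. real_of_int (snd z i))))
          = (\<lambda>t. - (\<Sum>i\<in>UNIV. expected_accepted K \<mu> p i t))"
        by (simp add: acc_eq expectation_sum_finite[OF fin])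
      then show "time_average (\<lambda>t. measure_pmf.expectation (state_action_law K \<mu> p t)
          (\<lambda>z. - (\<Sum>i\<in>UNIV. real_of_int (snd z i)))) \<longlonglongrightarrow> - (\<Sum>i\<in>UNIV. acc i)"
        using tendsto_minus[OF tendsto_sum[of UNIV, OF lims(2)]]
        by (simp add: time_average_linear[abs_def])
    qed simp
    moreover have "(\<Sum>i\<in>UNIV. acc i) = (\<Sum>i\<in>needy. acc i) + (\<Sum>i\<in>-needy. acc i)"
      by (subst sum.union_disjoint[symmetric]) auto
    moreover have "(\<Sum>i\<in>needy. acc i) \<ge> 0" using fair by (intro sum_nonneg) (simp add: acc_def)
    ultimately have acc: "(\<Sum>i\<in>-needy. acc i) \<le> 0" by linarith
    define \<omega> where "\<omega> = r ^ (bmax + 1)"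
    have \<omega>: "\<omega> > 0" using r by (simp add: \<omega>_def)
    \<comment> \<open>Lost load plus the contributions of users that are never in deficit. Along
      allowable actions this is a nonnegative integer, hence at least 1 unless it vanishes; in state
      \<open>s\<close>, vanishing forces the level down.\<close>
    define Y where "Y z = (\<Sum>i\<in>UNIV. of_bool (fst z i < 0) * real_of_int (snd z i - fst z i)) +
        (\<Sum>i\<in>-needy. real_of_int (snd z i))" for z :: "('n \<Rightarrow> int) \<times> ('n \<Rightarrow> int)"
    define V :: "('n \<Rightarrow> int) \<Rightarrow> int \<Rightarrow> real" where "V x b = of_bool (x = s) * r ^ (nat b + 1)" for x b
    have V: "Y (x, a) + measure_pmf.expectation (K x) (\<lambda>x'. V x' (b + (\<Sum>i\<in>UNIV. a i)))
        \<ge> V x b + \<omega> * of_bool (x = s)"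
      if x: "x \<in> S" and b: "b \<in> {0..int bmax}" and a: "a \<in> allowable bmax x b" for x b a
    proof -
      define b' where "b' = b + (\<Sum>i\<in>UNIV. a i)"
      define y where "y = (\<Sum>i\<in>UNIV. of_bool (x i < 0) * (a i - x i)) + (\<Sum>i\<in>-needy. a i)"
      have Yy: "Y (x, a) = real_of_int y" by (simp add: Y_def y_def)
      have l0: "0 \<le> of_bool (x i < 0) * (a i - x i)" for i using allowableD(3)[OF a, of i] by auto
      have "0 \<le> a i" if "i \<notin> needy" for i using allowableD(1)[OF a, of i] not_needy[OF x that] by blast
      then have y0: "y \<ge> 0" unfolding y_def using l0 by (intro add_nonneg_nonneg sum_nonneg) auto
      have E: "measure_pmf.expectation (K x) (\<lambda>x'. V x' b') = r ^ (nat b' + 1) * pmf (K x) s"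
      proof -
        have "measure_pmf.expectation (K x) (\<lambda>x'. V x' b') = (\<Sum>x'\<in>{s}. V x' b' * pmf (K x) x')"
          by (intro integral_measure_pmf_real) (auto simp: V_def)
        then show ?thesis by (simp add: V_def)
      qed
      show ?thesis
      proof (cases "x = s")
        case False
        have "r ^ (nat b' + 1) * pmf (K x) s \<ge> 0" using r by simp
        moreover have "V x b = 0" using False by (simp add: V_def)
        ultimately show ?thesis unfolding b'_def[symmetric] Yy E using y0 False by simp
      next
        case True
        have up: "a i \<le> x i + of_bool (x i < 0) * (a i - x i)" for i
          using allowableD(2)[OF a, of i] by auto
        have "(\<Sum>i\<in>needy. a i) \<le> (\<Sum>i\<in>needy. x i) + (\<Sum>i\<in>needy. of_bool (x i < 0) * (a i - x i))"
          unfolding sum.distrib[symmetric] by (intro sum_mono up)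
        also have "(\<Sum>i\<in>needy. of_bool (x i < 0) * (a i - x i)) \<le> (\<Sum>i\<in>UNIV. of_bool (x i < 0) * (a i - x i))"
          using l0 by (intro sum_mono2) auto
        finally have "(\<Sum>i\<in>needy. a i) \<le> - 1 + (\<Sum>i\<in>UNIV. of_bool (x i < 0) * (a i - x i))"
          using deficit True by simp
        moreover have "(\<Sum>i\<in>UNIV. a i) = (\<Sum>i\<in>needy. a i) + (\<Sum>i\<in>-needy. a i)"
          by (subst sum.union_disjoint[symmetric]) auto
        ultimately have b'y: "b' \<le> b - 1 + y" by (simp add: b'_def y_def)
        have b'0: "b' \<ge> 0" using allowableD(5)[OF a] by (simp add: b'_def)
        have rb: "\<omega> \<le> r ^ (nat b + 1)" unfolding \<omega>_def using r b by (intro power_decreasing) auto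
        \<comment> \<open>For \<open>y = 0\<close> the level drops by at least one and the slack in
          \<open>r\<close> applies; otherwise \<open>y \<ge> 1\<close> and
          \<open>2 * r \<le> 1\<close> suffice.\<close>
        have "y + r ^ (nat b' + 1) * q \<ge> 2 * r ^ (nat b + 1)"
        proof (cases "y = 0")
          case True
          then have "nat b' + 2 \<le> nat b + 1" using b'y b'0 by linarith
          then have "r ^ (nat b + 1) \<le> r ^ (nat b' + 2)" using r by (intro power_decreasing) auto
          moreover have "r ^ (nat b' + 1) * q = 2 * r ^ (nat b' + 2)" by (simp add: q2)
          ultimately show ?thesis using True by linarith
        next
          case False
          have "r ^ (nat b + 1) \<le> r ^ 1" using r by (intro power_decreasing) auto
          moreover have "r ^ (nat b' + 1) * q \<ge> 0" using r q by simp
          moreover have "real_of_int y \<ge> 1" using y0 False by linarith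
          ultimately show ?thesis using r unfolding power_one_right by linarith
        qed
        moreover have "V x b = r ^ (nat b + 1)" using True by (simp add: V_def)
        moreover have "pmf (K x) s = q" using True by (simp add: q_def)
        ultimately show ?thesis unfolding b'_def[symmetric] Yy E using True rb by simp
      qed
    qed
    \<comment> \<open>Subtracting \<open>\<omega> * g\<close> from the potential trades the gain
      \<omega> per visit to \<open>s\<close> for a gain \<open>\<omega> * \<delta>\<close> in every
      step.\<close>
    have "LLR_sys K \<mu> p + (\<Sum>i\<in>-needy. acc i) \<ge> \<omega> * \<delta>"
    proof (rule long_run_lower_bound[OF pol \<mu>, where Y = Y and W = "\<lambda>x b. V x b - \<omega> * g x"])
      have "(\<lambda>t. measure_pmf.expectation (state_action_law K \<mu> p t) Y) =
          (\<lambda>t. (\<Sum>i\<in>UNIV. expected_loss K \<mu> p i t) + (\<Sum>i\<in>-needy. expected_accepted K \<mu> p i t))"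
        unfolding Y_def by (simp only: loss_eq acc_eq expectation_sum_finite[OF fin] expectation_add_finite[OF fin])
      then show "time_average (\<lambda>t. measure_pmf.expectation (state_action_law K \<mu> p t) Y)
          \<longlonglongrightarrow> LLR_sys K \<mu> p + (\<Sum>i\<in>-needy. acc i)"
        using tendsto_add[OF tendsto_sum[of UNIV, OF lims(1)] tendsto_sum[of "-needy", OF lims(2)]]
        by (simp add: time_average_linear[abs_def] LLR_sys_def)
    next
      fix x b a assume x: "x \<in> S" and b: "b \<in> {0..int bmax}" and a: "a \<in> allowable bmax x b"
      have "measure_pmf.expectation (K x) (\<lambda>x'. V x' (b + (\<Sum>i\<in>UNIV. a i)) - \<omega> * g x') =
          measure_pmf.expectation (K x) (\<lambda>x'. V x' (b + (\<Sum>i\<in>UNIV. a i))) - \<omega> * measure_pmf.expectation (K x) g"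
        by (simp add: expectation_diff_finite[OF finite_K[OF x]])
      moreover have "\<omega> * measure_pmf.expectation (K x) g \<le> \<omega> * (g x + of_bool (x = s) - \<delta>)"
        using g[OF x] \<omega> by (intro mult_left_mono) auto
      ultimately show "V x b - \<omega> * g x + \<omega> * \<delta> \<le> Y (x, a) +
          measure_pmf.expectation (K x) (\<lambda>x'. V x' (b + (\<Sum>i\<in>UNIV. a i)) - \<omega> * g x')"
        using V[OF x b a] by (simp add: algebra_simps)
    qed
    then show ?thesis using acc by (simp add: \<omega>_def mult.commute mult.left_commute)
  qed
  moreover have "\<delta> * r > 0" using \<delta> r by simp
  ultimately show ?thesis using r by (intro exI[of _ "\<delta> * r"] conjI exI[of _ r]) auto
qed

end

section \<open>Policies with memory\<close>

lemma time_average_telescope: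
  assumes f: "\<And>t. f t = \<phi> (Suc t) - \<phi> t" and lim: "(\<lambda>T. \<phi> (Suc T) / real T) \<longlonglongrightarrow> 0"
  shows "time_average f \<longlonglongrightarrow> 0"
proof -
  have s: "(\<Sum>t=0..T. f t) = \<phi> (Suc T) - \<phi> 0" for T
    unfolding f by (induction T) auto
  then have "time_average f = (\<lambda>T. \<phi> (Suc T) / real T - \<phi> 0 * inverse (real T))"
    unfolding time_average_def[abs_def] s by (simp add: divide_inverse algebra_simps)
  moreover have "(\<lambda>T. \<phi> (Suc T) / real T - \<phi> 0 * inverse (real T)) \<longlonglongrightarrow> 0 - 0"
    by (intro tendsto_diff lim tendsto_mult_right_zero lim_inverse_n)
  ultimately show ?thesis by simp
qed

lemma bounded_over_n_tendsto_0:
  assumes "\<And>T. \<bar>\<phi> T\<bar> \<le> (M::real)"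
  shows "(\<lambda>T. \<phi> T / real T) \<longlonglongrightarrow> 0"
proof (rule Lim_null_comparison)
  show "\<forall>\<^sub>F T in sequentially. norm (\<phi> T / real T) \<le> M * inverse (real T)"
    using assms by (intro always_eventually allI) (simp add: divide_inverse abs_mult mult_right_mono)
  show "(\<lambda>T. M * inverse (real T)) \<longlonglongrightarrow> 0"
    by (rule tendsto_mult_right_zero[OF lim_inverse_n])
qed

lemma split_level:
  fixes cap :: "'n \<Rightarrow> int"
  assumes "finite U" "\<And>k. k \<in> U \<Longrightarrow> 0 \<le> cap k" "0 \<le> b" "b \<le> (\<Sum>k\<in>U. cap k)"
  shows "\<exists>e. (\<forall>k\<in>U. 0 \<le> e k \<and> e k \<le> cap k) \<and> (\<forall>k. k \<notin> U \<longrightarrow> e k = 0) \<and> (\<Sum>k\<in>U. e k) = b"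
  using assms
proof (induction U arbitrary: b rule: finite_induct)
  case (insert u U)
  let ?c = "min b (cap u)"
  have "0 \<le> b - ?c" "b - ?c \<le> (\<Sum>k\<in>U. cap k)" using insert.prems insert.hyps sum_nonneg[of U cap] by auto
  with insert.IH[of "b - ?c"] insert.prems obtain e where
    e: "\<forall>k\<in>U. 0 \<le> e k \<and> e k \<le> cap k" "\<forall>k. k \<notin> U \<longrightarrow> e k = 0" "(\<Sum>k\<in>U. e k) = b - ?c" by auto
  have "(\<Sum>k\<in>U. (e(u := ?c)) k) = (\<Sum>k\<in>U. e k)" using insert.hyps by (intro sum.cong) auto
  then have "(\<Sum>k\<in>insert u U. (e(u := ?c)) k) = b" using insert.hyps e(3) by simp
  moreover have "0 \<le> ?c" using insert.prems by auto
  ultimately show ?case using e by (intro exI[of _ "e(u := ?c)"]) auto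
qed (auto intro: exI[of _ "\<lambda>_. 0"])

text \<open>Dividing by the number of all users makes the lower bound independent of
  \<open>U\<close>. One member of \<open>U\<close> takes the remainder, so that the caps exhaust the
  battery exactly.\<close>

lemma equal_caps:
  fixes U :: "'n::finite set"
  assumes "U \<noteq> {}"
  shows "\<exists>cap. (\<forall>k. int (bmax div CARD('n)) \<le> cap k) \<and> (\<Sum>k\<in>U. cap k) = int bmax"
proof -
  obtain u where u: "u \<in> U" using assms by auto
  then have c: "card U \<ge> 1" by (metis One_nat_def Suc_leI card_gt_0_iff empty_iff finite)
  define \<beta> where "\<beta> = bmax div CARD('n)"
  have "card U * \<beta> \<le> CARD('n) * \<beta>" by (intro mult_right_mono card_mono) auto
  also have "\<dots> \<le> bmax" by (simp add: \<beta>_def)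
  finally have le: "int (card U) * int \<beta> \<le> int bmax" by (metis of_nat_le_iff of_nat_mult)
  let ?cap = "(\<lambda>_. int \<beta>)(u := int bmax - (int (card U) - 1) * int \<beta>)"
  have "(\<Sum>k\<in>U - {u}. ?cap k) = (\<Sum>k\<in>U - {u}. int \<beta>)" by (intro sum.cong) auto
  also have "\<dots> = (int (card U) - 1) * int \<beta>" using u c by (simp add: of_nat_diff)
  finally have "(\<Sum>k\<in>U. ?cap k) = int bmax" using u by (simp add: sum.remove[of U u])
  moreover have "int \<beta> \<le> ?cap k" for k using le by (simp add: algebra_simps)
  ultimately show ?thesis unfolding \<beta>_def by blast
qed

text \<open>Policies that act deterministically on a memory state \<open>z\<close>, which is a function of the
  history; \<open>lvl z\<close> is the battery level that the memory state encodes.\<close>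

locale memory_policy = battery S K \<pi> for S :: "('n::finite \<Rightarrow> int) set" and K \<pi> +
  fixes bmax :: nat and \<mu> :: "(('n \<Rightarrow> int) \<times> int) pmf"
    and init :: "int \<Rightarrow> 'z" and act :: "('n \<Rightarrow> int) \<Rightarrow> 'z \<Rightarrow> 'n \<Rightarrow> int"
    and upd :: "('n \<Rightarrow> int) \<Rightarrow> 'z \<Rightarrow> 'z" and lvl :: "'z \<Rightarrow> int" and Z :: "'z set"
  assumes initial: "set_pmf \<mu> \<subseteq> S \<times> {0..int bmax}"
    and init: "\<And>b. b \<in> {0..int bmax} \<Longrightarrow> init b \<in> Z \<and> lvl (init b) = b"
    and act: "\<And>x z. x \<in> S \<Longrightarrow> z \<in> Z \<Longrightarrow> act x z \<in> allowable bmax x (lvl z)"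
    and upd: "\<And>x z. x \<in> S \<Longrightarrow> z \<in> Z \<Longrightarrow> upd x z \<in> Z"
    and lvl: "\<And>x z. x \<in> S \<Longrightarrow> z \<in> Z \<Longrightarrow> lvl (upd x z) = lvl z + (\<Sum>i\<in>UNIV. act x z i)"
begin

text \<open>The level \<open>b\<close> matters only for the empty history. Otherwise the recursion
  ends with the level recorded in the oldest entry, which is the initial one.\<close>

primrec mem :: "'n history \<Rightarrow> int \<Rightarrow> 'z" where
  "mem [] b = init b"
| "mem (e # h) b = (case e of (x, b', a) \<Rightarrow> upd x (mem h b'))"

text \<open>\<open>is_policy\<close> ranges over all histories, including those that never occur
  under this policy; there the zero action, which is always allowable, serves as default.\<close>

definition pol :: "'n policy" where
  "pol h x b = return_pmf
     (if act x (mem h b) \<in> allowable bmax x b then act x (mem h b) else (\<lambda>_. 0))"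

definition step :: "('n \<Rightarrow> int) \<times> 'z \<Rightarrow> (('n \<Rightarrow> int) \<times> 'z) pmf" where
  "step = (\<lambda>(x, z). map_pmf (\<lambda>x'. (x', upd x z)) (K x))"

primrec chain :: "nat \<Rightarrow> (('n \<Rightarrow> int) \<times> 'z) pmf" where
  "chain 0 = map_pmf (\<lambda>(x, b). (x, init b)) \<mu>"
| "chain (Suc t) = bind_pmf (chain t) step"

lemma is_policy_pol: "is_policy S bmax pol"
  unfolding is_policy_def pol_def by (auto simp: allowable_def)

lemma process_memory:
  "(h, x, b) \<in> set_pmf (process K \<mu> pol t) \<Longrightarrow> x \<in> S \<and> mem h b \<in> Z \<and> lvl (mem h b) = b"
proof (induction t arbitrary: h x b)
  case 0
  then show ?case using initial init by auto
next
  case (Suc t)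
  then obtain h0 x0 b0 where 0: "(h0, x0, b0) \<in> set_pmf (process K \<mu> pol t)"
    and *: "\<exists>a \<in> set_pmf (pol h0 x0 b0). h = (x0, b0, a) # h0 \<and> x \<in> set_pmf (K x0) \<and> b = b0 + (\<Sum>i\<in>UNIV. a i)"
    by auto
  from Suc.IH[OF 0] have 1: "x0 \<in> S" "mem h0 b0 \<in> Z" "lvl (mem h0 b0) = b0" by auto
  then have "pol h0 x0 b0 = return_pmf (act x0 (mem h0 b0))"
    using act[OF 1(1,2)] by (simp add: pol_def)
  with * have "h = (x0, b0, act x0 (mem h0 b0)) # h0" "x \<in> set_pmf (K x0)"
    "b = b0 + (\<Sum>i\<in>UNIV. act x0 (mem h0 b0) i)" by auto
  then show ?case using 1 closed_S upd lvl by auto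
qed

text \<open>Histories enter the dynamics only through the memory state, so net generation and memory
  together form a Markov chain, and all later estimates refer to it.\<close>

lemma map_process: "map_pmf (\<lambda>(h, x, b). (x, mem h b)) (process K \<mu> pol t) = chain t"
proof (induction t)
  case 0
  show ?case by (simp add: pmf.map_comp o_def case_prod_unfold)
next
  case (Suc t)
  have "map_pmf (\<lambda>(h, x, b). (x, mem h b)) (process K \<mu> pol (Suc t)) =
      bind_pmf (process K \<mu> pol t) (\<lambda>(h, x, b). step (x, mem h b))"
    unfolding process.simps map_bind_pmf
    by (intro bind_pmf_cong refl)
       (auto simp: pol_def step_def map_bind_pmf bind_return_pmf pmf.map_comp o_def)
  also have "\<dots> = bind_pmf (map_pmf (\<lambda>(h, x, b). (x, mem h b)) (process K \<mu> pol t)) step"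
    unfolding bind_map_pmf by (intro bind_pmf_cong refl) auto
  finally show ?case by (simp only: Suc chain.simps)
qed

lemma state_action_law_pol:
  "state_action_law K \<mu> pol t = map_pmf (\<lambda>(x, z). (x, act x z)) (chain t)"
proof -
  have "state_action_law K \<mu> pol t =
      bind_pmf (process K \<mu> pol t) (\<lambda>(h, x, b). return_pmf (x, act x (mem h b)))"
    unfolding state_action_law_def
  proof (intro bind_pmf_cong refl, clarify)
    fix h x b assume "(h, x, b) \<in> set_pmf (process K \<mu> pol t)"
    from process_memory[OF this] act[of x "mem h b"]
    show "map_pmf (Pair x) (pol h x b) = return_pmf (x, act x (mem h b))"
      by (auto simp: pol_def)
  qed
  also have "\<dots> = map_pmf (\<lambda>(x, z). (x, act x z)) (map_pmf (\<lambda>(h, x, b). (x, mem h b)) (process K \<mu> pol t))"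
    unfolding map_pmf_def bind_assoc_pmf by (intro bind_pmf_cong refl) (auto simp: bind_return_pmf)
  finally show ?thesis by (simp only: map_process)
qed

lemma chain_support: "set_pmf (chain t) \<subseteq> S \<times> Z"
  unfolding map_process[symmetric] using process_memory by fastforce

lemma finite_chain: "finite (set_pmf (chain t))"
  unfolding map_process[symmetric] using process_support[OF is_policy_pol initial] by simp

lemma finite_step: "fst y \<in> S \<Longrightarrow> finite (set_pmf (step y))"
  by (auto simp: step_def finite_K split: prod.splits)

lemma expectation_chain_Suc:
  "measure_pmf.expectation (chain (Suc t)) (f :: _ \<Rightarrow> real) =
   measure_pmf.expectation (chain t) (\<lambda>y. measure_pmf.expectation (step y) f)"
  unfolding chain.simps using chain_support[of t]
  by (intro expectation_bind_finite finite_chain finite_step) auto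

lemma expected_loss_pol:
  "expected_loss K \<mu> pol i t = measure_pmf.expectation (chain t)
     (\<lambda>(x, z). of_bool (x i < 0) * real_of_int (act x z i - x i))"
  unfolding expected_loss_def state_action_law_pol by (simp add: case_prod_unfold)

lemma expected_accepted_pol:
  "expected_accepted K \<mu> pol i t = measure_pmf.expectation (chain t)
     (\<lambda>(x, z). real_of_int (act x z i))"
  unfolding expected_accepted_def state_action_law_pol by (simp add: case_prod_unfold)

text \<open>With finite memory the joint chain lives on a finite set. It may be reducible or
  periodic, but its Cesaro averages converge from every state, hence also under the initial
  law.\<close>

lemma time_average_chain_convergent:
  fixes f :: "('n \<Rightarrow> int) \<times> 'z \<Rightarrow> real"
  assumes "finite Z"
  shows "convergent (time_average (\<lambda>t. measure_pmf.expectation (chain t) f))"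
proof -
  interpret finite_kernel "S \<times> Z" step
    by unfold_locales (use finite_S assms upd in \<open>auto simp: step_def dest: closed_S[THEN subsetD]\<close>)
  obtain l where l: "\<And>y. y \<in> S \<times> Z \<Longrightarrow> (\<lambda>N. cesaro f N y) \<longlonglongrightarrow> l y"
    and "\<And>y. y \<in> S \<times> Z \<Longrightarrow> T l y = l y"
    using cesaro_converges[of f] by blast
  have pow: "measure_pmf.expectation (chain t) f' = measure_pmf.expectation (chain 0) ((T ^^ t) f')" for t f'
  proof (induction t arbitrary: f')
    case (Suc t)
    have "measure_pmf.expectation (chain (Suc t)) f' = measure_pmf.expectation (chain t) (T f')"
      unfolding T_def by (rule expectation_chain_Suc)
    also have "\<dots> = measure_pmf.expectation (chain 0) ((T ^^ Suc t) f')"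
      unfolding funpow_Suc_right o_apply by (rule Suc.IH)
    finally show ?case .
  qed simp
  have ces: "(\<Sum>t<N. measure_pmf.expectation (chain t) f) / real N = measure_pmf.expectation (chain 0) (cesaro f N)" for N
    unfolding cesaro_def pow[of _ f] integral_divide_zero
    by (simp only: expectation_sum_finite[OF finite_chain])
  have E0: "measure_pmf.expectation (chain 0) h = (\<Sum>y\<in>S \<times> Z. h y * pmf (chain 0) y)" for h :: "_ \<Rightarrow> real"
    using chain_support[of 0] finite_S assms by (intro integral_measure_pmf_real) auto
  have "(\<lambda>N. measure_pmf.expectation (chain 0) (cesaro f N)) \<longlonglongrightarrow> measure_pmf.expectation (chain 0) l"
    unfolding E0 by (intro tendsto_intros l)
  from LIMSEQ_Suc[OF this]
  have lim: "(\<lambda>T. measure_pmf.expectation (chain 0) (cesaro f (Suc T))) \<longlonglongrightarrow> measure_pmf.expectation (chain 0) l" .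
  \<comment> \<open>This factor corrects for the \<open>T + 1\<close> summands that
    \<open>time_average\<close> divides by \<open>T\<close>.\<close>
  have "(\<lambda>T. 1 + inverse (real T)) \<longlonglongrightarrow> 1 + 0"
    by (rule tendsto_add[OF tendsto_const lim_inverse_n])
  from tendsto_mult[OF this lim]
  have "(\<lambda>T. (1 + inverse (real T)) * measure_pmf.expectation (chain 0) (cesaro f (Suc T)))
      \<longlonglongrightarrow> (1 + 0) * measure_pmf.expectation (chain 0) l" .
  moreover have "\<forall>\<^sub>F T in sequentially. (1 + inverse (real T)) * measure_pmf.expectation (chain 0) (cesaro f (Suc T))
      = time_average (\<lambda>t. measure_pmf.expectation (chain t) f) T"
  proof (rule eventually_sequentiallyI[of 1])
    fix T :: nat assume "1 \<le> T"
    then have "1 + inverse (real T) = real (Suc T) / real T" by (simp add: field_simps)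
    then have "(1 + inverse (real T)) * (a / real (Suc T)) = 1 / real T * a" for a by simp
    then show "(1 + inverse (real T)) * measure_pmf.expectation (chain 0) (cesaro f (Suc T))
        = time_average (\<lambda>t. measure_pmf.expectation (chain t) f) T"
      unfolding ces[symmetric] time_average_def atLeast0AtMost lessThan_Suc_atMost .
  qed
  ultimately have "time_average (\<lambda>t. measure_pmf.expectation (chain t) f) \<longlonglongrightarrow> (1 + 0) * measure_pmf.expectation (chain 0) l"
    by (rule Lim_transform_eventually)
  then show ?thesis by (rule convergentI)
qed

lemma time_average_chain_le:
  fixes f \<Phi> :: "('n \<Rightarrow> int) \<times> 'z \<Rightarrow> real"
  assumes lim: "time_average (\<lambda>t. measure_pmf.expectation (chain t) f) \<longlonglongrightarrow> L"
    and B: "\<And>y. y \<in> S \<times> Z \<Longrightarrow> \<bar>\<Phi> y\<bar> \<le> M"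
    and st: "\<And>y. y \<in> S \<times> Z \<Longrightarrow> f y + measure_pmf.expectation (step y) \<Phi> \<le> \<Phi> y + c"
  shows "L \<le> c"
proof -
  let ?\<phi> = "\<lambda>t. - measure_pmf.expectation (chain t) \<Phi>"
  have "(\<lambda>T. - time_average (\<lambda>t. measure_pmf.expectation (chain t) f) T) \<longlonglongrightarrow> - L"
    using lim by (rule tendsto_minus)
  then have lim': "time_average (\<lambda>t. - measure_pmf.expectation (chain t) f) \<longlonglongrightarrow> - L"
    by (simp only: time_average_linear(2)[abs_def])
  have "- L \<ge> - c"
  proof (rule time_average_lower_bound[OF lim', where \<phi> = ?\<phi> and M = M])
    show "\<bar>?\<phi> t\<bar> \<le> M" for t
      unfolding abs_minus_cancel using B chain_support[of t]
      by (intro expectation_bounds_finite finite_chain) auto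
    fix t
    have "measure_pmf.expectation (chain t) (\<lambda>y. f y + measure_pmf.expectation (step y) \<Phi>) \<le>
        measure_pmf.expectation (chain t) (\<lambda>y. \<Phi> y + c)"
      using st chain_support[of t] by (intro expectation_mono_finite finite_chain) auto
    then show "- measure_pmf.expectation (chain t) f + ?\<phi> (Suc t) \<ge> ?\<phi> t + - c"
      unfolding expectation_chain_Suc by (simp add: expectation_add_finite[OF finite_chain])
  qed
  then show ?thesis by simp
qed

end

section \<open>Private shares\<close>

context battery begin

lemma uniform_poisson:
  "\<exists>g. \<exists>\<delta>>0. \<forall>i. \<forall>x\<in>S. measure_pmf.expectation (K x) (g i) \<le> g i x + real_of_int (x i) - \<delta>"
proof -
  have "\<exists>g. \<exists>\<delta>>0. \<forall>x\<in>S. measure_pmf.expectation (K x) g \<le> g x + real_of_int (x i) - \<delta>" for i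
    using net_generative[of i] unfolding drift_def
    by (intro poisson_inequality[OF finite_S irreducible stationary])
  then obtain g \<delta> where g: "\<And>i. \<delta> i > 0"
    "\<And>i x. x \<in> S \<Longrightarrow> measure_pmf.expectation (K x) (g i) \<le> g i x + real_of_int (x i) - \<delta> i"
    by metis
  define d where "d = Min (range \<delta>)"
  have "d > 0" unfolding d_def using g(1) by (subst Min_gr_iff) auto
  moreover have "d \<le> \<delta> i" for i unfolding d_def by (intro Min_le) auto
  then have "measure_pmf.expectation (K x) (g i) \<le> g i x + real_of_int (x i) - d" if "x \<in> S" for i x
    using g(2)[OF that, of i] by (smt (verit))
  ultimately show ?thesis by blast
qed

lemma uniform_bound:
  fixes g :: "'i::finite \<Rightarrow> ('n \<Rightarrow> int) \<Rightarrow> real"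
  shows "\<exists>M\<ge>0. \<forall>i. \<forall>x\<in>S. \<bar>g i x\<bar> \<le> M"
proof (intro exI conjI allI ballI)
  show "(\<Sum>i\<in>UNIV. \<Sum>x\<in>S. \<bar>g i x\<bar>) \<ge> 0" by (intro sum_nonneg) auto
  fix i x assume "x \<in> S"
  then have "\<bar>g i x\<bar> \<le> (\<Sum>x\<in>S. \<bar>g i x\<bar>)"
    using finite_S by (intro member_le_sum[where f = "\<lambda>x. \<bar>g i x\<bar>"]) auto
  also have "\<dots> \<le> (\<Sum>i\<in>UNIV. \<Sum>x\<in>S. \<bar>g i x\<bar>)"
    by (intro member_le_sum[where f = "\<lambda>i. \<Sum>x\<in>S. \<bar>g i x\<bar>"] sum_nonneg) auto
  finally show "\<bar>g i x\<bar> \<le> (\<Sum>i\<in>UNIV. \<Sum>x\<in>S. \<bar>g i x\<bar>)" .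
qed

text \<open>Every user runs its own account, truncated at 0 and at its cap. The accepted energy is
  the increment of a bounded quantity and averages to 0. Load is lost only when the account is
  nearly empty, and the exponential potential makes this rare.\<close>

lemma private_shares_policy:
  "\<exists>C>0. \<exists>\<theta>>0. \<forall>bmax \<mu>. set_pmf \<mu> \<subseteq> S \<times> {0..int bmax} \<longrightarrow>
    (\<exists>p\<in>feasible_policies S K \<mu> bmax. LLR_sys K \<mu> p \<le> C * exp (- \<theta> * real (bmax div CARD('n))))"
proof -
  obtain g \<delta> where \<delta>: "\<delta> > 0" and
    g: "\<And>i x. x \<in> S \<Longrightarrow> measure_pmf.expectation (K x) (g i) \<le> g i x + real_of_int (x i) - \<delta>"
    using uniform_poisson by auto
  obtain \<theta> \<rho> where \<theta>: "\<theta> > 0" and \<rho>: "0 \<le> \<rho>" "\<rho> < 1"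
    and con: "\<And>i x. x \<in> S \<Longrightarrow>
      measure_pmf.expectation (K x) (\<lambda>y. exp (\<theta> * (g i y - g i x - real_of_int (x i)))) \<le> \<rho>"
    using exponential_contraction[of UNIV S K \<delta> g "\<lambda>i x. real_of_int (x i)"] finite_S closed_S \<delta> g by auto
  obtain M where M: "M \<ge> 0" "\<And>i x. x \<in> S \<Longrightarrow> \<bar>g i x\<bar> \<le> M" using uniform_bound[of g] by auto
  obtain X where X: "X \<ge> 0" "\<And>i x. x \<in> S \<Longrightarrow> \<bar>real_of_int (x i)\<bar> \<le> X"
    using uniform_bound[of "\<lambda>i x. real_of_int (x i)"] by auto
  \<comment> \<open>Load is lost only if \<open>e k\<close> is below \<open>X\<close>, where the
    potential is at least \<open>A * exp (- \<theta> * (X + M))\<close>. This \<open>A\<close> makes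
    the contraction gain there at least \<open>X + 1\<close>, which exceeds the loss;
    \<open>X + 1\<close> instead of \<open>X\<close> keeps \<open>A\<close> positive.\<close>
  define A where "A = (X + 1) * exp (\<theta> * (X + M)) / (1 - \<rho>)"
  have A: "A > 0" using X \<rho> by (simp add: A_def)
  have A': "(1 - \<rho>) * A = (X + 1) * exp (\<theta> * (X + M))" using \<rho> by (simp add: A_def)
  define C where "C = real CARD('n) * (A * exp (\<theta> * M))"
  have "\<exists>p\<in>feasible_policies S K \<mu> bmax. LLR_sys K \<mu> p \<le> C * exp (- \<theta> * real (bmax div CARD('n)))"
    if \<mu>: "set_pmf \<mu> \<subseteq> S \<times> {0..int bmax}" for bmax \<mu>
  proof -
    define \<beta> where "\<beta> = bmax div CARD('n)"
    obtain cap where cap: "\<And>k::'n. int \<beta> \<le> cap k" "(\<Sum>k\<in>UNIV. cap k) = int bmax"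
      using equal_caps[of "UNIV :: 'n set" bmax] by (auto simp: \<beta>_def)
    have cap0: "0 \<le> cap k" for k using cap(1)[of k] by linarith
    define Z where "Z = {e. \<forall>k. e k \<in> {0..cap k}}"
    have "\<exists>e. e \<in> Z \<and> (\<Sum>k\<in>UNIV. e k) = b" if "b \<in> {0..int bmax}" for b
    proof -
      have "\<exists>e. (\<forall>k\<in>UNIV. 0 \<le> e k \<and> e k \<le> cap k) \<and> (\<forall>k. k \<notin> UNIV \<longrightarrow> e k = 0) \<and> (\<Sum>k\<in>UNIV. e k) = b"
        using that cap cap0 by (intro split_level) auto
      then show ?thesis by (auto simp: Z_def)
    qed
    then obtain init where init: "\<And>b. b \<in> {0..int bmax} \<Longrightarrow> init b \<in> Z \<and> (\<Sum>k\<in>UNIV. init b k) = b"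
      by metis
    define upd :: "('n \<Rightarrow> int) \<Rightarrow> ('n \<Rightarrow> int) \<Rightarrow> 'n \<Rightarrow> int"
      where "upd x e k = max 0 (min (cap k) (e k + x k))" for x e k
    define act :: "('n \<Rightarrow> int) \<Rightarrow> ('n \<Rightarrow> int) \<Rightarrow> 'n \<Rightarrow> int"
      where "act x e k = upd x e k - e k" for x e k
    have upd_Z: "upd x e \<in> Z" for x e using cap0 by (auto simp: Z_def upd_def)
    have sum_Z: "(\<Sum>k\<in>UNIV. e k) \<in> {0..int bmax}" if "e \<in> Z" for e
      using that cap(2) sum_mono[of UNIV e cap] by (auto simp: Z_def intro: sum_nonneg)
    interpret memory_policy S K \<pi> bmax \<mu> init act upd "\<lambda>e. \<Sum>k\<in>UNIV. e k" Z
    proof unfold_locales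
      fix x e assume x: "x \<in> S" and e: "e \<in> Z"
      have sum: "(\<Sum>k\<in>UNIV. e k) + (\<Sum>k\<in>UNIV. act x e k) = (\<Sum>k\<in>UNIV. upd x e k)"
        by (simp add: act_def sum_subtractf)
      show "(\<Sum>k\<in>UNIV. upd x e k) = (\<Sum>k\<in>UNIV. e k) + (\<Sum>k\<in>UNIV. act x e k)" by (simp add: sum)
      have "if 0 \<le> x k then act x e k \<in> {0..x k} else act x e k \<in> {x k..0}" for k
        using e by (auto simp: act_def upd_def Z_def dest: spec[of _ k])
      then show "act x e \<in> allowable bmax x (\<Sum>k\<in>UNIV. e k)"
        using sum_Z[OF upd_Z, of x e] unfolding allowable_def mem_Collect_eq sum atLeastAtMost_iff by blast
    qed (use \<mu> init upd_Z in auto)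
    have finZ: "finite Z" unfolding Z_def by (rule finite_pointwise) simp
    have acc: "time_average (expected_accepted K \<mu> pol k) \<longlonglongrightarrow> 0" for k
    proof (rule time_average_telescope[where \<phi> = "\<lambda>t. measure_pmf.expectation (chain t) (\<lambda>y. real_of_int (snd y k))"])
      fix t
      have "measure_pmf.expectation (chain (Suc t)) (\<lambda>y. real_of_int (snd y k)) =
          measure_pmf.expectation (chain t) (\<lambda>y. real_of_int (snd y k) + real_of_int (act (fst y) (snd y) k))"
        unfolding expectation_chain_Suc by (simp add: step_def act_def case_prod_unfold)
      then show "expected_accepted K \<mu> pol k t = measure_pmf.expectation (chain (Suc t)) (\<lambda>y. real_of_int (snd y k)) -
          measure_pmf.expectation (chain t) (\<lambda>y. real_of_int (snd y k))"
        unfolding expected_accepted_pol expectation_add_finite[OF finite_chain] by (simp add: case_prod_unfold)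
    next
      have "\<bar>measure_pmf.expectation (chain t) (\<lambda>y. real_of_int (snd y k))\<bar> \<le> real_of_int (cap k)" for t
      proof (intro expectation_bounds_finite finite_chain)
        fix y assume "y \<in> set_pmf (chain t)"
        then have "snd y \<in> Z" using chain_support[of t] by auto
        then have "snd y k \<in> {0..cap k}" unfolding Z_def by blast
        then show "\<bar>real_of_int (snd y k)\<bar> \<le> real_of_int (cap k)" by auto
      qed
      then show "(\<lambda>T. measure_pmf.expectation (chain (Suc T)) (\<lambda>y. real_of_int (snd y k)) / real T) \<longlonglongrightarrow> 0"
        by (intro bounded_over_n_tendsto_0[where M = "real_of_int (cap k)"])
    qed
    have loss_eq: "expected_loss K \<mu> pol k = (\<lambda>t. measure_pmf.expectation (chain t)
        (\<lambda>(x, z). of_bool (x k < 0) * real_of_int (act x z k - x k)))" for k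
      by (rule ext) (rule expected_loss_pol)
    have conv: "convergent (time_average (expected_loss K \<mu> pol k))" for k
      unfolding loss_eq by (rule time_average_chain_convergent[OF finZ])
    have feas: "pol \<in> feasible_policies S K \<mu> bmax"
      unfolding feasible_policies_def using is_policy_pol conv limI[OF acc] convergentI[OF acc] by simp
    have "LLR K \<mu> pol k \<le> A * exp (\<theta> * M) * exp (- \<theta> * real \<beta>)" for k
    proof -
      define \<Phi> where "\<Phi> = (\<lambda>y :: ('n \<Rightarrow> int) \<times> ('n \<Rightarrow> int). A * exp (\<theta> * (g k (fst y) - real_of_int (snd y k))))"
      have lim: "time_average (\<lambda>t. measure_pmf.expectation (chain t)
          (\<lambda>(x, z). of_bool (x k < 0) * real_of_int (act x z k - x k))) \<longlonglongrightarrow> LLR K \<mu> pol k"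
        using conv[of k] unfolding loss_eq[symmetric] by (simp add: LLR_def convergent_LIMSEQ_iff)
      show ?thesis
      proof (rule time_average_chain_le[OF lim, where \<Phi> = \<Phi> and M = "A * exp (\<theta> * M)"])
        fix y assume "y \<in> S \<times> Z"
        then obtain x e where y: "y = (x, e)" and x: "x \<in> S" and e: "e \<in> Z" by auto
        have ek: "0 \<le> e k" "e k \<le> cap k" using e unfolding Z_def by (auto dest: spec[of _ k])
        have gM: "g k x \<le> M" "- M \<le> g k x" using M(2)[OF x, of k] by auto
        have "\<theta> * (g k x - real_of_int (e k)) \<le> \<theta> * M" using gM ek \<theta> by (intro mult_left_mono) auto
        then show "\<bar>\<Phi> y\<bar> \<le> A * exp (\<theta> * M)" using A by (simp add: \<Phi>_def y abs_mult)
        \<comment> \<open>Truncation at 0 only raises the account, so the hypothesis of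
          \<open>exponential_drift\<close> is met.\<close>
        have ge: "real_of_int (upd x e k) \<ge> min (real_of_int (e k) + real_of_int (x k)) (real \<beta>)"
        proof -
          have "upd x e k \<ge> min (e k + x k) (int \<beta>)" unfolding upd_def using cap(1)[of k] by linarith
          then show ?thesis by linarith
        qed
        have "measure_pmf.expectation (K x) (\<lambda>x'. exp (\<theta> * (g k x' - real_of_int (upd x e k))))
          \<le> \<rho> * exp (\<theta> * (g k x - real_of_int (e k))) + exp (\<theta> * M) * exp (- \<theta> * real \<beta>)"
          using M(2) closed_S[OF x]
          by (intro exponential_drift[where v = "\<lambda>x. real_of_int (x k)", OF finite_K[OF x] \<theta> con[OF x] _ ge])
             (auto simp: abs_le_iff)
        then have "A * measure_pmf.expectation (K x) (\<lambda>x'. exp (\<theta> * (g k x' - real_of_int (upd x e k))))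
          \<le> A * (\<rho> * exp (\<theta> * (g k x - real_of_int (e k))) + exp (\<theta> * M) * exp (- \<theta> * real \<beta>))"
          using A by (intro mult_left_mono) auto
        moreover have "measure_pmf.expectation (step y) \<Phi> =
            A * measure_pmf.expectation (K x) (\<lambda>x'. exp (\<theta> * (g k x' - real_of_int (upd x e k))))"
          by (simp add: y step_def \<Phi>_def)
        moreover have "of_bool (x k < 0) * real_of_int (act x e k - x k)
            \<le> (1 - \<rho>) * (A * exp (\<theta> * (g k x - real_of_int (e k))))"
        proof (cases "x k < 0 \<and> e k + x k < 0")
          case True
          then have "act x e k - x k = - (e k + x k)" using cap0[of k] by (auto simp: act_def upd_def)
          then have "of_bool (x k < 0) * real_of_int (act x e k - x k) = real_of_int (- (e k + x k))"
            using True by simp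
          also have "\<dots> \<le> (X + 1) * 1" using X(2)[OF x, of k] ek by simp
          also have "(X + 1) * 1 \<le> (X + 1) * exp (\<theta> * (X + M + g k x - real_of_int (e k)))"
          proof (intro mult_left_mono)
            have "X + M + g k x - real_of_int (e k) \<ge> 0" using X(2)[OF x, of k] gM True by linarith
            then show "1 \<le> exp (\<theta> * (X + M + g k x - real_of_int (e k)))" using \<theta> by simp
          qed (use X in simp)
          also have "\<dots> = (1 - \<rho>) * (A * exp (\<theta> * (g k x - real_of_int (e k))))"
            unfolding mult.assoc[symmetric] A' by (simp add: exp_add[symmetric] algebra_simps)
          finally show ?thesis .
        next
          case False
          then have "of_bool (x k < 0) * real_of_int (act x e k - x k) = 0"
            using ek by (auto simp: act_def upd_def)
          then show ?thesis using \<rho> A by (metis diff_gt_0_iff_gt exp_ge_zero less_imp_le mult_nonneg_nonneg)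
        qed
        ultimately show "(case y of (x, z) \<Rightarrow> of_bool (x k < 0) * real_of_int (act x z k - x k)) +
            measure_pmf.expectation (step y) \<Phi> \<le> \<Phi> y + A * exp (\<theta> * M) * exp (- \<theta> * real \<beta>)"
          unfolding y prod.case \<Phi>_def fst_conv snd_conv distrib_left left_diff_distrib
          by (simp only: mult.assoc mult.left_commute[of A \<rho>] mult_1)
      qed
    qed
    then have "LLR_sys K \<mu> pol \<le> (\<Sum>k\<in>(UNIV::'n set). A * exp (\<theta> * M) * exp (- \<theta> * real \<beta>))"
      unfolding LLR_sys_def by (intro sum_mono)
    then show ?thesis using feas by (intro bexI[of _ pol]) (auto simp: C_def \<beta>_def)
  qed
  moreover have "C > 0" using A by (simp add: C_def)
  ultimately show ?thesis using \<theta> by blast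
qed

end

section \<open>Pooling among the needy users\<close>

text \<open>The caps are at least \<beta>, a charged account keeps at least \<open>thr\<close>, and
  \<open>u0\<close> receives the whole content of the battery at a reset; \<open>X_small\<close>
  lets this content fit under its cap.\<close>

locale pooling = battery S K \<pi> for S :: "('n::finite \<Rightarrow> int) set" and K \<pi> +
  fixes bmax :: nat and cap :: "'n \<Rightarrow> int" and X \<beta> thr :: int and u0 :: 'n
  assumes self_sufficient: "\<And>s. s \<in> S \<Longrightarrow> 0 \<le> (\<Sum>i\<in>needy. s i)"
    and X: "\<And>x k. x \<in> S \<Longrightarrow> \<bar>x k\<bar> \<le> X"
    and cap: "\<And>k. \<beta> \<le> cap k" "(\<Sum>k\<in>needy. cap k) = int bmax"
    and u0: "u0 \<in> needy"
    and thr: "0 \<le> thr" "thr < \<beta>"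
    and X_small: "int CARD('n) * X \<le> \<beta>"
begin

text \<open>The total is the battery level and must not be negative, whereas single accounts may be
  overdrawn. Together with the caps this bounds every debt by \<open>bmax\<close>.\<close>

definition accounts :: "('n \<Rightarrow> int) set" where
  "accounts = {e. (\<forall>k\<in>needy. e k \<le> cap k) \<and> (\<forall>k. k \<notin> needy \<longrightarrow> e k = 0) \<and> 0 \<le> (\<Sum>k\<in>needy. e k)}"

definition income :: "('n \<Rightarrow> int) \<Rightarrow> ('n \<Rightarrow> int) \<Rightarrow> 'n \<Rightarrow> int" where
  "income x e k = (if k \<in> needy then min (cap k) (e k + x k) else 0)"

text \<open>Tests whether the deficits can be served although the caps turn surpluses away.\<close>

definition normal :: "('n \<Rightarrow> int) \<Rightarrow> ('n \<Rightarrow> int) \<Rightarrow> bool" where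
  "normal x e \<longleftrightarrow> 0 \<le> (\<Sum>k\<in>needy. income x e k)"

text \<open>The pair consists of a debtor and a creditor. A repayment only relabels stored energy; the
  debtor then accepts more of its own surplus because its account is further below the cap. \<open>loan\<close>
  is the part of the balances that is written off when the accounts are reset.\<close>

definition repay :: "'n \<times> 'n \<Rightarrow> ('n \<Rightarrow> int) \<Rightarrow> ('n \<Rightarrow> int) \<Rightarrow> bool" where
  "repay pr x e \<longleftrightarrow> normal x e \<and> x (snd pr) < 0 \<and> thr + 1 \<le> income x e (fst pr)"

definition account_step :: "'n \<times> 'n \<Rightarrow> ('n \<Rightarrow> int) \<Rightarrow> ('n \<Rightarrow> int) \<Rightarrow> 'n \<Rightarrow> int" where
  "account_step pr x e k =
     (if normal x e
      then income x e k + of_bool (repay pr x e) * (of_bool (k = snd pr) - of_bool (k = fst pr))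
      else of_bool (k = u0) * (\<Sum>l\<in>needy. e l + x l))"

definition accept :: "('n \<Rightarrow> int) \<Rightarrow> ('n \<Rightarrow> int) \<Rightarrow> 'n \<Rightarrow> int" where
  "accept x e k = (if k \<in> needy then if normal x e then income x e k - e k else x k else 0)"

definition loan :: "('n \<Rightarrow> int) \<Rightarrow> ('n \<Rightarrow> int) \<Rightarrow> 'n \<Rightarrow> int" where
  "loan x e k = (if normal x e \<or> k \<notin> needy then 0
     else e k + x k - of_bool (k = u0) * (\<Sum>l\<in>needy. e l + x l))"

lemma X_nonneg: "0 \<le> X"
proof -
  obtain s where "s \<in> S" using irreducible by (auto simp: irreducible_chain_def)
  from X[OF this, of u0] show ?thesis by linarith
qed

lemma cap_nonneg: "0 \<le> cap k"
  using cap(1)[of k] thr by linarith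

lemma accountsD:
  assumes "e \<in> accounts"
  shows "k \<in> needy \<Longrightarrow> e k \<le> cap k" "k \<notin> needy \<Longrightarrow> e k = 0" "0 \<le> (\<Sum>k\<in>needy. e k)"
    "(\<Sum>k\<in>needy. e k) \<le> int bmax"
  using assms sum_mono[of needy e cap] cap(2) by (auto simp: accounts_def)

lemma cap_le: "k \<in> needy \<Longrightarrow> cap k \<le> int bmax"
  using member_le_sum[of k needy cap] cap_nonneg cap(2) by auto

lemma accounts_abs_le:
  assumes e: "e \<in> accounts"
  shows "\<bar>e k\<bar> \<le> int bmax"
proof (cases "k \<in> needy")
  case True
  have "(\<Sum>l\<in>needy. e l) = e k + (\<Sum>l\<in>needy - {k}. e l)" using True by (simp add: sum.remove)
  moreover have "(\<Sum>l\<in>needy - {k}. e l) \<le> (\<Sum>l\<in>needy - {k}. cap l)"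
    using accountsD(1)[OF e] by (intro sum_mono) auto
  moreover have "(\<Sum>l\<in>needy. cap l) = cap k + (\<Sum>l\<in>needy - {k}. cap l)" using True by (simp add: sum.remove)
  ultimately show ?thesis
    using accountsD(1)[OF e True] accountsD(3)[OF e] cap_le[OF True] cap_nonneg[of k] cap(2) by linarith
qed (use accountsD(2)[OF e] in simp)

lemma finite_accounts: "finite accounts"
proof (rule finite_subset)
  show "accounts \<subseteq> {e. \<forall>k. e k \<in> {- int bmax..int bmax}}" using accounts_abs_le by (auto simp: abs_le_iff minus_le_iff)
qed (intro finite_pointwise, simp)

text \<open>The uncapped total is nonnegative by \<open>self_sufficient\<close>, so a negative
  capped total means that some account is at its cap, which is at least \<beta>. The remaining
  accounts outweigh it, hence one of them is in debt by about \<beta> divided by the number of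
  users. The caps turn away at most \<open>X\<close> per user, which bounds the uncapped total from
  above.\<close>

lemma emergency:
  assumes x: "x \<in> S" and e: "e \<in> accounts" and "\<not> normal x e"
  shows "0 \<le> (\<Sum>l\<in>needy. e l + x l)" "(\<Sum>l\<in>needy. e l + x l) \<le> \<beta>"
    "\<exists>k\<in>needy. int CARD('n) * (e k - X) \<le> - \<beta>"
proof -
  show pos: "0 \<le> (\<Sum>l\<in>needy. e l + x l)"
    using self_sufficient[OF x] accountsD(3)[OF e] by (simp add: sum.distrib)
  have neg: "(\<Sum>k\<in>needy. income x e k) < 0" using assms(3) by (simp add: normal_def)
  have "e k + x k \<le> income x e k + X" if "k \<in> needy" for k
    using accountsD(1)[OF e that] X[OF x, of k] that by (auto simp: income_def)
  then have "(\<Sum>l\<in>needy. e l + x l) \<le> (\<Sum>l\<in>needy. income x e l + X)" by (intro sum_mono)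
  also have "\<dots> \<le> int (card needy) * X" using neg by (simp add: sum.distrib)
  also have "\<dots> \<le> int CARD('n) * X" using X_nonneg by (intro mult_right_mono) (auto intro: card_mono)
  finally show "(\<Sum>l\<in>needy. e l + x l) \<le> \<beta>" using X_small by linarith
  have "\<exists>k0\<in>needy. income x e k0 < e k0 + x k0"
  proof (rule ccontr)
    assume "\<not> ?thesis"
    then have "(\<Sum>l\<in>needy. e l + x l) \<le> (\<Sum>l\<in>needy. income x e l)" by (intro sum_mono) force
    then show False using pos neg by linarith
  qed
  then obtain k0 where k0: "k0 \<in> needy" "income x e k0 < e k0 + x k0" by auto
  then have i0: "income x e k0 \<ge> \<beta>" using cap(1)[of k0] by (auto simp: income_def)
  show "\<exists>k\<in>needy. int CARD('n) * (e k - X) \<le> - \<beta>"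
  proof (rule ccontr)
    assume "\<not> ?thesis"
    then have big: "- \<beta> < int CARD('n) * (e k - X)" if "k \<in> needy" for k using that by force
    have inc: "- \<beta> \<le> int CARD('n) * income x e k" if "k \<in> needy" for k
    proof -
      have "e k - X \<le> e k + x k" using X[OF x, of k] by linarith
      then have "int CARD('n) * (e k - X) \<le> int CARD('n) * (e k + x k)" by (intro mult_left_mono) auto
      moreover have "0 \<le> int CARD('n) * cap k" using cap_nonneg by simp
      moreover have "income x e k = cap k \<or> income x e k = e k + x k"
        using that by (auto simp: income_def min_def)
      ultimately show ?thesis using big[OF that] thr by (elim disjE; simp only:; linarith)
    qed
    have "int CARD('n) * (\<Sum>k\<in>needy. income x e k) =
        int CARD('n) * income x e k0 + (\<Sum>k\<in>needy - {k0}. int CARD('n) * income x e k)"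
      using k0(1) by (simp add: sum.remove[of needy k0] sum_distrib_left distrib_left)
    moreover have "int CARD('n) * \<beta> + (\<Sum>k\<in>needy - {k0}. - \<beta>) \<le>
        int CARD('n) * income x e k0 + (\<Sum>k\<in>needy - {k0}. int CARD('n) * income x e k)"
      using inc i0 by (intro add_mono sum_mono mult_left_mono) auto
    moreover have "int CARD('n) * \<beta> + (\<Sum>k\<in>needy - {k0}. - \<beta>) =
        (int CARD('n) - int (card (needy - {k0}))) * \<beta>"
      by (simp add: algebra_simps)
    moreover have "0 \<le> (int CARD('n) - int (card (needy - {k0}))) * \<beta>"
    proof (intro mult_nonneg_nonneg)
      have "card (needy - {k0}) \<le> CARD('n)" by (intro card_mono) auto
      then show "0 \<le> int CARD('n) - int (card (needy - {k0}))" by simp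
    qed (use thr in simp)
    ultimately have "0 \<le> int CARD('n) * (\<Sum>k\<in>needy. income x e k)" by linarith
    then show False using neg by (simp add: zero_le_mult_iff)
  qed
qed

lemma sum_of_bool_needy: "k \<in> needy \<Longrightarrow> (\<Sum>l\<in>needy. of_bool (l = k) :: int) = 1"
  by (simp add: of_bool_def)

lemma account_step_closed:
  assumes x: "x \<in> S" and e: "e \<in> accounts" and pr: "fst pr \<in> needy" "snd pr \<in> needy"
  shows "account_step pr x e \<in> accounts"
proof (cases "normal x e")
  case True
  have "account_step pr x e k \<le> cap k" if "k \<in> needy" for k
  proof -
    have "income x e k \<le> cap k" using that by (simp add: income_def)
    \<comment> \<open>A user in deficit ends strictly below its cap, so the creditor has room for
      the transferred unit. This is why repayments wait for a deficit of the creditor.\<close>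
    moreover have "income x e k + 1 \<le> cap k" if "x k < 0"
      using that \<open>k \<in> needy\<close> accountsD(1)[OF e \<open>k \<in> needy\<close>] by (simp add: income_def)
    ultimately show ?thesis using True by (auto simp: account_step_def repay_def)
  qed
  moreover have "account_step pr x e k = 0" if "k \<notin> needy" for k
    using that pr True by (auto simp: account_step_def income_def)
  moreover have "(\<Sum>k\<in>needy. account_step pr x e k) = (\<Sum>k\<in>needy. income x e k)"
    using True pr
    by (simp add: account_step_def sum.distrib sum_distrib_left[symmetric] sum_subtractf sum_of_bool_needy)
  ultimately show ?thesis using True by (simp add: accounts_def normal_def)
next
  case False
  note em = emergency[OF x e False]
  have "of_bool (k = u0) * (\<Sum>l\<in>needy. e l + x l) \<le> cap k" for k
    using em(2) cap(1)[of k] cap_nonneg[of k] by auto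
  moreover have "(\<Sum>k\<in>needy. of_bool (k = u0) * (\<Sum>l\<in>needy. e l + x l)) = (\<Sum>l\<in>needy. e l + x l)"
    unfolding sum_distrib_right[symmetric] using sum_of_bool_needy[OF u0] by simp
  ultimately show ?thesis using em(1) u0 False by (auto simp: accounts_def account_step_def)
qed

lemma accept_level:
  assumes pr: "fst pr \<in> needy" "snd pr \<in> needy"
  shows "(\<Sum>k\<in>needy. account_step pr x e k) = (\<Sum>k\<in>needy. e k) + (\<Sum>k\<in>UNIV. accept x e k)"
proof -
  have U: "(\<Sum>k\<in>UNIV. accept x e k) = (\<Sum>k\<in>needy. accept x e k)"
    by (intro sum.mono_neutral_right) (auto simp: accept_def)
  show ?thesis
  proof (cases "normal x e")
    case True
    then show ?thesis unfolding U using pr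
      by (simp add: account_step_def accept_def sum.distrib sum_distrib_left[symmetric] sum_subtractf
          sum_of_bool_needy)
  next
    case False
    have "(\<Sum>k\<in>needy. of_bool (k = u0) * (\<Sum>l\<in>needy. e l + x l)) = (\<Sum>l\<in>needy. e l + x l)"
      unfolding sum_distrib_right[symmetric] using sum_of_bool_needy[OF u0] by simp
    with False show ?thesis unfolding U by (simp add: account_step_def accept_def sum.distrib)
  qed
qed

text \<open>A negative income cannot lift an account above its cap, so demand is served in full; at
  resets this holds by definition.\<close>

lemma accept_deficit:
  assumes "x \<in> S" "e \<in> accounts" "x k < 0"
  shows "accept x e k = x k"
  using assms accountsD(1)[OF assms(2), of k] not_needy[OF assms(1), of k]
  by (auto simp: accept_def income_def)

lemma accept_allowable:
  assumes x: "x \<in> S" and e: "e \<in> accounts"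
  shows "accept x e \<in> allowable bmax x (\<Sum>k\<in>needy. e k)"
proof -
  have "if 0 \<le> x k then accept x e k \<in> {0..x k} else accept x e k \<in> {x k..0}" for k
    using accept_deficit[OF x e, of k] accountsD(1)[OF e, of k] by (auto simp: accept_def income_def)
  \<comment> \<open>\<open>accept\<close> does not depend on the pair. The pair
    \<open>(u0, u0)\<close>, whose transfer cancels, is used to read off the battery
    constraint.\<close>
  moreover have "account_step (u0, u0) x e \<in> accounts"
    using u0 by (intro account_step_closed[OF x e]) auto
  from accountsD(3,4)[OF this]
  have "(\<Sum>k\<in>needy. e k) + (\<Sum>k\<in>UNIV. accept x e k) \<in> {0..int bmax}"
    unfolding accept_level[of "(u0, u0)" x e, simplified, OF u0] by simp
  ultimately show ?thesis unfolding allowable_def mem_Collect_eq atLeastAtMost_iff by blast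
qed

text \<open>What a user gives beyond the change of its own account is owed to it by the others. As
  accounts are bounded, a user's average acceptance tends to 0 once the expected sum of these
  amounts grows sublinearly.\<close>

lemma ledger:
  assumes e: "e \<in> accounts" and pr: "fst pr \<in> needy" "snd pr \<in> needy"
  shows "accept x e k - (account_step pr x e k - e k) =
    of_bool (repay pr x e) * (of_bool (k = fst pr) - of_bool (k = snd pr)) + loan x e k"
  using accountsD(2)[OF e, of k] pr u0
  by (auto simp: accept_def account_step_def loan_def repay_def income_def)

lemma loan_le:
  assumes x: "x \<in> S" and e: "e \<in> accounts"
  shows "\<bar>loan x e k\<bar> \<le> X + 2 * int bmax"
proof (cases "normal x e \<or> k \<notin> needy")
  case False
  have "\<beta> \<le> int bmax" using cap(1)[of u0] cap_le[OF u0] by linarith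
  then show ?thesis
    using False emergency[OF x e] accounts_abs_le[OF e, of k] X[OF x, of k]
    by (cases "k = u0") (auto simp: loan_def)
qed (use X_nonneg in \<open>auto simp: loan_def\<close>)

text \<open>In the potential, the first two groups of terms force a positive rate of repayment: either
  the debtor's account is high often enough to be charged when the creditor is in deficit, or its
  income is not turned away. The exponential terms pay for the loans.\<close>

lemma repayment_drift:
  fixes g :: "'n \<Rightarrow> ('n \<Rightarrow> int) \<Rightarrow> real" and h :: "('n \<Rightarrow> int) \<Rightarrow> real"
  assumes pr: "i \<in> needy" "j \<in> needy" "i \<noteq> j"
    and \<theta>: "\<theta> > 0" and \<delta>: "\<delta> > 0"
    and g: "\<And>k x. x \<in> S \<Longrightarrow> measure_pmf.expectation (K x) (g k) \<le> g k x + real_of_int (x k) - \<delta>"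
    and con: "\<And>k x. x \<in> S \<Longrightarrow>
      measure_pmf.expectation (K x) (\<lambda>y. exp (\<theta> * (g k y - g k x - real_of_int (x k)))) \<le> 1"
    and h: "\<And>x. x \<in> S \<Longrightarrow> measure_pmf.expectation (K x) h \<le> h x + of_bool (x j < 0) - \<delta>"
    and M: "M \<ge> 0" "\<And>k x. x \<in> S \<Longrightarrow> \<bar>g k x\<bar> \<le> M" "\<And>x. x \<in> S \<Longrightarrow> \<bar>h x\<bar> \<le> M"
    and D: "D * \<delta> = real_of_int X" and w: "w > 0"
    and L1: "real CARD('n) * (exp (\<theta> * M) * exp (- \<theta> * real_of_int thr)) \<le> \<delta> / 4"
    and L2: "real_of_int thr + real_of_int X + 1 + w \<le> real_of_int \<beta> - real_of_int X"
    and L3: "D * ((real_of_int X + 1) / w * M) \<le> \<delta> / 4"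
    and L4: "2 * M + 2 * (D * M) + real CARD('n) * exp (\<theta> * M) + real bmax
      + (1 + D) * (real CARD('n) * (real_of_int X + 2 * real bmax)) + \<delta> / 2
      \<le> exp (\<theta> * (real_of_int \<beta> / real CARD('n) - real_of_int X - M))"
  shows "\<exists>H. \<forall>x\<in>S. \<forall>e\<in>accounts.
    measure_pmf.expectation (K x) (\<lambda>x'. H (x', account_step (i, j) x e)) \<le> H (x, e)
      + (1 + D) * (of_bool (repay (i, j) x e) - (\<Sum>k\<in>needy. \<bar>real_of_int (loan x e k)\<bar>)) - \<delta> / 2"
proof -
  have D0: "D \<ge> 0" using D \<delta> X_nonneg by (metis of_int_0_le_iff zero_le_mult_iff not_less)
  \<comment> \<open>A ramp: it is positive only above \<open>thr + X + 1\<close>, where the debtor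
    can be charged whatever its income, and by \<open>L2\<close> it equals 1 from
    \<open>\<beta> - X\<close> on, where income may be turned away. By \<open>L3\<close> its slope
    is so small that its variation in one step costs at most \<open>\<delta> / 4\<close>.\<close>
  define lam :: "real \<Rightarrow> real" where "lam m = max 0 (min 1 ((m - (thr + X + 1)) / w))" for m
  have lam01: "0 \<le> lam m" "lam m \<le> 1" for m by (auto simp: lam_def)
  have lam_lip: "\<bar>lam m - lam m'\<bar> \<le> \<bar>m - m'\<bar> / w" for m m'
  proof -
    have "\<bar>lam m - lam m'\<bar> \<le> \<bar>(m - (thr + X + 1)) / w - (m' - (thr + X + 1)) / w\<bar>"
      unfolding lam_def by linarith
    also have "\<dots> = \<bar>m - m'\<bar> / w" using w by (simp add: diff_divide_distrib[symmetric] abs_divide)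
    finally show ?thesis .
  qed
  define V where "V x e = (\<Sum>k\<in>needy. exp (\<theta> * (g k x - real_of_int (e k))))" for x and e :: "'n \<Rightarrow> int"
  \<comment> \<open>Up to repayments, \<open>g i\<close> minus the account falls by \<delta> less
    the rejected income, which is at most \<open>X * lam\<close>. The ramp term falls by
    \<open>D * \<delta> * lam\<close>, and \<open>D * \<delta> = X\<close> cancels the
    rejections.\<close>
  define H where "H = (\<lambda>(x, e :: 'n \<Rightarrow> int). g i x - real_of_int (e i) + D * (lam (e i) * h x) + V x e)"
  have card_needy: "real (card needy) \<le> real CARD('n)" by (simp add: card_mono)
  have main: "measure_pmf.expectation (K x) (\<lambda>x'. H (x', account_step (i, j) x e)) \<le> H (x, e)
      + (1 + D) * (of_bool (repay (i, j) x e) - (\<Sum>k\<in>needy. \<bar>real_of_int (loan x e k)\<bar>)) - \<delta> / 2"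
    if x: "x \<in> S" and e: "e \<in> accounts" for x e
  proof -
    define e' where "e' = account_step (i, j) x e"
    note fK = finite_K[OF x]
    have e'_acc: "e' \<in> accounts" unfolding e'_def using pr by (intro account_step_closed x e) auto
    have EH: "measure_pmf.expectation (K x) (\<lambda>x'. H (x', e')) =
        measure_pmf.expectation (K x) (g i) - real_of_int (e' i)
        + D * (lam (e' i) * measure_pmf.expectation (K x) h)
        + measure_pmf.expectation (K x) (\<lambda>x'. V x' e')"
      unfolding H_def by (simp add: expectation_add_finite[OF fK] expectation_diff_finite[OF fK])
    have Hxe: "H (x, e) = g i x - real_of_int (e i) + D * (lam (e i) * h x) + V x e" by (simp add: H_def)
    have gM: "\<bar>measure_pmf.expectation (K x) (g i)\<bar> \<le> M" "\<bar>measure_pmf.expectation (K x) h\<bar> \<le> M"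
      using M closed_S[OF x] by (auto intro!: expectation_bounds_finite[OF fK])
    have lamM: "\<bar>lam a * b\<bar> \<le> M" if "\<bar>b\<bar> \<le> M" for a b
      using mult_mono[OF lam01(2)[of a] that] lam01(1)[of a] by (simp add: abs_mult)
    show ?thesis
    proof (cases "normal x e")
      case False
      \<comment> \<open>At a reset the deep debt makes \<open>V\<close> at least the right-hand side
        of \<open>L4\<close>; afterwards no account is negative. The drop of \<open>V\<close>
        therefore pays for the loans and for the changes of all other terms.\<close>
      note em = emergency[OF x e False]
      have rep: "\<not> repay (i, j) x e" using False by (simp add: repay_def)
      have e'0: "e' k \<ge> 0" for k using em(1) False by (simp add: e'_def account_step_def)
      have "measure_pmf.expectation (K x) (\<lambda>x'. V x' e') \<le> measure_pmf.expectation (K x) (\<lambda>x'. real CARD('n) * exp (\<theta> * M))"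
      proof (intro expectation_mono_finite fK)
        fix x' assume "x' \<in> set_pmf (K x)"
        then have x': "x' \<in> S" using closed_S[OF x] by auto
        have "V x' e' \<le> (\<Sum>k\<in>needy. exp (\<theta> * M))"
          unfolding V_def
        proof (intro sum_mono)
          fix k
          have "g k x' - real_of_int (e' k) \<le> M" using M(2)[OF x', of k] e'0[of k] by linarith
          then show "exp (\<theta> * (g k x' - real_of_int (e' k))) \<le> exp (\<theta> * M)" using \<theta> by simp
        qed
        also have "\<dots> \<le> real CARD('n) * exp (\<theta> * M)" using card_needy by (simp add: mult_right_mono)
        finally show "V x' e' \<le> real CARD('n) * exp (\<theta> * M)" .
      qed
      then have V': "measure_pmf.expectation (K x) (\<lambda>x'. V x' e') \<le> real CARD('n) * exp (\<theta> * M)" by simp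
      obtain k where k: "k \<in> needy" "int CARD('n) * (e k - X) \<le> - \<beta>" using em(3) by auto
      have n0: "real CARD('n) > 0" by simp
      have "real CARD('n) * (real_of_int (e k) - real_of_int X) \<le> - real_of_int \<beta>"
        using k(2) by (metis of_int_diff of_int_le_iff of_int_minus of_int_mult of_int_of_nat_eq)
      then have "real_of_int \<beta> \<le> (real_of_int X - real_of_int (e k)) * real CARD('n)"
        by (simp add: algebra_simps)
      then have "real_of_int \<beta> / real CARD('n) \<le> real_of_int X - real_of_int (e k)"
        by (simp only: pos_divide_le_eq[OF n0])
      then have "real_of_int \<beta> / real CARD('n) - real_of_int X - M \<le> g k x - real_of_int (e k)"
        using M(2)[OF x, of k] by linarith
      then have "exp (\<theta> * (real_of_int \<beta> / real CARD('n) - real_of_int X - M)) \<le> exp (\<theta> * (g k x - real_of_int (e k)))"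
        using \<theta> by simp
      also have "\<dots> \<le> V x e" unfolding V_def using k(1)
        by (intro member_le_sum[where f = "\<lambda>k. exp (\<theta> * (g k x - real_of_int (e k)))"]) auto
      finally have Vbig: "exp (\<theta> * (real_of_int \<beta> / real CARD('n) - real_of_int X - M)) \<le> V x e" .
      have "(\<Sum>k\<in>needy. \<bar>real_of_int (loan x e k)\<bar>) \<le> (\<Sum>k\<in>needy. real_of_int X + 2 * real bmax)"
      proof (intro sum_mono)
        fix k
        have "real_of_int \<bar>loan x e k\<bar> \<le> real_of_int (X + 2 * int bmax)"
          using loan_le[OF x e, of k] by (simp only: of_int_le_iff)
        then show "\<bar>real_of_int (loan x e k)\<bar> \<le> real_of_int X + 2 * real bmax" by simp
      qed
      also have "\<dots> \<le> real CARD('n) * (real_of_int X + 2 * real bmax)"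
        using card_needy X_nonneg by (simp add: mult_right_mono)
      finally have "(1 + D) * (\<Sum>k\<in>needy. \<bar>real_of_int (loan x e k)\<bar>)
          \<le> (1 + D) * (real CARD('n) * (real_of_int X + 2 * real bmax))"
        using D0 by (intro mult_left_mono) auto
      moreover have "real_of_int (e i) \<le> real bmax" using accounts_abs_le[OF e, of i] by linarith
      moreover have "D * (lam (e' i) * measure_pmf.expectation (K x) h) \<le> D * M"
        using lamM[OF gM(2), of "e' i"] D0 by (intro mult_left_mono) auto
      moreover have "D * (lam (e i) * h x) \<ge> D * (- M)"
        using lamM[OF M(3)[OF x], of "e i"] D0 by (intro mult_left_mono) auto
      ultimately show ?thesis
        using L4 V' Vbig gM(1) e'0[of i] M(2)[OF x, of i] rep
        unfolding e'_def[symmetric] EH Hxe by simp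
    next
      case True
      define R where "R = repay (i, j) x e"
      have loan0: "loan x e k = 0" for k using True by (simp add: loan_def)
      have e'_eq: "e' k = income x e k + of_bool R * (of_bool (k = j) - of_bool (k = i))" for k
        using True by (simp add: e'_def account_step_def R_def)
      have inc: "income x e k = min (cap k) (e k + x k)" if "k \<in> needy" for k
        using that by (simp add: income_def)
      have V': "measure_pmf.expectation (K x) (\<lambda>x'. V x' e') \<le> V x e + \<delta> / 4"
      proof -
        have "measure_pmf.expectation (K x) (\<lambda>x'. V x' e') =
            (\<Sum>k\<in>needy. measure_pmf.expectation (K x) (\<lambda>x'. exp (\<theta> * (g k x' - real_of_int (e' k)))))"
          unfolding V_def by (rule expectation_sum_finite[OF fK])
        also have "\<dots> \<le> (\<Sum>k\<in>needy. 1 * exp (\<theta> * (g k x - real_of_int (e k))) + exp (\<theta> * M) * exp (- \<theta> * real_of_int thr))"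
        proof (intro sum_mono)
          fix k assume k: "k \<in> needy"
          \<comment> \<open>A charged debtor keeps at least \<open>thr\<close>, so
            \<open>thr\<close> takes the role of the cap in
            \<open>exponential_drift\<close>.\<close>
          have "e' k \<ge> min (e k + x k) thr"
          proof (cases "R \<and> k = i")
            case True
            then have "thr + 1 \<le> income x e k" by (simp add: R_def repay_def)
            then show ?thesis using e'_eq[of k] True pr by simp
          next
            case False
            then have "e' k \<ge> income x e k" using e'_eq[of k] by auto
            then show ?thesis using inc[OF k] cap(1)[of k] thr by linarith
          qed
          then have ge: "real_of_int (e' k) \<ge> min (real_of_int (e k) + real_of_int (x k)) (real_of_int thr)"
            by linarith
          show "measure_pmf.expectation (K x) (\<lambda>x'. exp (\<theta> * (g k x' - real_of_int (e' k))))
            \<le> 1 * exp (\<theta> * (g k x - real_of_int (e k))) + exp (\<theta> * M) * exp (- \<theta> * real_of_int thr)"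
            using M(2) closed_S[OF x]
            by (intro exponential_drift[where v = "\<lambda>x. real_of_int (x k)", OF fK \<theta> con[OF x] _ ge])
               (auto simp: abs_le_iff)
        qed
        also have "\<dots> = V x e + real (card needy) * (exp (\<theta> * M) * exp (- \<theta> * real_of_int thr))"
          by (simp add: V_def sum.distrib)
        also have "real (card needy) * (exp (\<theta> * M) * exp (- \<theta> * real_of_int thr)) \<le>
            real CARD('n) * (exp (\<theta> * M) * exp (- \<theta> * real_of_int thr))"
          using card_needy by (intro mult_right_mono) auto
        finally show ?thesis using L1 by linarith
      qed
      define rej where "rej = e i + x i - income x e i"
      have xi: "\<bar>x i\<bar> \<le> X" by (rule X[OF x])
      have ei: "e i \<le> cap i" by (rule accountsD(1)[OF e pr(1)])
      have e'i: "e' i = e i + x i - rej - of_bool R"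
        using e'_eq[of i] pr by (simp add: rej_def)
      have rej: "0 \<le> rej" "rej \<le> X" using inc[OF pr(1)] xi ei by (auto simp: rej_def)
      have rej_lam: "real_of_int rej \<le> real_of_int X * lam (e i)"
      proof (cases "rej = 0")
        case False
        then have "e i + x i > cap i" using inc[OF pr(1)] by (auto simp: rej_def)
        then have "e i \<ge> \<beta> - X" using cap(1)[of i] xi by linarith
        then have "real_of_int (e i) - (thr + X + 1) \<ge> w" using L2 by linarith
        then have "lam (e i) = 1" using w by (simp add: lam_def pos_le_divide_eq)
        then show ?thesis using rej by simp
      qed (use lam01 X_nonneg in simp)
      have lamR: "lam (e i) * of_bool (x j < 0) \<le> of_bool R"
      proof (cases "lam (e i) = 0")
        case False
        then have "lam (e i) > 0" using lam01(1)[of "e i"] by linarith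
        then have "(real_of_int (e i) - (thr + X + 1)) / w > 0" by (auto simp: lam_def)
        then have "real_of_int (e i) > real_of_int (thr + X + 1)" using w by (simp add: zero_less_divide_iff)
        then have "e i > thr + X + 1" by linarith
        then have "income x e i \<ge> thr + 1" using inc[OF pr(1)] xi cap(1)[of i] thr by linarith
        then show ?thesis using True lam01(2)[of "e i"] by (auto simp: R_def repay_def)
      qed simp
      have "\<bar>e' i - e i\<bar> \<le> X + 1"
      proof -
        have "\<bar>x i - rej\<bar> \<le> X" using inc[OF pr(1)] xi ei cap_nonneg[of i] by (auto simp: rej_def)
        then show ?thesis unfolding e'i by (cases R) auto
      qed
      then have "\<bar>real_of_int (e' i) - real_of_int (e i)\<bar> \<le> real_of_int X + 1" by linarith
      then have "\<bar>lam (e' i) - lam (e i)\<bar> \<le> (real_of_int X + 1) / w"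
        using lam_lip[of "e' i" "e i"] w by (meson divide_right_mono less_imp_le order_trans)
      then have "\<bar>(lam (e' i) - lam (e i)) * measure_pmf.expectation (K x) h\<bar> \<le> (real_of_int X + 1) / w * M"
        unfolding abs_mult using gM(2) X_nonneg w by (intro mult_mono) auto
      moreover have "lam (e i) * measure_pmf.expectation (K x) h \<le> lam (e i) * (h x + of_bool (x j < 0) - \<delta>)"
        using h[OF x] lam01 by (intro mult_left_mono) auto
      ultimately have "lam (e' i) * measure_pmf.expectation (K x) h
          \<le> lam (e i) * h x + of_bool R - \<delta> * lam (e i) + (real_of_int X + 1) / w * M"
        using lamR by (simp add: algebra_simps)
      then have "D * (lam (e' i) * measure_pmf.expectation (K x) h)
          \<le> D * (lam (e i) * h x + of_bool R - \<delta> * lam (e i) + (real_of_int X + 1) / w * M)"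
        using D0 by (intro mult_left_mono)
      also have "\<dots> = D * (lam (e i) * h x) + D * of_bool R - (D * \<delta>) * lam (e i) + D * ((real_of_int X + 1) / w * M)"
        by (simp only: distrib_left right_diff_distrib mult.assoc)
      finally have Dh: "D * (lam (e' i) * measure_pmf.expectation (K x) h)
          \<le> D * (lam (e i) * h x) + D * of_bool R - real_of_int X * lam (e i) + \<delta> / 4"
        using L3 unfolding D by linarith
      \<comment> \<open>Of the drift \<open>- \<delta>\<close> one quarter is spent on
        \<open>V\<close> and one on the variation of the ramp. A repayment counts 1 here and
        \<open>D\<close> in the ramp term, hence the factor \<open>1 + D\<close>.\<close>
      have "measure_pmf.expectation (K x) (g i) - real_of_int (e' i)
          \<le> g i x - real_of_int (e i) - \<delta> + real_of_int rej + of_bool R"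
        using g[OF x, of i] unfolding e'i by simp
      then show ?thesis
        using Dh V' rej_lam unfolding e'_def[symmetric] R_def[symmetric] EH Hxe
        by (simp add: loan0 distrib_right)
    qed
  qed
  then show ?thesis by blast
qed

end

text \<open>Balances with sum 0 satisfy \<open>D i \<le> 0 \<le> D j\<close>, and
  \<open>D j - D i\<close> dominates every \<open>\<bar>D k\<bar>\<close>. Loans of total size
  \<kappa> raise the cross term by at most \<open>\<kappa> * (D j - D i)\<close>, while the transfer
  lowers it by \<open>r * (D j - D i)\<close>; only squared increments remain.\<close>

lemma sum_squares_transfer:
  fixes D \<Delta> l :: "'k \<Rightarrow> real"
  assumes U: "finite U" "i \<in> U" "j \<in> U" and zero: "(\<Sum>k\<in>U. D k) = 0"
    and ext: "\<And>k. k \<in> U \<Longrightarrow> D i \<le> D k" "\<And>k. k \<in> U \<Longrightarrow> D k \<le> D j"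
    and \<Delta>: "\<And>k. k \<in> U \<Longrightarrow> \<Delta> k = r * (of_bool (k = i) - of_bool (k = j)) + l k"
    and l: "(\<Sum>k\<in>U. \<bar>l k\<bar>) \<le> \<kappa>" and r: "i \<noteq> j \<Longrightarrow> \<kappa> \<le> r"
    and B: "\<And>k. k \<in> U \<Longrightarrow> \<bar>\<Delta> k\<bar> \<le> B"
  shows "(\<Sum>k\<in>U. (D k + \<Delta> k)\<^sup>2) \<le> (\<Sum>k\<in>U. (D k)\<^sup>2) + real (card U) * B\<^sup>2"
proof -
  have Di: "D i \<le> 0"
  proof (rule ccontr)
    assume "\<not> D i \<le> 0"
    then have "(\<Sum>k\<in>U. D k) > 0" using ext(1) U by (intro sum_pos) force+
    then show False using zero by simp
  qed
  have Dj: "D j \<ge> 0"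
  proof (rule ccontr)
    assume "\<not> D j \<ge> 0"
    then have "(\<Sum>k\<in>U. - D k) > 0" using ext(2) U by (intro sum_pos) force+
    then show False using zero by (simp add: sum_negf)
  qed
  have "(\<Sum>k\<in>U. D k * \<Delta> k) = (\<Sum>k\<in>U. r * (D k * of_bool (k = i)) - r * (D k * of_bool (k = j)) + D k * l k)"
  proof (intro sum.cong refl)
    fix k assume "k \<in> U"
    show "D k * \<Delta> k = r * (D k * of_bool (k = i)) - r * (D k * of_bool (k = j)) + D k * l k"
      unfolding \<Delta>[OF \<open>k \<in> U\<close>] by (simp add: algebra_simps)
  qed
  also have "\<dots> = r * (\<Sum>k\<in>U. D k * of_bool (k = i)) - r * (\<Sum>k\<in>U. D k * of_bool (k = j)) + (\<Sum>k\<in>U. D k * l k)"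
    by (simp only: sum.distrib sum_subtractf sum_distrib_left)
  also have "(\<Sum>k\<in>U. D k * of_bool (k = i)) = D i" using U by (simp add: of_bool_def if_distrib cong: if_cong)
  also have "(\<Sum>k\<in>U. D k * of_bool (k = j)) = D j" using U by (simp add: of_bool_def if_distrib cong: if_cong)
  finally have eq: "(\<Sum>k\<in>U. D k * \<Delta> k) = r * D i - r * D j + (\<Sum>k\<in>U. D k * l k)" .
  have "(\<Sum>k\<in>U. D k * l k) \<le> (\<Sum>k\<in>U. (D j - D i) * \<bar>l k\<bar>)"
  proof (intro sum_mono)
    fix k assume "k \<in> U"
    then have "\<bar>D k\<bar> \<le> D j - D i" using ext[of k] Di Dj by linarith
    then have "\<bar>D k\<bar> * \<bar>l k\<bar> \<le> (D j - D i) * \<bar>l k\<bar>" by (intro mult_right_mono) auto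
    then show "D k * l k \<le> (D j - D i) * \<bar>l k\<bar>" by (metis abs_ge_self abs_mult order_trans)
  qed
  also have "\<dots> = (D j - D i) * (\<Sum>k\<in>U. \<bar>l k\<bar>)" by (simp add: sum_distrib_left)
  also have "\<dots> \<le> (D j - D i) * \<kappa>" using l Di Dj by (intro mult_left_mono) auto
  finally have "(\<Sum>k\<in>U. D k * \<Delta> k) \<le> - (r - \<kappa>) * (D j - D i)"
    unfolding eq by (simp add: algebra_simps)
  also have "\<dots> \<le> 0"
  \<comment> \<open>For \<open>i = j\<close> the factor \<open>D j - D i\<close> is 0, so nothing
    has to be repaid.\<close>
  proof (cases "i = j")
    case False
    then show ?thesis using r Di Dj by (simp add: mult_nonpos_nonneg)
  qed simp
  finally have cross: "(\<Sum>k\<in>U. D k * \<Delta> k) \<le> 0" .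
  have "(\<Sum>k\<in>U. (\<Delta> k)\<^sup>2) \<le> (\<Sum>k\<in>U. B\<^sup>2)"
    using B by (intro sum_mono) (metis abs_ge_zero power2_abs power_mono)
  moreover have "(\<Sum>k\<in>U. (D k + \<Delta> k)\<^sup>2) = (\<Sum>k\<in>U. (D k)\<^sup>2) + 2 * (\<Sum>k\<in>U. D k * \<Delta> k) + (\<Sum>k\<in>U. (\<Delta> k)\<^sup>2)"
    by (simp add: power2_sum sum.distrib sum_distrib_left mult.assoc)
  ultimately show ?thesis using cross by simp
qed

text \<open>The bound on the squares gives growth of order sqrt t at the multiples of
  \<open>L\<close>; bounded increments fill the blocks in between.\<close>

lemma square_bound_sublinear:
  fixes D :: "nat \<Rightarrow> real"
  assumes L: "L > 0" and C: "C \<ge> 0" and Q: "\<And>m. (D (m * L))\<^sup>2 \<le> real m * C"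
    and st: "\<And>t. \<bar>D (Suc t) - D t\<bar> \<le> B"
  shows "(\<lambda>T. D (Suc T) / real T) \<longlonglongrightarrow> 0"
proof -
  have B: "B \<ge> 0" using st[of 0] by linarith
  have step: "\<bar>D (t + r) - D t\<bar> \<le> real r * B" for t r
  proof (induction r)
    case (Suc r)
    then show ?case using st[of "t + r"] by (simp add: algebra_simps)
  qed simp
  have bound: "\<bar>D t\<bar> \<le> sqrt (real t * C) + real L * B" for t
  proof -
    define m where "m = t div L"
    have t: "t = m * L + t mod L" by (simp add: m_def)
    have "m \<le> t" by (simp add: m_def)
    then have "real m * C \<le> real t * C" using C by (intro mult_right_mono) auto
    then have "(D (m * L))\<^sup>2 \<le> real t * C" using Q[of m] by linarith
    then have "\<bar>D (m * L)\<bar> \<le> sqrt (real t * C)" by (simp add: real_le_rsqrt)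
    moreover have "\<bar>D t - D (m * L)\<bar> \<le> real (t mod L) * B" using step[of "m * L" "t mod L"] t by simp
    moreover have "real (t mod L) * B \<le> real L * B"
      using B L by (intro mult_right_mono) (auto intro: less_imp_le)
    ultimately show ?thesis by linarith
  qed
  show ?thesis
  proof (rule Lim_null_comparison)
    show "\<forall>\<^sub>F T in sequentially. norm (D (Suc T) / real T) \<le> (sqrt (real (Suc T) * C) + real L * B) / real T"
    proof (intro always_eventually allI)
      fix T
      have "\<bar>D (Suc T)\<bar> / real T \<le> (sqrt (real (Suc T) * C) + real L * B) / real T"
        by (intro divide_right_mono bound) simp
      then show "norm (D (Suc T) / real T) \<le> (sqrt (real (Suc T) * C) + real L * B) / real T"
        by (simp only: real_norm_def abs_divide abs_of_nat)
    qed
    have "(\<lambda>T. sqrt (real (Suc T)) / real T) \<longlonglongrightarrow> 0" by real_asymp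
    then have "(\<lambda>T. sqrt C * (sqrt (real (Suc T)) / real T) + real L * B * inverse (real T)) \<longlonglongrightarrow> sqrt C * 0 + 0"
      by (intro tendsto_add tendsto_mult tendsto_const tendsto_mult_right_zero lim_inverse_n)
    moreover have "(sqrt (real (Suc T) * C) + real L * B) / real T =
        sqrt C * (sqrt (real (Suc T)) / real T) + real L * B * inverse (real T)" for T
      unfolding real_sqrt_mult by (simp add: divide_inverse algebra_simps del: of_nat_Suc)
    ultimately show "(\<lambda>T. (sqrt (real (Suc T) * C) + real L * B) / real T) \<longlonglongrightarrow> 0"
      by (simp only: mult_zero_right add_0_right)
  qed
qed

context pooling begin

text \<open>The pair of debtor and creditor is chosen anew every \<open>L\<close> steps according to the ledger
  \<open>D\<close> of expected balances. Since \<open>D\<close> is deterministic, so is the schedule, and the ledger need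
  not be part of the memory of the policy.\<close>

lemma fair_lossless_policy:
  assumes \<mu>: "set_pmf \<mu> \<subseteq> S \<times> {0..int bmax}" and c: "c > 0" and \<delta>: "\<delta> > 0"
    and drift: "\<And>i j. i \<in> needy \<Longrightarrow> j \<in> needy \<Longrightarrow> i \<noteq> j \<Longrightarrow> \<exists>H. \<forall>x\<in>S. \<forall>e\<in>accounts.
      measure_pmf.expectation (K x) (\<lambda>x'. H (x', account_step (i, j) x e)) \<le> H (x, e)
      + c * (of_bool (repay (i, j) x e) - (\<Sum>k\<in>needy. \<bar>real_of_int (loan x e k)\<bar>)) - \<delta>"
  shows "\<exists>p\<in>feasible_policies S K \<mu> bmax. LLR_sys K \<mu> p = 0"
proof -
  have "\<exists>H. i \<in> needy \<longrightarrow> j \<in> needy \<longrightarrow> i \<noteq> j \<longrightarrow> (\<forall>x\<in>S. \<forall>e\<in>accounts.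
      measure_pmf.expectation (K x) (\<lambda>x'. H (x', account_step (i, j) x e)) \<le> H (x, e)
      + c * (of_bool (repay (i, j) x e) - (\<Sum>k\<in>needy. \<bar>real_of_int (loan x e k)\<bar>)) - \<delta>)" for i j
    using drift[of i j] by meson
  then obtain H where H: "\<And>i j x e. i \<in> needy \<Longrightarrow> j \<in> needy \<Longrightarrow> i \<noteq> j \<Longrightarrow> x \<in> S \<Longrightarrow> e \<in> accounts \<Longrightarrow>
      measure_pmf.expectation (K x) (\<lambda>x'. H i j (x', account_step (i, j) x e)) \<le> H i j (x, e)
      + c * (of_bool (repay (i, j) x e) - (\<Sum>k\<in>needy. \<bar>real_of_int (loan x e k)\<bar>)) - \<delta>"
    by metis
  define HB where "HB = (\<Sum>i\<in>UNIV. \<Sum>j\<in>UNIV. \<Sum>y\<in>S \<times> accounts. \<bar>H i j y\<bar>)"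
  have finY: "finite (S \<times> accounts)" using finite_S finite_accounts by simp
  have HB: "\<bar>H i j y\<bar> \<le> HB" if "y \<in> S \<times> accounts" for i j y
  proof -
    have "\<bar>H i j y\<bar> \<le> (\<Sum>y\<in>S \<times> accounts. \<bar>H i j y\<bar>)"
      using finY that by (intro member_le_sum[where f = "\<lambda>y. \<bar>H i j y\<bar>"]) auto
    also have "\<dots> \<le> (\<Sum>j\<in>UNIV. \<Sum>y\<in>S \<times> accounts. \<bar>H i j y\<bar>)"
      by (intro member_le_sum[where f = "\<lambda>j. \<Sum>y\<in>S \<times> accounts. \<bar>H i j y\<bar>"] sum_nonneg) auto
    also have "\<dots> \<le> HB" unfolding HB_def
      by (intro member_le_sum[where f = "\<lambda>i. \<Sum>j\<in>UNIV. \<Sum>y\<in>S \<times> accounts. \<bar>H i j y\<bar>"] sum_nonneg) auto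
    finally show ?thesis .
  qed
  \<comment> \<open>Over a block of length \<open>L\<close> the drift \<open>L * \<delta>\<close>
    outweighs the oscillation of the potential, which is at most \<open>2 * HB\<close>. Hence the
    expected repayments of a block cover its expected loans. The successor ensures
    \<open>L > 0\<close>.\<close>
  obtain L0 :: nat where "2 * HB / \<delta> < real L0" using reals_Archimedean2 by blast
  then have L0: "2 * HB \<le> real L0 * \<delta>" using \<delta> by (simp add: pos_divide_less_eq less_imp_le)
  define L where "L = Suc L0"
  have L: "L > 0" "2 * HB \<le> real L * \<delta>" using L0 \<delta> by (auto simp: L_def algebra_simps)
  have "\<exists>e. e \<in> accounts \<and> (\<Sum>k\<in>needy. e k) = b" if b: "b \<in> {0..int bmax}" for b
  proof -
    have "\<exists>e. (\<forall>k\<in>needy. 0 \<le> e k \<and> e k \<le> cap k) \<and> (\<forall>k. k \<notin> needy \<longrightarrow> e k = 0) \<and> (\<Sum>k\<in>needy. e k) = b"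
      using b cap(2) cap_nonneg by (intro split_level) auto
    then show ?thesis using b by (auto simp: accounts_def)
  qed
  then obtain init where init: "\<And>b. b \<in> {0..int bmax} \<Longrightarrow> init b \<in> accounts \<and> (\<Sum>k\<in>needy. init b k) = b"
    by metis
  have ne: "needy \<noteq> {}" using u0 by auto
  have "\<exists>pr. fst pr \<in> needy \<and> snd pr \<in> needy \<and> (\<forall>k\<in>needy. D (fst pr) \<le> D k \<and> D k \<le> D (snd pr))"
    for D :: "'n \<Rightarrow> real"
  proof -
    have "Min (D ` needy) \<in> D ` needy" "Max (D ` needy) \<in> D ` needy" using ne by auto
    then obtain i j where "i \<in> needy" "j \<in> needy" "D i = Min (D ` needy)" "D j = Max (D ` needy)" by fastforce
    then show ?thesis by (intro exI[of _ "(i, j)"]) auto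
  qed
  then obtain pick where pick: "\<And>D :: 'n \<Rightarrow> real. fst (pick D) \<in> needy \<and> snd (pick D) \<in> needy \<and>
      (\<forall>k\<in>needy. D (fst (pick D)) \<le> D k \<and> D k \<le> D (snd (pick D)))"
    by metis
  define led :: "'n \<times> 'n \<Rightarrow> 'n \<Rightarrow> ('n \<Rightarrow> int) \<times> ('n \<Rightarrow> int) \<Rightarrow> real" where
    "led pr k = (\<lambda>(x, e). real_of_int (accept x e k - (account_step pr x e k - e k)))" for pr k
  define kern where "kern pr = (\<lambda>(x, e). map_pmf (\<lambda>x'. (x', account_step pr x e)) (K x))" for pr
  define nxt where "nxt pr \<nu> D = (\<lambda>k. D k + measure_pmf.expectation \<nu> (led pr k))" for pr \<nu> and D :: "'n \<Rightarrow> real"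
  \<comment> \<open>Joint recursion for the law of states and accounts, the expected balances and
    the current pair. The policy depends on it only through the deterministic sequence
    \<open>pair t\<close>.\<close>
  define st where "st = rec_nat (map_pmf (\<lambda>(x, b). (x, init b)) \<mu>, \<lambda>_. 0 :: real, pick (\<lambda>_. 0))
    (\<lambda>t (\<nu>, D, pr). (bind_pmf \<nu> (kern pr), nxt pr \<nu> D, if L dvd Suc t then pick (nxt pr \<nu> D) else pr))"
  define \<nu> where "\<nu> t = fst (st t)" for t
  define D where "D t = fst (snd (st t))" for t
  define pair where "pair t = snd (snd (st t))" for t
  have \<nu>0: "\<nu> 0 = map_pmf (\<lambda>(x, b). (x, init b)) \<mu>" and D0: "D 0 = (\<lambda>_. 0)" and pair0: "pair 0 = pick (D 0)"
    by (simp_all add: \<nu>_def D_def pair_def st_def)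
  have \<nu>S: "\<nu> (Suc t) = bind_pmf (\<nu> t) (kern (pair t))"
    and DS: "D (Suc t) k = D t k + measure_pmf.expectation (\<nu> t) (led (pair t) k)"
    and pairS: "pair (Suc t) = (if L dvd Suc t then pick (D (Suc t)) else pair t)" for t k
    by (simp_all add: \<nu>_def D_def pair_def st_def nxt_def case_prod_unfold)
  have pair_needy: "fst (pair t) \<in> needy \<and> snd (pair t) \<in> needy" for t
    by (induction t) (use pick in \<open>auto simp: pair0 pairS\<close>)
  then have pair_fst: "fst (pair t) \<in> needy" and pair_snd: "snd (pair t) \<in> needy" for t by auto
  \<comment> \<open>The memory carries a clock for looking up \<open>pair t\<close>, so its range is
    infinite and \<open>time_average_chain_convergent\<close> does not apply; the limits are
    computed directly below.\<close>
  interpret memory_policy S K \<pi> bmax \<mu> "\<lambda>b. (0 :: nat, init b)" "\<lambda>x (t, e). accept x e"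
    "\<lambda>x (t, e). (Suc t, account_step (pair t) x e)" "\<lambda>(t, e). \<Sum>k\<in>needy. e k" "UNIV \<times> accounts"
    by unfold_locales
      (use \<mu> init accept_allowable account_step_closed[OF _ _ pair_fst pair_snd]
        accept_level[OF pair_fst pair_snd] in auto)
  have chain: "chain t = map_pmf (\<lambda>(x, e). (x, (t, e))) (\<nu> t)" for t
  proof (induction t)
    case 0
    show ?case unfolding chain.simps \<nu>0 pmf.map_comp by (intro map_pmf_cong refl) auto
  next
    case (Suc t)
    show ?case unfolding chain.simps Suc \<nu>S bind_map_pmf map_bind_pmf
      by (intro bind_pmf_cong refl) (auto simp: step_def kern_def pmf.map_comp o_def)
  qed
  have sup: "set_pmf (\<nu> t) \<subseteq> S \<times> accounts" for t using chain_support[of t] unfolding chain by force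
  have fin: "finite (set_pmf (\<nu> t))" for t using finite_subset[OF sup finY] .
  have E_Suc: "measure_pmf.expectation (\<nu> (Suc t)) f = measure_pmf.expectation (\<nu> t)
      (\<lambda>y. measure_pmf.expectation (kern (pair t) y) f)" for t and f :: "_ \<Rightarrow> real"
    unfolding \<nu>S using sup[of t] finite_K
    by (intro expectation_bind_finite fin) (auto simp: kern_def)
  define R where "R t = measure_pmf.expectation (\<nu> t) (\<lambda>y. of_bool (repay (pair t) (fst y) (snd y)) :: real)" for t
  define l where "l t k = measure_pmf.expectation (\<nu> t) (\<lambda>y. real_of_int (loan (fst y) (snd y) k))" for t k
  define \<kappa> where "\<kappa> t = measure_pmf.expectation (\<nu> t) (\<lambda>y. \<Sum>k\<in>needy. \<bar>real_of_int (loan (fst y) (snd y) k)\<bar>)" for t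
  have led_eq: "led (pair t) k y = of_bool (repay (pair t) (fst y) (snd y)) *
      (of_bool (k = fst (pair t)) - of_bool (k = snd (pair t))) + real_of_int (loan (fst y) (snd y) k)"
    if "y \<in> S \<times> accounts" for t k y
    using ledger[of "snd y" "pair t" "fst y" k] that pair_needy[of t] by (auto simp: led_def)
  have D_step: "D (Suc t) k = D t k + (R t * (of_bool (k = fst (pair t)) - of_bool (k = snd (pair t))) + l t k)" for t k
  proof -
    have "measure_pmf.expectation (\<nu> t) (led (pair t) k) = measure_pmf.expectation (\<nu> t)
      (\<lambda>y. of_bool (repay (pair t) (fst y) (snd y)) *
        (of_bool (k = fst (pair t)) - of_bool (k = snd (pair t))) + real_of_int (loan (fst y) (snd y) k))"
      using sup[of t] by (intro expectation_cong_support led_eq) auto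
    then show ?thesis unfolding DS R_def l_def by (simp add: expectation_add_finite[OF fin])
  qed
  have l_le: "(\<Sum>k\<in>needy. \<bar>l t k\<bar>) \<le> \<kappa> t" for t
  proof -
    have "(\<Sum>k\<in>needy. \<bar>l t k\<bar>) \<le> (\<Sum>k\<in>needy. measure_pmf.expectation (\<nu> t) (\<lambda>y. \<bar>real_of_int (loan (fst y) (snd y) k)\<bar>))"
      unfolding l_def by (intro sum_mono integral_abs_bound)
    then show ?thesis unfolding \<kappa>_def by (simp only: expectation_sum_finite[OF fin])
  qed
  define B where "B = 1 + real_of_int X + 2 * real bmax"
  have D_incr: "\<bar>D (Suc t) k - D t k\<bar> \<le> B" for t k
  proof -
    have "\<bar>measure_pmf.expectation (\<nu> t) (led (pair t) k)\<bar> \<le> B"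
    proof (intro expectation_bounds_finite fin)
      fix y assume "y \<in> set_pmf (\<nu> t)"
      then have y: "y \<in> S \<times> accounts" using sup by auto
      then have "real_of_int \<bar>loan (fst y) (snd y) k\<bar> \<le> real_of_int (X + 2 * int bmax)"
        using loan_le[of "fst y" "snd y" k] by (subst of_int_le_iff) auto
      then have "\<bar>real_of_int (loan (fst y) (snd y) k)\<bar> \<le> real_of_int X + 2 * real bmax" by simp
      then show "\<bar>led (pair t) k y\<bar> \<le> B" unfolding led_eq[OF y] B_def by (auto simp: of_bool_def)
    qed
    then show ?thesis by (simp add: DS)
  qed
  have D_sum: "(\<Sum>k\<in>needy. D t k) = 0" for t
  proof (induction t)
    case (Suc t)
    have "(\<Sum>k\<in>needy. led (pair t) k y) = 0" if "y \<in> S \<times> accounts" for y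
    proof -
      have "(\<Sum>k\<in>UNIV. accept (fst y) (snd y) k) = (\<Sum>k\<in>needy. accept (fst y) (snd y) k)"
        by (intro sum.mono_neutral_right) (auto simp: accept_def)
      then have "(\<Sum>k\<in>needy. accept (fst y) (snd y) k - (account_step (pair t) (fst y) (snd y) k - snd y k)) = 0"
        using accept_level[of "pair t" "fst y" "snd y"] pair_needy[of t] by (simp add: sum_subtractf)
      then have "real_of_int (\<Sum>k\<in>needy. accept (fst y) (snd y) k - (account_step (pair t) (fst y) (snd y) k - snd y k)) = 0"
        by (simp only: of_int_0)
      then show ?thesis unfolding led_def case_prod_unfold of_int_sum .
    qed
    then have "measure_pmf.expectation (\<nu> t) (\<lambda>y. \<Sum>k\<in>needy. led (pair t) k y) = measure_pmf.expectation (\<nu> t) (\<lambda>_. 0)"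
      using sup[of t] by (intro expectation_cong_support) auto
    then have "(\<Sum>k\<in>needy. measure_pmf.expectation (\<nu> t) (led (pair t) k)) = 0"
      unfolding expectation_sum_finite[OF fin] by simp
    then show ?case using Suc by (simp add: DS sum.distrib)
  qed (simp add: D0)
  have pair_block: "pair (m * L + r) = pick (D (m * L))" if "r < L" for m r
    using that
  proof (induction r)
    case 0
    show ?case
    proof (cases m)
      case (Suc m')
      then have "m * L = Suc (m' * L + L0)" by (simp add: L_def)
      moreover have "L dvd Suc (m' * L + L0)" using calculation by (metis dvd_triv_right)
      ultimately show ?thesis using pairS[of "m' * L + L0"] by simp
    qed (simp add: pair0)
  next
    case (Suc r)
    have "\<not> L dvd Suc (m * L + r)"
    proof
      assume "L dvd Suc (m * L + r)"
      then have "L dvd m * L + Suc r" by simp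
      then have "L dvd Suc r" by (simp only: dvd_add_right_iff dvd_triv_right)
      then show False using Suc.prems by (auto dest: dvd_imp_le)
    qed
    then show ?case using Suc pairS[of "m * L + r"] by simp
  qed
  define Q where "Q m = (\<Sum>k\<in>needy. (D (m * L) k)\<^sup>2)" for m
  define B0 where "B0 = real (card needy) * (real L * B)\<^sup>2"
  have Q_step: "Q (Suc m) \<le> Q m + B0" for m
  proof -
    define i j where "i = fst (pick (D (m * L)))" and "j = snd (pick (D (m * L)))"
    have ij: "i \<in> needy" "j \<in> needy" "\<And>k. k \<in> needy \<Longrightarrow> D (m * L) i \<le> D (m * L) k"
        "\<And>k. k \<in> needy \<Longrightarrow> D (m * L) k \<le> D (m * L) j"
      using pick[of "D (m * L)"] by (auto simp: i_def j_def)
    have pr: "pair (m * L + r) = (i, j)" if "r < L" for r using pair_block[OF that] by (simp add: i_def j_def)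
    define Rs where "Rs r = (\<Sum>q<r. R (m * L + q))" for r
    define ls where "ls r k = (\<Sum>q<r. l (m * L + q) k)" for r k
    define \<kappa>s where "\<kappa>s r = (\<Sum>q<r. \<kappa> (m * L + q))" for r
    have D_eq: "r \<le> L \<Longrightarrow> D (m * L + r) k = D (m * L) k + (Rs r * (of_bool (k = i) - of_bool (k = j)) + ls r k)" for r k
    proof (induction r)
      case (Suc r)
      then show ?case using D_step[of "m * L + r" k] pr[of r] by (simp add: Rs_def ls_def algebra_simps)
    qed (simp add: Rs_def ls_def)
    have D_bd: "\<bar>D (m * L + r) k - D (m * L) k\<bar> \<le> real r * B" for r k
    proof (induction r)
      case (Suc r)
      then show ?case using D_incr[of "m * L + r" k] by (simp add: algebra_simps)
    qed simp
    have gain: "\<kappa>s L \<le> Rs L" if "i \<noteq> j"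
    proof -
      let ?E = "\<lambda>r. measure_pmf.expectation (\<nu> (m * L + r)) (H i j)"
      have H_step: "?E (Suc r) \<le> ?E r + c * (R (m * L + r) - \<kappa> (m * L + r)) - \<delta>" if r: "r < L" for r
      proof -
        let ?t = "m * L + r"
        have "?E (Suc r) = measure_pmf.expectation (\<nu> ?t) (\<lambda>y. measure_pmf.expectation (kern (i, j) y) (H i j))"
          using E_Suc[of ?t "H i j"] pr[OF r] by simp
        also have "\<dots> \<le> measure_pmf.expectation (\<nu> ?t) (\<lambda>y. H i j y + c * (of_bool (repay (i, j) (fst y) (snd y))
            - (\<Sum>k\<in>needy. \<bar>real_of_int (loan (fst y) (snd y) k)\<bar>)) - \<delta>)"
        proof (intro expectation_mono_finite fin)
          fix y assume "y \<in> set_pmf (\<nu> ?t)"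
          then obtain x e where y: "y = (x, e)" "x \<in> S" "e \<in> accounts" using sup[of ?t] by auto
          show "measure_pmf.expectation (kern (i, j) y) (H i j) \<le> H i j y + c * (of_bool (repay (i, j) (fst y) (snd y))
            - (\<Sum>k\<in>needy. \<bar>real_of_int (loan (fst y) (snd y) k)\<bar>)) - \<delta>"
            using H[OF ij(1,2) \<open>i \<noteq> j\<close> y(2,3)] by (simp add: y(1) kern_def)
        qed
        also have "\<dots> = ?E r + c * (R ?t - \<kappa> ?t) - \<delta>"
          unfolding R_def \<kappa>_def pr[OF r]
          by (simp add: expectation_add_finite[OF fin] expectation_diff_finite[OF fin])
        finally show ?thesis .
      qed
      have "r \<le> L \<Longrightarrow> ?E r \<le> ?E 0 + c * (Rs r - \<kappa>s r) - real r * \<delta>" for r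
      proof (induction r)
        case (Suc r)
        have "c * (Rs (Suc r) - \<kappa>s (Suc r)) = c * (Rs r - \<kappa>s r) + c * (R (m * L + r) - \<kappa> (m * L + r))"
          by (simp add: Rs_def \<kappa>s_def algebra_simps)
        then show ?case using Suc H_step[of r] by (simp add: algebra_simps)
      qed (simp add: Rs_def \<kappa>s_def)
      from this[of L] have "?E L \<le> ?E 0 + c * (Rs L - \<kappa>s L) - real L * \<delta>" by simp
      moreover have "\<bar>?E r\<bar> \<le> HB" for r
        using HB sup by (intro expectation_bounds_finite fin) blast
      from this[of L] this[of 0] have "- HB \<le> ?E L" "?E 0 \<le> HB" by linarith+
      ultimately have "0 \<le> c * (Rs L - \<kappa>s L)" using L(2) by linarith
      then show ?thesis using c by (simp add: zero_le_mult_iff)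
    qed
    \<comment> \<open>As the pair is fixed within a block, the block acts as one transfer of size
      \<open>Rs L\<close> from the largest to the smallest balance, perturbed by the loans.\<close>
    have "(\<Sum>k\<in>needy. (D (m * L) k + (D (m * L + L) k - D (m * L) k))\<^sup>2)
        \<le> (\<Sum>k\<in>needy. (D (m * L) k)\<^sup>2) + real (card needy) * (real L * B)\<^sup>2"
    proof (rule sum_squares_transfer[where i = i and j = j and r = "Rs L" and l = "ls L" and \<kappa> = "\<kappa>s L"])
      show "(\<Sum>k\<in>needy. \<bar>ls L k\<bar>) \<le> \<kappa>s L"
      proof -
        have "(\<Sum>k\<in>needy. \<bar>ls L k\<bar>) \<le> (\<Sum>k\<in>needy. \<Sum>q<L. \<bar>l (m * L + q) k\<bar>)"
          unfolding ls_def by (intro sum_mono sum_abs)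
        also have "\<dots> = (\<Sum>q<L. \<Sum>k\<in>needy. \<bar>l (m * L + q) k\<bar>)" by (rule sum.swap)
        also have "\<dots> \<le> \<kappa>s L" unfolding \<kappa>s_def by (intro sum_mono l_le)
        finally show ?thesis .
      qed
    qed (use ij D_sum gain D_eq[of L] D_bd[of L] in auto)
    then show ?thesis by (simp add: Q_def B0_def add.commute)
  qed
  have Q_le: "Q m \<le> real m * B0" for m
  proof (induction m)
    case (Suc m)
    then show ?case using Q_step[of m] by (simp add: algebra_simps)
  qed (simp add: Q_def D0)
  have D_out: "D t k = 0" if "k \<notin> needy" for t k
  proof (induction t)
    case (Suc t)
    have "loan x e k = 0" for x e using that by (simp add: loan_def)
    then have "l t k = 0" by (simp add: l_def)
    then show ?case using Suc D_step[of t k] pair_needy[of t] that by auto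
  qed (simp add: D0)
  have D_sublinear: "(\<lambda>T. D (Suc T) k / real T) \<longlonglongrightarrow> 0" for k
  proof (rule square_bound_sublinear[OF L(1), where C = B0 and B = B])
    show "B0 \<ge> 0" by (simp add: B0_def)
    show "(D (m * L) k)\<^sup>2 \<le> real m * B0" for m
    proof (cases "k \<in> needy")
      case True
      then have "(D (m * L) k)\<^sup>2 \<le> Q m" unfolding Q_def
        by (intro member_le_sum[where f = "\<lambda>k. (D (m * L) k)\<^sup>2"]) auto
      then show ?thesis using Q_le[of m] by linarith
    qed (simp add: D_out B0_def)
  qed (rule D_incr)
  \<comment> \<open>The expected acceptance is the increment of the ledger plus that of the expected
    account; the former grows sublinearly and the latter is bounded.\<close>
  have acc: "time_average (expected_accepted K \<mu> pol k) \<longlonglongrightarrow> 0" for k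
  proof (rule time_average_telescope[where \<phi> = "\<lambda>t. D t k + measure_pmf.expectation (\<nu> t) (\<lambda>y. real_of_int (snd y k))"])
    fix t
    have "measure_pmf.expectation (\<nu> (Suc t)) (\<lambda>y. real_of_int (snd y k)) =
        measure_pmf.expectation (\<nu> t) (\<lambda>y. real_of_int (account_step (pair t) (fst y) (snd y) k))"
      unfolding E_Suc by (simp add: kern_def case_prod_unfold)
    moreover have "measure_pmf.expectation (\<nu> t) (led (pair t) k) = measure_pmf.expectation (\<nu> t)
        (\<lambda>y. real_of_int (accept (fst y) (snd y) k) -
          (real_of_int (account_step (pair t) (fst y) (snd y) k) - real_of_int (snd y k)))"
      by (simp add: led_def case_prod_unfold)
    moreover have "expected_accepted K \<mu> pol k t = measure_pmf.expectation (\<nu> t) (\<lambda>y. real_of_int (accept (fst y) (snd y) k))"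
      unfolding expected_accepted_pol chain by (simp add: case_prod_unfold)
    ultimately show "expected_accepted K \<mu> pol k t = D (Suc t) k + measure_pmf.expectation (\<nu> (Suc t)) (\<lambda>y. real_of_int (snd y k)) -
        (D t k + measure_pmf.expectation (\<nu> t) (\<lambda>y. real_of_int (snd y k)))"
      unfolding DS by (simp add: expectation_diff_finite[OF fin])
  next
    have "\<bar>measure_pmf.expectation (\<nu> t) (\<lambda>y. real_of_int (snd y k))\<bar> \<le> real bmax" for t
    proof (intro expectation_bounds_finite fin)
      fix y assume "y \<in> set_pmf (\<nu> t)"
      then have "\<bar>snd y k\<bar> \<le> int bmax" using sup[of t] by (intro accounts_abs_le) auto
      then show "\<bar>real_of_int (snd y k)\<bar> \<le> real bmax" by linarith
    qed
    then have "(\<lambda>T. measure_pmf.expectation (\<nu> (Suc T)) (\<lambda>y. real_of_int (snd y k)) / real T) \<longlonglongrightarrow> 0"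
      by (intro bounded_over_n_tendsto_0[where M = "real bmax"])
    from tendsto_add[OF D_sublinear[of k] this]
    show "(\<lambda>T. (D (Suc T) k + measure_pmf.expectation (\<nu> (Suc T)) (\<lambda>y. real_of_int (snd y k))) / real T) \<longlonglongrightarrow> 0"
      by (simp add: add_divide_distrib)
  qed
  have loss: "expected_loss K \<mu> pol k = (\<lambda>_. 0)" for k
  proof
    fix t
    have "measure_pmf.expectation (\<nu> t) (\<lambda>y. of_bool (fst y k < 0) * real_of_int (accept (fst y) (snd y) k - fst y k))
        = measure_pmf.expectation (\<nu> t) (\<lambda>_. 0)"
      using sup[of t] by (intro expectation_cong_support) (auto simp: accept_deficit)
    then show "expected_loss K \<mu> pol k t = 0"
      unfolding expected_loss_pol chain by (simp add: case_prod_unfold)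
  qed
  have avg0: "time_average (\<lambda>_. 0) \<longlonglongrightarrow> 0" by (simp add: time_average_def[abs_def])
  have "pol \<in> feasible_policies S K \<mu> bmax"
    unfolding feasible_policies_def
    using is_policy_pol limI[OF acc] convergentI[OF acc] convergentI[OF avg0] by (simp add: loss)
  moreover have "LLR_sys K \<mu> pol = 0"
    unfolding LLR_sys_def LLR_def loss using limI[OF avg0] by simp
  ultimately show ?thesis by blast
qed

end

section \<open>The exponential rate\<close>

lemma filterlim_nat_div_at_top:
  assumes "n > 0"
  shows "filterlim (\<lambda>b :: nat. b div n) at_top at_top"
  unfolding filterlim_at_top
proof
  fix Z
  show "\<forall>\<^sub>F b in sequentially. Z \<le> b div n"
    using assms by (intro eventually_sequentiallyI[of "Z * n"]) (simp add: less_eq_div_iff_mult_less_eq)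
qed

context battery begin

section \<open>Zero loss for large capacities in the absence of a joint deficit\<close>

lemma no_demand_lossless:
  assumes empty: "needy = {}" and \<mu>: "set_pmf \<mu> \<subseteq> S \<times> {0..int bmax}"
  shows "\<exists>p\<in>feasible_policies S K \<mu> bmax. LLR_sys K \<mu> p = 0"
proof -
  interpret memory_policy S K \<pi> bmax \<mu> "\<lambda>b. b" "\<lambda>_ _ _. 0" "\<lambda>_ z. z" "\<lambda>z. z" "{0..int bmax}"
    by unfold_locales (use \<mu> in \<open>auto simp: allowable_def\<close>)
  have acc: "expected_accepted K \<mu> pol k = (\<lambda>_. 0)" for k
    by (rule ext) (simp add: expected_accepted_pol case_prod_unfold)
  have loss: "expected_loss K \<mu> pol k = (\<lambda>_. 0)" for k
  proof
    fix t
    have "measure_pmf.expectation (chain t) (\<lambda>(x, z). of_bool (x k < 0) * real_of_int (0 - x k))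
        = measure_pmf.expectation (chain t) (\<lambda>_. 0)"
    proof (intro expectation_cong_support, clarify)
      fix x z assume "(x, z) \<in> set_pmf (chain t)"
      then have "0 \<le> x k" using chain_support[of t] not_needy[of x k] empty by auto
      then show "of_bool (x k < 0) * real_of_int (0 - x k) = 0" by simp
    qed
    then show "expected_loss K \<mu> pol k t = 0" unfolding expected_loss_pol by simp
  qed
  have avg0: "time_average (\<lambda>_. 0) \<longlonglongrightarrow> 0" by (simp add: time_average_def[abs_def])
  have "pol \<in> feasible_policies S K \<mu> bmax"
    unfolding feasible_policies_def
    using is_policy_pol limI[OF avg0] convergentI[OF avg0] by (simp add: loss acc)
  moreover have "LLR_sys K \<mu> pol = 0"
    unfolding LLR_sys_def LLR_def loss using limI[OF avg0] by simp
  ultimately show ?thesis by blast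
qed

lemma demand_poisson:
  "\<exists>h :: 'n \<Rightarrow> ('n \<Rightarrow> int) \<Rightarrow> real. \<exists>\<delta>>0. \<forall>j\<in>needy. \<forall>x\<in>S. measure_pmf.expectation (K x) (h j) \<le> h j x + of_bool (x j < 0) - \<delta>"
proof -
  have "\<exists>h :: ('n \<Rightarrow> int) \<Rightarrow> real. \<exists>\<delta>>0. j \<in> needy \<longrightarrow> (\<forall>x\<in>S. measure_pmf.expectation (K x) h \<le> h x + of_bool (x j < 0) - \<delta>)" for j
  proof (cases "j \<in> needy")
    case True
    then obtain s where s: "s \<in> S" "s j < 0" by (auto simp: needy_def)
    have "0 < of_bool (s j < 0) * pmf \<pi> s"
      using stationary_pmf_pos[OF irreducible stationary s(1)] s(2) by simp
    also have "\<dots> \<le> (\<Sum>x\<in>S. of_bool (x j < 0) * pmf \<pi> x)"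
      using s finite_S by (intro member_le_sum[where f = "\<lambda>x. of_bool (x j < 0) * pmf \<pi> x"]) auto
    finally have "(\<Sum>x\<in>S. of_bool (x j < 0) * pmf \<pi> x) > 0" .
    from poisson_inequality[OF finite_S irreducible stationary this] show ?thesis by blast
  \<comment> \<open>The common margin is a minimum over all users, so users outside
    \<open>needy\<close> receive the dummy margin 1.\<close>
  qed (auto intro: exI[of _ 1])
  then obtain h :: "'n \<Rightarrow> ('n \<Rightarrow> int) \<Rightarrow> real" and \<delta> :: "'n \<Rightarrow> real" where h: "\<And>j. \<delta> j > 0"
    "\<And>j x. j \<in> needy \<Longrightarrow> x \<in> S \<Longrightarrow> measure_pmf.expectation (K x) (h j) \<le> h j x + of_bool (x j < 0) - \<delta> j"
    by metis
  define d where "d = Min (range \<delta>)"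
  have "d > 0" unfolding d_def using h(1) by (subst Min_gr_iff) auto
  moreover have "d \<le> \<delta> j" for j unfolding d_def by (intro Min_le) auto
  then have "measure_pmf.expectation (K x) (h j) \<le> h j x + of_bool (x j < 0) - d"
    if "j \<in> needy" "x \<in> S" for j x
    using h(2)[OF that] by (smt (verit))
  ultimately show ?thesis by blast
qed

lemma eventually_lossless:
  assumes self: "\<And>s. s \<in> S \<Longrightarrow> 0 \<le> (\<Sum>i\<in>needy. s i)"
  shows "\<forall>\<^sub>F bmax in sequentially. \<forall>\<mu>. set_pmf \<mu> \<subseteq> S \<times> {0..int bmax} \<longrightarrow>
    (\<exists>p\<in>feasible_policies S K \<mu> bmax. LLR_sys K \<mu> p = 0)"
proof (cases "needy = {}")
  case True
  then show ?thesis using no_demand_lossless by simp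
next
  case False
  then obtain u0 where u0: "u0 \<in> needy" by auto
  define n where "n = real CARD('n)"
  have n: "n > 0" by (simp add: n_def)
  obtain g \<delta>1 where \<delta>1: "\<delta>1 > 0" and
    g: "\<And>k x. x \<in> S \<Longrightarrow> measure_pmf.expectation (K x) (g k) \<le> g k x + real_of_int (x k) - \<delta>1"
    using uniform_poisson by auto
  obtain h :: "'n \<Rightarrow> ('n \<Rightarrow> int) \<Rightarrow> real" and \<delta>2 :: real where \<delta>2: "\<delta>2 > 0" and
    h: "\<And>j x. j \<in> needy \<Longrightarrow> x \<in> S \<Longrightarrow> measure_pmf.expectation (K x) (h j) \<le> h j x + of_bool (x j < 0) - \<delta>2"
    using demand_poisson by auto
  obtain \<theta> \<rho> where \<theta>: "\<theta> > 0" and \<rho>: "\<rho> < 1"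
    and con: "\<And>i x. x \<in> S \<Longrightarrow>
      measure_pmf.expectation (K x) (\<lambda>y. exp (\<theta> * (g i y - g i x - real_of_int (x i)))) \<le> \<rho>"
    using exponential_contraction[of UNIV S K \<delta>1 g "\<lambda>i x. real_of_int (x i)"] finite_S closed_S \<delta>1 g by auto
  obtain Mg where Mg: "Mg \<ge> 0" "\<And>i x. x \<in> S \<Longrightarrow> \<bar>g i x\<bar> \<le> Mg" using uniform_bound[of g] by auto
  obtain Mh where Mh: "Mh \<ge> 0" "\<And>i x. x \<in> S \<Longrightarrow> \<bar>h i x\<bar> \<le> Mh" using uniform_bound[of h] by auto
  obtain X' where X': "X' \<ge> 0" "\<And>i x. x \<in> S \<Longrightarrow> \<bar>real_of_int (x i)\<bar> \<le> X'"
    using uniform_bound[of "\<lambda>i x. real_of_int (x i)"] by auto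
  define X where "X = \<lceil>X'\<rceil>"
  have X: "\<bar>x i\<bar> \<le> X" if "x \<in> S" for x i using X'(2)[OF that, of i] unfolding X_def by linarith
  define M where "M = max Mg Mh"
  have M: "M \<ge> 0" "\<And>i x. x \<in> S \<Longrightarrow> \<bar>g i x\<bar> \<le> M" "\<And>i x. x \<in> S \<Longrightarrow> \<bar>h i x\<bar> \<le> M"
    using Mg Mh unfolding M_def by (auto intro: max.coboundedI1 max.coboundedI2)
  define \<delta> where "\<delta> = min \<delta>1 \<delta>2"
  have \<delta>: "\<delta> > 0" using \<delta>1 \<delta>2 by (simp add: \<delta>_def)
  define D where "D = real_of_int X / \<delta>"
  have X0: "X \<ge> 0" using X'(1) by (simp add: X_def)
  then have D: "D * \<delta> = real_of_int X" "D \<ge> 0" using \<delta> by (auto simp: D_def)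
  define x where "x = real_of_int X"
  \<comment> \<open>The requirements of the pooling construction in terms of a real
    \<open>b\<close>, which stands for \<beta>, so that asymptotic estimates apply.
    \<open>bmax\<close> is replaced by its upper bound \<open>n * b + n\<close>, \<open>thr\<close>
    by its lower bound \<open>b / 4 - 1\<close>, and the ramp width is \<open>b / 4\<close>.\<close>
  define good where "good b \<longleftrightarrow> 1 \<le> b \<and> n * x \<le> b \<and>
      n * (exp (\<theta> * M) * exp (- \<theta> * (b / 4 - 1))) \<le> \<delta> / 4 \<and>
      x + 1 + x \<le> b / 2 \<and> D * ((x + 1) / (b / 4) * M) \<le> \<delta> / 4 \<and>
      2 * M + 2 * (D * M) + n * exp (\<theta> * M) + (n * b + n)
      + (1 + D) * (n * (x + 2 * (n * b + n))) + \<delta> / 2 \<le> exp (\<theta> * (b / n - x - M))" for b :: real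
  have "((\<lambda>b. n * (exp (\<theta> * M) * exp (- \<theta> * (b / 4 - 1)))) \<longlongrightarrow> 0) at_top"
    using \<theta> by real_asymp
  moreover have "((\<lambda>b. D * ((x + 1) / (b / 4) * M)) \<longlongrightarrow> 0) at_top" by real_asymp
  moreover have "\<forall>\<^sub>F b in at_top. 0 \<le> exp (\<theta> * (b / n - x - M)) - (2 * M + 2 * (D * M) + n * exp (\<theta> * M)
      + (n * b + n) + (1 + D) * (n * (x + 2 * (n * b + n))) + \<delta> / 2)"
  proof -
    have "filterlim (\<lambda>b. exp (\<theta> * (b / n - x - M)) - (2 * M + 2 * (D * M) + n * exp (\<theta> * M) + (n * b + n)
      + (1 + D) * (n * (x + 2 * (n * b + n))) + \<delta> / 2)) at_top at_top"
      using \<theta> n by real_asymp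
    then show ?thesis unfolding filterlim_at_top by (rule spec)
  qed
  ultimately have "\<forall>\<^sub>F b in at_top. n * (exp (\<theta> * M) * exp (- \<theta> * (b / 4 - 1))) < \<delta> / 4 \<and>
      D * ((x + 1) / (b / 4) * M) < \<delta> / 4 \<and>
      0 \<le> exp (\<theta> * (b / n - x - M)) - (2 * M + 2 * (D * M) + n * exp (\<theta> * M) + (n * b + n)
      + (1 + D) * (n * (x + 2 * (n * b + n))) + \<delta> / 2) \<and> max 1 (max (n * x) (2 * (x + 1 + x))) \<le> b"
    using \<delta> by (intro eventually_conj order_tendstoD(2)[where y = 0] eventually_ge_at_top) auto
  then have "\<forall>\<^sub>F b in at_top. good b"
    by eventually_elim (auto simp: good_def)
  moreover have "filterlim (\<lambda>bmax :: nat. real (bmax div CARD('n))) at_top sequentially"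
    by (rule filterlim_compose[OF filterlim_real_sequentially filterlim_nat_div_at_top]) simp
  ultimately have "\<forall>\<^sub>F bmax in sequentially. good (real (bmax div CARD('n)))"
    by (rule eventually_compose_filterlim)
  then show ?thesis
  proof eventually_elim
    fix bmax assume good: "good (real (bmax div CARD('n)))"
    define \<beta> where "\<beta> = bmax div CARD('n)"
    \<comment> \<open>One quarter of \<beta> for the threshold and one for the ramp leave half of
      \<beta> for the terms in \<open>X\<close>.\<close>
    define thr where "thr = \<beta> div 4"
    have gd: "1 \<le> real \<beta>" "n * x \<le> real \<beta>"
      "n * (exp (\<theta> * M) * exp (- \<theta> * (real \<beta> / 4 - 1))) \<le> \<delta> / 4"
      "x + 1 + x \<le> real \<beta> / 2" "D * ((x + 1) / (real \<beta> / 4) * M) \<le> \<delta> / 4"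
      "2 * M + 2 * (D * M) + n * exp (\<theta> * M) + (n * real \<beta> + n)
      + (1 + D) * (n * (x + 2 * (n * real \<beta> + n))) + \<delta> / 2 \<le> exp (\<theta> * (real \<beta> / n - x - M))"
      using good unfolding good_def \<beta>_def by blast+
    have thr_bounds: "real \<beta> / 4 - 1 \<le> real thr" "real thr \<le> real \<beta> / 4" "thr < \<beta>"
      using gd(1) unfolding thr_def by linarith+
    have bmax: "real bmax \<le> n * real \<beta> + n"
    proof -
      have "bmax \<le> CARD('n) * \<beta> + CARD('n)"
        unfolding \<beta>_def using mult_div_mod_eq[of "CARD('n)" bmax] mod_less_divisor[of "CARD('n)" bmax]
          zero_less_card_finite[where 'a = 'n] by linarith
      then have "real bmax \<le> real (CARD('n) * \<beta> + CARD('n))" by (simp only: of_nat_le_iff)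
      then show ?thesis by (simp add: n_def)
    qed
    obtain cap where cap: "\<And>k::'n. int \<beta> \<le> cap k" "(\<Sum>k\<in>needy. cap k) = int bmax"
      using equal_caps[OF False, of bmax] by (auto simp: \<beta>_def)
    have nx: "int CARD('n) * X \<le> int \<beta>"
    proof -
      have "real_of_int (int CARD('n) * X) \<le> real_of_int (int \<beta>)" using gd(2) by (simp add: n_def x_def)
      then show ?thesis by (simp only: of_int_le_iff)
    qed
    interpret pooling S K \<pi> bmax cap X "int \<beta>" "int thr" u0
      by unfold_locales (use self X cap u0 thr_bounds nx in auto)
    have drift: "\<exists>H. \<forall>x\<in>S. \<forall>e\<in>accounts.
      measure_pmf.expectation (K x) (\<lambda>x'. H (x', account_step (i, j) x e)) \<le> H (x, e)
      + (1 + D) * (of_bool (repay (i, j) x e) - (\<Sum>k\<in>needy. \<bar>real_of_int (loan x e k)\<bar>)) - \<delta> / 2"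
      if ij: "i \<in> needy" "j \<in> needy" "i \<noteq> j" for i j
    proof (rule repayment_drift[where g = g and h = "h j" and \<theta> = \<theta> and M = M and w = "real \<beta> / 4",
          OF ij \<theta> \<delta> _ _ _ M(1,2,3) D(1)])
      show "measure_pmf.expectation (K x) (g k) \<le> g k x + real_of_int (x k) - \<delta>" if "x \<in> S" for k x
        using g[OF that, of k] by (simp add: \<delta>_def)
      show "measure_pmf.expectation (K x) (\<lambda>y. exp (\<theta> * (g k y - g k x - real_of_int (x k)))) \<le> 1"
        if "x \<in> S" for k x
        using con[OF that, of k] \<rho> by linarith
      show "measure_pmf.expectation (K x) (h j) \<le> h j x + of_bool (x j < 0) - \<delta>" if "x \<in> S" for x
        using h[OF ij(2) that] by (simp add: \<delta>_def)
      show "real \<beta> / 4 > 0" using gd(1) by simp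
      have "exp (- \<theta> * real thr) \<le> exp (- \<theta> * (real \<beta> / 4 - 1))" using \<theta> thr_bounds(1) by simp
      then have "n * (exp (\<theta> * M) * exp (- \<theta> * real thr)) \<le> n * (exp (\<theta> * M) * exp (- \<theta> * (real \<beta> / 4 - 1)))"
        using n by (intro mult_left_mono) auto
      then show "real CARD('n) * (exp (\<theta> * M) * exp (- \<theta> * real_of_int (int thr))) \<le> \<delta> / 4"
        using gd(3) unfolding n_def of_int_of_nat_eq by linarith
      show "real_of_int (int thr) + real_of_int X + 1 + real \<beta> / 4 \<le> real_of_int (int \<beta>) - real_of_int X"
        using gd(4) thr_bounds(2) unfolding x_def by simp
      show "D * ((real_of_int X + 1) / (real \<beta> / 4) * M) \<le> \<delta> / 4"
        using gd(5) unfolding x_def .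
      have "(1 + D) * (n * (x + 2 * real bmax)) \<le> (1 + D) * (n * (x + 2 * (n * real \<beta> + n)))"
        using D(2) n bmax by (intro mult_left_mono) auto
      then show "2 * M + 2 * (D * M) + real CARD('n) * exp (\<theta> * M) + real bmax
        + (1 + D) * (real CARD('n) * (real_of_int X + 2 * real bmax)) + \<delta> / 2
        \<le> exp (\<theta> * (real_of_int (int \<beta>) / real CARD('n) - real_of_int X - M))"
        using gd(6) bmax unfolding n_def[symmetric] x_def[symmetric] of_int_of_nat_eq by linarith
    qed
    show "\<forall>\<mu>. set_pmf \<mu> \<subseteq> S \<times> {0..int bmax} \<longrightarrow>
      (\<exists>p\<in>feasible_policies S K \<mu> bmax. LLR_sys K \<mu> p = 0)"
      using fair_lossless_policy[where c = "1 + D" and \<delta> = "\<delta> / 2", OF _ _ _ drift] D(2) \<delta> by auto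
  qed
qed

end

text \<open>The infinite value of \<open>c\<close> does occur: without a joint deficit of the needy
  users the optimal loss is 0 for all large capacities. With a joint deficit, the exponential lower
  bound keeps both the loss positive and the limsup finite. This dichotomy gives the
  characterization of \<open>c = \<infinity>\<close>.\<close>

theorem mainTheorem2:
  fixes S :: "('n::finite \<Rightarrow> int) set"
    and Si :: "'n \<Rightarrow> int set"
    and K :: "('n \<Rightarrow> int) \<Rightarrow> ('n \<Rightarrow> int) pmf"
    and \<pi> :: "('n \<Rightarrow> int) pmf"
    and \<mu> :: "nat \<Rightarrow> (('n \<Rightarrow> int) \<times> int) pmf"
  assumes "\<And>i. finite (Si i) \<and> Si i \<noteq> {} \<and> Max (Si i) > 0 \<and> Min (Si i) < 0"
    and "finite S" and "S \<subseteq> {s. \<forall>i. s i \<in> Si i}"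
    and "irreducible_chain S K"
    and "\<And>s. s \<in> S \<Longrightarrow> pmf (K s) s > 0"
    and "stationary_distribution S K \<pi>"
    and "\<And>bmax. set_pmf (\<mu> bmax) \<subseteq> S \<times> {0..int bmax}"
    and "\<And>i. drift S \<pi> i > 0"
  shows "\<exists>c::ereal. c > 0 \<and>
           (c = \<infinity> \<longleftrightarrow> (\<forall>\<^sub>F bmax in sequentially. LLR_opt S K (\<mu> bmax) bmax = 0)) \<and>
           limsup (\<lambda>bmax. log_ext (LLR_opt S K (\<mu> bmax) bmax) / ereal (real bmax)) = - c"
proof -
  interpret battery S K \<pi> by unfold_locales (use assms in auto)
  note \<mu> = assms(7)
  define f where "f b = LLR_opt S K (\<mu> b) b" for b
  define q where "q b = log_ext (f b) / ereal (real b)" for b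
  obtain C \<theta> where C: "C > 0" and \<theta>: "\<theta> > 0" and
    up: "\<And>b. \<exists>p\<in>feasible_policies S K (\<mu> b) b. LLR_sys K (\<mu> b) p \<le> C * exp (- \<theta> * real (b div CARD('n)))"
    using private_shares_policy \<mu> by metis
  have bdd: "bdd_below (LLR_sys K (\<mu> b) ` feasible_policies S K (\<mu> b) b)" for b
    using LLR_sys_nonneg[OF _ \<mu>] by (intro bdd_belowI[of _ 0]) auto
  have ne: "feasible_policies S K (\<mu> b) b \<noteq> {}" for b using up[of b] by auto
  have f_le: "f b \<le> LLR_sys K (\<mu> b) p" if "p \<in> feasible_policies S K (\<mu> b) b" for b p
    unfolding f_def LLR_opt_def using bdd that by (rule cINF_lower)
  have f_ge: "a \<le> f b" if "\<And>p. p \<in> feasible_policies S K (\<mu> b) b \<Longrightarrow> a \<le> LLR_sys K (\<mu> b) p" for a b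
    unfolding f_def LLR_opt_def using ne that by (rule cINF_greatest)
  have f0: "f b \<ge> 0" for b by (rule f_ge) (rule LLR_sys_nonneg[OF _ \<mu>])
  have f_up: "f b \<le> C * exp (- \<theta> * real (b div CARD('n)))" for b
    using up[of b] f_le order_trans by blast
  have "limsup q < 0"
  proof -
    \<comment> \<open>Rounding in \<open>b div CARD('n)\<close> loses less than 1, which costs at
      most the additive constant \<theta> in the logarithm.\<close>
    let ?u = "\<lambda>b :: nat. (ln C + \<theta>) * inverse (real b) + - \<theta> / real CARD('n)"
    have "\<forall>\<^sub>F b in sequentially. q b \<le> ereal (?u b)"
    proof (rule eventually_sequentiallyI[of 1])
      fix b :: nat assume b: "1 \<le> b"
      show "q b \<le> ereal (?u b)"
      proof (cases "f b = 0")
        case True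
        then show ?thesis using b by (simp add: q_def log_ext_def)
      next
        case False
        then have pos: "f b > 0" using f0[of b] by simp
        have "real b < real CARD('n) * (real (b div CARD('n)) + 1)"
        proof -
          have "b < CARD('n) * (b div CARD('n) + 1)"
            using dividend_less_times_div[of "CARD('n)" b] by simp
          then have "real b < real (CARD('n) * (b div CARD('n) + 1))" by (simp only: of_nat_less_iff)
          then show ?thesis by (simp add: distrib_left)
        qed
        then have "real b / real CARD('n) \<le> real (b div CARD('n)) + 1"
          by (simp add: pos_divide_le_eq mult.commute)
        then have "\<theta> * (real b / real CARD('n)) \<le> \<theta> * (real (b div CARD('n)) + 1)"
          using \<theta> by (intro mult_left_mono) auto
        moreover have "ln (f b) \<le> ln (C * exp (- \<theta> * real (b div CARD('n))))"
          using pos f_up[of b] by simp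
        then have "ln (f b) \<le> ln C - \<theta> * real (b div CARD('n))" using C by (simp add: ln_mult)
        ultimately have "ln (f b) \<le> ln C + \<theta> - \<theta> * (real b / real CARD('n))" by (simp add: algebra_simps)
        then have "ln (f b) / real b \<le> (ln C + \<theta> - \<theta> * (real b / real CARD('n))) / real b"
          by (intro divide_right_mono) auto
        also have "\<dots> = ?u b" using b by (simp add: field_simps)
        finally show ?thesis using False b by (simp add: q_def log_ext_def)
      qed
    qed
    then have "limsup q \<le> limsup (\<lambda>b. ereal (?u b))" by (rule Limsup_mono)
    also have "?u \<longlonglongrightarrow> 0 + - \<theta> / real CARD('n)"
      by (intro tendsto_add tendsto_const tendsto_mult_right_zero lim_inverse_n)
    then have "(\<lambda>b. ereal (?u b)) \<longlonglongrightarrow> ereal (- \<theta> / real CARD('n))" by simp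
    then have "limsup (\<lambda>b. ereal (?u b)) = ereal (- \<theta> / real CARD('n))"
      by (intro lim_imp_Limsup) auto
    also have "\<dots> < 0" using \<theta> by simp
    finally show ?thesis .
  qed
  moreover have "limsup q = - \<infinity> \<longleftrightarrow> (\<forall>\<^sub>F b in sequentially. f b = 0)"
  proof
    assume "\<forall>\<^sub>F b in sequentially. f b = 0"
    then have "\<forall>\<^sub>F b in sequentially. q b = - \<infinity>"
      using eventually_ge_at_top[of 1] by eventually_elim (simp add: q_def log_ext_def)
    then have "limsup q = limsup (\<lambda>_ :: nat. - \<infinity> :: ereal)" by (rule Limsup_eq)
    then show "limsup q = - \<infinity>" by (simp add: Limsup_const)
  next
    assume lim: "limsup q = - \<infinity>"
    show "\<forall>\<^sub>F b in sequentially. f b = 0"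
    proof (cases "\<exists>s\<in>S. (\<Sum>i\<in>needy. s i) < 0")
      case True
      then obtain s where "s \<in> S" "(\<Sum>i\<in>needy. s i) < 0" by auto
      from LLR_sys_exponential_lower_bound[OF this] obtain \<kappa> r where \<kappa>: "\<kappa> > 0" "r > 0" and
        low: "\<And>b p. p \<in> feasible_policies S K (\<mu> b) b \<Longrightarrow> \<kappa> * r ^ b \<le> LLR_sys K (\<mu> b) p"
        using \<mu> by metis
      let ?l = "\<lambda>b :: nat. ln \<kappa> * inverse (real b) + ln r"
      have "\<forall>\<^sub>F b in sequentially. ereal (?l b) \<le> q b"
      proof (rule eventually_sequentiallyI[of 1])
        fix b :: nat assume b: "1 \<le> b"
        have fb: "\<kappa> * r ^ b \<le> f b" by (rule f_ge) (rule low)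
        have pos: "\<kappa> * r ^ b > 0" using \<kappa> by simp
        then have "ln (\<kappa> * r ^ b) \<le> ln (f b)" using fb by simp
        then have "ln \<kappa> + real b * ln r \<le> ln (f b)" using \<kappa> by (simp add: ln_mult ln_realpow)
        then have "(ln \<kappa> + real b * ln r) / real b \<le> ln (f b) / real b" by (intro divide_right_mono) auto
        moreover have "(ln \<kappa> + real b * ln r) / real b = ?l b" using b by (simp add: field_simps)
        moreover have "f b \<noteq> 0" using fb pos by linarith
        ultimately show "ereal (?l b) \<le> q b" using b by (simp add: q_def log_ext_def)
      qed
      then have "limsup (\<lambda>b. ereal (?l b)) \<le> limsup q" by (rule Limsup_mono)
      moreover have "?l \<longlonglongrightarrow> 0 + ln r"
        by (intro tendsto_add tendsto_const tendsto_mult_right_zero lim_inverse_n)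
      then have "(\<lambda>b. ereal (?l b)) \<longlonglongrightarrow> ereal (ln r)" by simp
      then have "limsup (\<lambda>b. ereal (?l b)) = ereal (ln r)" by (intro lim_imp_Limsup) auto
      ultimately show ?thesis using lim by simp
    next
      case False
      have "\<forall>\<^sub>F bmax in sequentially. \<forall>\<mu>. set_pmf \<mu> \<subseteq> S \<times> {0..int bmax} \<longrightarrow>
          (\<exists>p\<in>feasible_policies S K \<mu> bmax. LLR_sys K \<mu> p = 0)"
        by (rule eventually_lossless) (use False in force)
      then show ?thesis
      proof eventually_elim
        case (elim b)
        from elim[rule_format, OF \<mu>]
        obtain p where "p \<in> feasible_policies S K (\<mu> b) b" "LLR_sys K (\<mu> b) p = 0" by blast
        then show ?case using f_le[of p b] f0[of b] by linarith
      qed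
    qed
  qed
  ultimately show ?thesis
    unfolding f_def[symmetric] q_def[symmetric]
    by (intro exI[of _ "- limsup q"]) (simp add: ereal_uminus_eq_reorder)
qed

end
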